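(* Let $R:S^1\to\mathbb{R}$ satisfy the standing assumptions in the context. Assume that the equation $q^2=R(y)$ has a solution $y\in S^1$ for some non-negative integer $q$, and that no solution $y$ of $q^2=R(y)$, for any non-negative integer $q$, is a stationary point of $R$. Define $\eta:\Phi\to\Phi^*$ by $$\eta(f)[g]=(2\pi)^2\sum_{m\in\mathbb{Z}}\ \sum_{y\in S^1:\,R(y)=m^2}\frac{\overline{f_m(y)}\,g_m(y)}{|R'(y)|},\qquad f,g\in\Phi .$$ Then $\eta$ is a rigging map, its image is nontrivial and finite dimensional, and the representation of $\mathcal{A}_{\mathrm{obs}}$ on the physical Hilbert space $\mathcal{H}_{\mathrm{RAQ}}:=\eta(\Phi)$ is irreducible, i.e. every linear subspace $V\subset\mathcal{H}_{\mathrm{RAQ}}$ with $V\neq\{0\}$ that is invariant under $\mathcal{A}_{\mathrm{obs}}$ equals $\mathcal{H}_{\mathrm{RAQ}}$.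
   Context: $S^1=\mathbb{R}/2\pi\mathbb{Z}$, and $\mathcal{C}=S^1\times S^1$ has coordinates $(x,y)$. Standing assumptions on $R:S^1\to\mathbb{R}$: $R$ is smooth, is positive somewhere, has at most finitely many stationary points (points with $R'=0$), at each stationary point some derivative of $R$ (of order $\ge 1$) is nonvanishing, and no zero of $R$ is a stationary point. $\mathcal{H}_{\mathrm{aux}}=L^2(\mathcal{C},dx\,dy)$ with inner product $(\phi_1,\phi_2)_{\mathrm{aux}}=\int dx\,dy\,\overline{\phi_1}\phi_2$. The constraint operator $\hat C=-\partial^2/\partial x^2-R(y)$ is essentially self-adjoint, and $U(t):=e^{-it\hat C}$, $t\in\mathbb{R}$. The test space $\Phi\subset\mathcal{H}_{\mathrm{aux}}$ is the dense subspace of functions $f(x,y)=\sum_{m\in\mathbb{Z}}e^{imx}f_m(y)$ with each $f_m:S^1\to\mathbb{C}$ smooth and only finitely many $f_m$ nonzero. It is invariant under $U(t)$: $(U(t)f)(x,y)=\sum_m e^{-it[m^2-R(y)]}e^{imx}f_m(y)$. $\Phi^*$ is the algebraic dual of $\Phi$; $\xi[g]$ denotes the action of $\xi\in\Phi^*$ on $g\in\Phi$. $\mathcal{A}_{\mathrm{obs}}$ is the algebra of (linear, densely defined) operators $\mathcal{O}$ on $\mathcal{H}_{\mathrm{aux}}$ such that the domains of $\mathcal{O}$ and its adjoint $\mathcal{O}^\dagger$ include $\Phi$, both $\mathcal{O}$ and $\mathcal{O}^\dagger$ map $\Phi$ into $\Phi$, and $\mathcal{O}$ commutes with $U(t)$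 on $\Phi$ for all $t\in\mathbb{R}$. A rigging map is an antilinear map $\eta:\Phi\to\Phi^*$ that is (i) real: $\eta(f)[g]=\overline{\eta(g)[f]}$; (ii) positive: $\eta(f)[f]\ge0$; (iii) has $U(t)$-invariant image: $\eta(f)[U(t)g]=\eta(f)[g]$ for all $t\in\mathbb{R}$; (iv) intertwining: $\eta(\mathcal{O}f)[g]=\eta(f)[\mathcal{O}^\dagger g]$ for all $\mathcal{O}\in\mathcal{A}_{\mathrm{obs}}$; all for all $f,g\in\Phi$. For a rigging map $\eta$ with finite-dimensional image, the physical Hilbert space is $\eta(\Phi)$ with inner product $(\eta(\phi_1),\eta(\phi_2))_{\mathrm{RAQ}}:=\eta(\phi_2)[\phi_1]$, and $\mathcal{O}\in\mathcal{A}_{\mathrm{obs}}$ acts on it by $\eta(\phi)\mapsto\eta(\mathcal{O}\phi)$. A subspace $V$ is invariant under $\mathcal{A}_{\mathrm{obs}}$ if $\eta(\phi)\in V$ implies $\eta(\mathcal{O}\phi)\in V$ for all $\mathcal{O}\in\mathcal{A}_{\mathrm{obs}}$. *)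

theory Defs
  imports "HOL-Analysis.Analysis" "HOL-Library.Function_Algebras"
begin

section \<open>Smooth functions on the circle\<close>

text \<open>
  The circle \<open>\<real>/2\<pi>\<int>\<close> is handled through \<open>2\<pi>\<close>-periodic functions on the real line; the
  half-open interval \<open>{0..<2*pi}\<close> contains each of its points exactly once.
\<close>

definition vderiv :: "(real \<Rightarrow> 'a::real_normed_vector) \<Rightarrow> real \<Rightarrow> 'a" where
  "vderiv f = (\<lambda>y. vector_derivative f (at y))"

definition smooth :: "(real \<Rightarrow> 'a::real_normed_vector) \<Rightarrow> bool" where
  "smooth f \<longleftrightarrow> (\<forall>k y. (vderiv ^^ k) f differentiable at y)"

definition circle_smooth :: "(real \<Rightarrow> 'a::real_normed_vector) \<Rightarrow> bool" where
  "circle_smooth f \<longleftrightarrow> smooth f \<and> (\<forall>y. f (y + 2*pi) = f y)"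

definition standing_assumptions :: "(real \<Rightarrow> real) \<Rightarrow> bool" where
  "standing_assumptions R \<longleftrightarrow>
     circle_smooth R \<and>
     (\<exists>y. R y > 0) \<and>
     finite {y \<in> {0..<2*pi}. vderiv R y = 0} \<and>
     (\<forall>y. vderiv R y = 0 \<longrightarrow> (\<exists>k\<ge>1. (vderiv ^^ k) R y \<noteq> 0)) \<and>
     (\<forall>y. R y = 0 \<longrightarrow> vderiv R y \<noteq> 0)"


section \<open>The auxiliary Hilbert space\<close>

definition torus :: "(real \<times> real) measure" where
  "torus = restrict_space lborel ({0..<2*pi} \<times> {0..<2*pi})"

definition sq_integrable :: "(real \<times> real \<Rightarrow> complex) \<Rightarrow> bool" where
  "sq_integrable f \<longleftrightarrow>
     f \<in> borel_measurable torus \<and> integrable torus (\<lambda>p. (cmod (f p))\<^sup>2)"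

definition ae_eq :: "(real \<times> real \<Rightarrow> complex) \<Rightarrow> (real \<times> real \<Rightarrow> complex) \<Rightarrow> bool" where
  "ae_eq f g \<longleftrightarrow> sq_integrable f \<and> sq_integrable g \<and> (AE p in torus. f p = g p)"

lemma ae_eq_refl: "ae_eq f f \<longleftrightarrow> sq_integrable f"
  by (simp add: ae_eq_def)

lemma ae_eqI: "sq_integrable f \<Longrightarrow> (\<And>p. f p = g p) \<Longrightarrow> ae_eq f g"
  by (simp add: ae_eq_def ext[of f g])

lemma sq_integrable_zero: "sq_integrable (\<lambda>_. 0)"
  by (simp add: sq_integrable_def)

lemma sq_integrable_scale:
  assumes "sq_integrable f"
  shows "sq_integrable (\<lambda>p. a * f p)"
  using assms by (auto simp: sq_integrable_def norm_mult power_mult_distrib)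

lemma sq_integrable_add:
  assumes "sq_integrable f" "sq_integrable g"
  shows "sq_integrable (\<lambda>p. f p + g p)"
  unfolding sq_integrable_def
proof (intro conjI)
  have [measurable]: "f \<in> borel_measurable torus" "g \<in> borel_measurable torus"
    using assms by (auto simp: sq_integrable_def)
  show "(\<lambda>p. f p + g p) \<in> borel_measurable torus" by measurable
  show "integrable torus (\<lambda>p. (cmod (f p + g p))\<^sup>2)"
  proof (rule Bochner_Integration.integrable_bound)
    show "integrable torus (\<lambda>p. 2 * (cmod (f p))\<^sup>2 + 2 * (cmod (g p))\<^sup>2)"
      using assms by (auto simp: sq_integrable_def)
    show "(\<lambda>p. (cmod (f p + g p))\<^sup>2) \<in> borel_measurable torus" by measurable
    have "(cmod (a + b))\<^sup>2 \<le> 2 * (cmod a)\<^sup>2 + 2 * (cmod b)\<^sup>2" for a b :: complex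
    proof -
      have "(cmod (a + b))\<^sup>2 \<le> (cmod a + cmod b)\<^sup>2"
        by (intro power_mono norm_triangle_ineq) auto
      also have "\<dots> \<le> 2 * (cmod a)\<^sup>2 + 2 * (cmod b)\<^sup>2"
        using sum_squares_bound[of "cmod a" "cmod b"] by (simp add: power2_sum)
      finally show ?thesis .
    qed
    then show "AE p in torus. norm ((cmod (f p + g p))\<^sup>2)
        \<le> norm (2 * (cmod (f p))\<^sup>2 + 2 * (cmod (g p))\<^sup>2)"
      by simp
  qed
qed

lemma borel_measurable_cnj_borel [measurable]: "cnj \<in> borel_measurable borel"
  by (intro borel_measurable_continuous_onI continuous_intros)

lemma sq_integrable_product:
  assumes "sq_integrable f" "sq_integrable g"
  shows "integrable torus (\<lambda>p. cnj (f p) * g p)"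
proof (rule Bochner_Integration.integrable_bound)
  have [measurable]: "f \<in> borel_measurable torus" "g \<in> borel_measurable torus"
    using assms by (auto simp: sq_integrable_def)
  show "integrable torus (\<lambda>p. (cmod (f p))\<^sup>2 + (cmod (g p))\<^sup>2)"
    using assms by (auto simp: sq_integrable_def)
  show "(\<lambda>p. cnj (f p) * g p) \<in> borel_measurable torus" by measurable
  have "cmod a * cmod b \<le> (cmod a)\<^sup>2 + (cmod b)\<^sup>2" for a b :: complex
  proof -
    have "0 \<le> cmod a * cmod b" by simp
    then show ?thesis using sum_squares_bound[of "cmod a" "cmod b"] by linarith
  qed
  then show "AE p in torus. norm (cnj (f p) * g p) \<le> norm ((cmod (f p))\<^sup>2 + (cmod (g p))\<^sup>2)"
    by (simp add: norm_mult)
qed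

quotient_type aux_space = "real \<times> real \<Rightarrow> complex" / partial: ae_eq
proof (rule part_equivpI)
  show "\<exists>f. ae_eq f f" using sq_integrable_zero ae_eq_refl by blast
  show "symp ae_eq" by (rule sympI) (auto simp: ae_eq_def)
  show "transp ae_eq" by (rule transpI) (auto simp: ae_eq_def)
qed

lift_definition scaleC :: "complex \<Rightarrow> aux_space \<Rightarrow> aux_space" (infixr "*\<^sub>C" 75)
  is "\<lambda>a f p. a * f p"
  by (auto simp: ae_eq_def sq_integrable_scale)

lift_definition inner_aux :: "aux_space \<Rightarrow> aux_space \<Rightarrow> complex"
  is "\<lambda>f g. LINT p|torus. cnj (f p) * g p"
proof -
  fix f f' g g' assume *: "ae_eq f f'" "ae_eq g g'"
  then have [measurable]: "f \<in> borel_measurable torus" "g \<in> borel_measurable torus"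
      "f' \<in> borel_measurable torus" "g' \<in> borel_measurable torus"
    by (auto simp: ae_eq_def sq_integrable_def)
  show "(LINT p|torus. cnj (f p) * g p) = (LINT p|torus. cnj (f' p) * g' p)"
    using * by (intro integral_cong_AE) (auto simp: ae_eq_def)
qed

instantiation aux_space :: real_vector
begin

lift_definition zero_aux_space :: aux_space is "\<lambda>_. 0"
  by (simp add: ae_eq_refl sq_integrable_zero)

lift_definition plus_aux_space :: "aux_space \<Rightarrow> aux_space \<Rightarrow> aux_space" is "\<lambda>f g p. f p + g p"
  by (auto simp: ae_eq_def sq_integrable_add)

definition uminus_aux_space :: "aux_space \<Rightarrow> aux_space" where
  "uminus_aux_space \<phi> = (-1) *\<^sub>C \<phi>"

definition minus_aux_space :: "aux_space \<Rightarrow> aux_space \<Rightarrow> aux_space" where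
  "minus_aux_space \<phi> \<psi> = \<phi> + (-1) *\<^sub>C \<psi>"

definition scaleR_aux_space :: "real \<Rightarrow> aux_space \<Rightarrow> aux_space" where
  "scaleR_aux_space r \<phi> = of_real r *\<^sub>C \<phi>"

lemma scaleC_add_right: "a *\<^sub>C (\<phi> + \<psi>) = a *\<^sub>C \<phi> + a *\<^sub>C (\<psi> :: aux_space)"
  by transfer (rule ae_eqI; simp add: ae_eq_refl sq_integrable_add sq_integrable_scale distrib_left)

lemma scaleC_add_left: "(a + b) *\<^sub>C \<phi> = a *\<^sub>C \<phi> + b *\<^sub>C (\<phi> :: aux_space)"
  by transfer (rule ae_eqI; simp add: ae_eq_refl sq_integrable_add sq_integrable_scale distrib_right)

lemma scaleC_scaleC: "a *\<^sub>C b *\<^sub>C \<phi> = (a * b) *\<^sub>C (\<phi> :: aux_space)"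
  by transfer (rule ae_eqI; simp add: ae_eq_refl sq_integrable_scale mult.assoc)

lemma scaleC_one: "1 *\<^sub>C \<phi> = (\<phi> :: aux_space)"
  by transfer (rule ae_eqI; simp add: ae_eq_refl)

instance
proof
  fix \<phi> \<psi> \<omega> :: aux_space and r s :: real
  show "\<phi> + \<psi> + \<omega> = \<phi> + (\<psi> + \<omega>)"
    by transfer (rule ae_eqI; simp add: ae_eq_refl sq_integrable_add algebra_simps)
  show "\<phi> + \<psi> = \<psi> + \<phi>"
    by transfer (rule ae_eqI; simp add: ae_eq_refl sq_integrable_add algebra_simps)
  show "0 + \<phi> = \<phi>"
    by transfer (rule ae_eqI; simp add: ae_eq_refl)
  show "- \<phi> + \<phi> = 0" unfolding uminus_aux_space_def
    by transfer (rule ae_eqI; simp add: ae_eq_refl sq_integrable_zero)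
  show "\<phi> - \<psi> = \<phi> + - \<psi>"
    by (simp add: minus_aux_space_def uminus_aux_space_def)
  show "r *\<^sub>R (\<phi> + \<psi>) = r *\<^sub>R \<phi> + r *\<^sub>R \<psi>" unfolding scaleR_aux_space_def
    by (rule scaleC_add_right)
  show "(r + s) *\<^sub>R \<phi> = r *\<^sub>R \<phi> + s *\<^sub>R \<phi>" unfolding scaleR_aux_space_def
    by (simp add: scaleC_add_left)
  show "r *\<^sub>R s *\<^sub>R \<phi> = (r * s) *\<^sub>R \<phi>" unfolding scaleR_aux_space_def
    by (simp add: scaleC_scaleC)
  show "1 *\<^sub>R \<phi> = \<phi>" unfolding scaleR_aux_space_def
    by (simp add: scaleC_one)
qed

end

interpretation aux: vector_space scaleC
  by unfold_locales (simp_all add: scaleC_add_right scaleC_add_left scaleC_scaleC scaleC_one)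

lemma inner_aux_add_left: "inner_aux (\<phi> + \<psi>) \<omega> = inner_aux \<phi> \<omega> + inner_aux \<psi> \<omega>"
  by transfer (simp add: ae_eq_refl sq_integrable_product distrib_right)

lemma inner_aux_add_right: "inner_aux \<omega> (\<phi> + \<psi>) = inner_aux \<omega> \<phi> + inner_aux \<omega> \<psi>"
  by transfer (simp add: ae_eq_refl sq_integrable_product distrib_left)

lemma inner_aux_scale_left: "inner_aux (a *\<^sub>C \<phi>) \<psi> = cnj a * inner_aux \<phi> \<psi>"
  by transfer (simp add: mult.assoc)

lemma inner_aux_scale_right: "inner_aux \<phi> (a *\<^sub>C \<psi>) = a * inner_aux \<phi> \<psi>"
  by transfer (simp add: mult.left_commute)

lemma inner_aux_commute: "inner_aux \<psi> \<phi> = cnj (inner_aux \<phi> \<psi>)"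
  by transfer (simp add: mult.commute flip: Bochner_Integration.integral_cnj)

lift_definition sq_norm :: "aux_space \<Rightarrow> real" is "\<lambda>f. LINT p|torus. (cmod (f p))\<^sup>2"
proof -
  fix f f' assume *: "ae_eq f f'"
  then have [measurable]: "f \<in> borel_measurable torus" "f' \<in> borel_measurable torus"
    by (auto simp: ae_eq_def sq_integrable_def)
  show "(LINT p|torus. (cmod (f p))\<^sup>2) = (LINT p|torus. (cmod (f' p))\<^sup>2)"
    using * by (intro integral_cong_AE) (auto simp: ae_eq_def)
qed

lemma inner_aux_self: "inner_aux \<phi> \<phi> = of_real (sq_norm \<phi>)"
proof (transfer)
  fix f
  have "cnj (f p) * f p = of_real ((cmod (f p))\<^sup>2)" for p :: "real \<times> real"
    by (simp only: complex_norm_square mult.commute)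
  then show "(LINT p|torus. cnj (f p) * f p) = of_real (LINT p|torus. (cmod (f p))\<^sup>2)"
    by (simp only: integral_complex_of_real)
qed

lemma sq_norm_nonneg: "sq_norm \<phi> \<ge> 0"
  by transfer simp

lemma sq_norm_eq_0_iff: "sq_norm \<phi> = 0 \<longleftrightarrow> \<phi> = 0"
proof (transfer)
  fix f assume "ae_eq f f"
  then have f: "sq_integrable f" by (simp add: ae_eq_refl)
  then have "(LINT p|torus. (cmod (f p))\<^sup>2) = 0 \<longleftrightarrow> (AE p in torus. (cmod (f p))\<^sup>2 = 0)"
    by (intro integral_nonneg_eq_0_iff_AE) (auto simp: sq_integrable_def)
  then show "(LINT p|torus. (cmod (f p))\<^sup>2) = 0 \<longleftrightarrow> ae_eq f (\<lambda>_. 0)"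
    using f by (simp add: ae_eq_def sq_integrable_zero)
qed

instantiation aux_space :: real_inner
begin

definition inner_aux_space :: "aux_space \<Rightarrow> aux_space \<Rightarrow> real" where
  "inner_aux_space \<phi> \<psi> = Re (inner_aux \<phi> \<psi>)"

definition norm_aux_space :: "aux_space \<Rightarrow> real" where
  "norm_aux_space \<phi> = sqrt (Re (inner_aux \<phi> \<phi>))"

definition sgn_aux_space :: "aux_space \<Rightarrow> aux_space" where
  "sgn_aux_space \<phi> = \<phi> /\<^sub>R norm \<phi>"

definition dist_aux_space :: "aux_space \<Rightarrow> aux_space \<Rightarrow> real" where
  "dist_aux_space \<phi> \<psi> = norm (\<phi> - \<psi>)"

definition uniformity_aux_space :: "(aux_space \<times> aux_space) filter" where
  "uniformity_aux_space = (INF e\<in>{0<..}. principal {(\<phi>, \<psi>). dist \<phi> \<psi> < e})"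

definition open_aux_space :: "aux_space set \<Rightarrow> bool" where
  "open_aux_space S \<longleftrightarrow> (\<forall>\<phi>\<in>S. eventually (\<lambda>(\<phi>', \<psi>). \<phi>' = \<phi> \<longrightarrow> \<psi> \<in> S) uniformity)"

instance
proof
  fix \<phi> \<psi> \<omega> :: aux_space and r :: real
  show "dist \<phi> \<psi> = norm (\<phi> - \<psi>)" by (rule dist_aux_space_def)
  show "inner \<phi> \<psi> = inner \<psi> \<phi>"
    unfolding inner_aux_space_def by (subst inner_aux_commute) simp
  show "inner (\<phi> + \<psi>) \<omega> = inner \<phi> \<omega> + inner \<psi> \<omega>"
    by (simp add: inner_aux_space_def inner_aux_add_left)
  show "inner (r *\<^sub>R \<phi>) \<psi> = r * inner \<phi> \<psi>"
    by (simp add: inner_aux_space_def scaleR_aux_space_def inner_aux_scale_left)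
  show "0 \<le> inner \<phi> \<phi>"
    by (simp add: inner_aux_space_def inner_aux_self sq_norm_nonneg)
  show "(inner \<phi> \<phi> = 0) = (\<phi> = 0)"
    by (simp add: inner_aux_space_def inner_aux_self sq_norm_eq_0_iff)
  show "norm \<phi> = sqrt (inner \<phi> \<phi>)"
    by (simp add: inner_aux_space_def norm_aux_space_def)
qed (rule sgn_aux_space_def uniformity_aux_space_def open_aux_space_def)+

end


section \<open>The test space\<close>

definition modes :: "(int \<Rightarrow> real \<Rightarrow> complex) set" where
  "modes = {c. (\<forall>m. circle_smooth (c m)) \<and> finite {m. c m \<noteq> (\<lambda>_. 0)}}"

definition mode_sum :: "(int \<Rightarrow> real \<Rightarrow> complex) \<Rightarrow> real \<times> real \<Rightarrow> complex" where
  "mode_sum c = (\<lambda>(x, y). \<Sum>m | c m \<noteq> (\<lambda>_. 0). exp (\<i> * of_int m * of_real x) * c m y)"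

definition test_fun :: "(int \<Rightarrow> real \<Rightarrow> complex) \<Rightarrow> aux_space" where
  "test_fun c = abs_aux_space (mode_sum c)"

definition test_space :: "aux_space set" ("\<Phi>") where
  "\<Phi> = test_fun ` modes"

lemma exp_mode_deriv:
  "((\<lambda>x. exp (\<i> * of_int m * of_real x)) has_vector_derivative
     \<i> * of_int m * exp (\<i> * of_int m * of_real x)) (at x within S)"
proof -
  have "((\<lambda>z. exp (\<i> * of_int m * z)) has_field_derivative
      \<i> * of_int m * exp (\<i> * of_int m * of_real x)) (at (of_real x))"
    by (auto intro!: derivative_eq_intros)
  from has_vector_derivative_real_field[OF this]
  show ?thesis by (rule has_vector_derivative_at_within)
qed

lemma integral_exp_mode:
  "((\<lambda>x. exp (\<i> * of_int k * of_real x)) has_integral (if k = 0 then 2 * of_real pi else 0)) {0..2*pi}"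
proof (cases "k = 0")
  case True
  then show ?thesis using has_integral_const_real[of "1::complex" 0 "2*pi"]
    by (simp add: scaleR_conv_of_real)
next
  case False
  have "((\<lambda>x. exp (\<i> * of_int k * of_real x) / (\<i> * of_int k)) has_vector_derivative
      exp (\<i> * of_int k * of_real x)) (at x within {0..2*pi})" for x
    using has_vector_derivative_divide[OF exp_mode_deriv[of k x "{0..2*pi}"], of "\<i> * of_int k"] False
    by simp
  then have "((\<lambda>x. exp (\<i> * of_int k * of_real x)) has_integral
      exp (\<i> * of_int k * of_real (2*pi)) / (\<i> * of_int k)
      - exp (\<i> * of_int k * of_real 0) / (\<i> * of_int k)) {0..2*pi}"
    by (intro fundamental_theorem_of_calculus) auto
  moreover have "exp (\<i> * of_int k * of_real (2*pi)) = 1"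
    using exp_integer_2pi[of "of_int k"] by (simp add: mult_ac)
  ultimately show ?thesis using False by simp
qed

lemma continuous_circle_smooth: "circle_smooth f \<Longrightarrow> continuous_on S f"
  unfolding circle_smooth_def smooth_def
  by (metis continuous_at_imp_continuous_on differentiable_imp_continuous_within funpow_0)

lemma continuous_mode_sum:
  assumes "c \<in> modes"
  shows "continuous_on UNIV (mode_sum c)"
proof -
  have *: "continuous_on UNIV (\<lambda>p :: real \<times> real. c m (snd p))" for m
  proof (rule continuous_on_compose2[of UNIV "c m" UNIV snd])
    show "continuous_on UNIV (c m)"
      using assms continuous_circle_smooth by (auto simp: modes_def)
    show "continuous_on UNIV (snd :: real \<times> real \<Rightarrow> real)"
      by (rule continuous_on_snd[OF continuous_on_id])
  qed auto
  have **: "continuous_on UNIV (\<lambda>p :: real \<times> real. exp (\<i> * of_int m * complex_of_real (fst p)))" for m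
    by (intro continuous_intros)
  have "mode_sum c = (\<lambda>p. \<Sum>m | c m \<noteq> (\<lambda>_. 0).
      exp (\<i> * of_int m * complex_of_real (fst p)) * c m (snd p))"
    by (auto simp: mode_sum_def)
  then show ?thesis
    by (simp only:) (rule continuous_on_sum, rule continuous_on_mult[OF ** *])
qed

lemma square_borel: "{0..<2*pi} \<times> {0..<2*pi} \<in> sets (borel :: (real \<times> real) measure)"
proof -
  have "{0..<2*pi} \<times> {0..<2*pi} \<in> sets (borel \<Otimes>\<^sub>M borel :: (real \<times> real) measure)"
    by (intro pair_measureI) auto
  then show ?thesis by (simp only: borel_prod)
qed

lemma finite_measure_torus: "finite_measure torus"
proof (rule finite_measureI)
  have "emeasure torus (space torus) = emeasure lborel ({0..<2*pi} \<times> {0..<2*pi} :: (real \<times> real) set)"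
    unfolding torus_def using square_borel
    by (subst emeasure_restrict_space) (simp_all add: space_restrict_space)
  also have "\<dots> \<le> emeasure lborel ({0..2*pi} \<times> {0..2*pi} :: (real \<times> real) set)"
    by (intro emeasure_mono) (simp_all add: subset_iff closed_Times borel_closed)
  also have "\<dots> < \<infinity>"
    by (intro emeasure_compact_finite compact_Times compact_Icc)
  finally show "emeasure torus (space torus) \<noteq> \<infinity>" by simp
qed

lemma sq_integrable_continuous:
  assumes "continuous_on UNIV f"
  shows "sq_integrable f"
  unfolding sq_integrable_def
proof
  interpret finite_measure torus by (rule finite_measure_torus)
  have "f \<in> borel_measurable borel"
    using assms by (rule borel_measurable_continuous_onI)
  then show f: "f \<in> borel_measurable torus"
    unfolding torus_def by (intro measurable_restrict_space1) simp
  have "compact (f ` ({0..2*pi} \<times> {0..2*pi}))"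
    by (intro compact_continuous_image continuous_on_subset[OF assms] compact_Times compact_Icc) simp
  then have "bounded (f ` ({0..2*pi} \<times> {0..2*pi}))" by (rule compact_imp_bounded)
  then obtain B where B: "\<And>p. p \<in> {0..2*pi} \<times> {0..2*pi} \<Longrightarrow> cmod (f p) \<le> B"
    unfolding bounded_iff by blast
  show "integrable torus (\<lambda>p. (cmod (f p))\<^sup>2)"
  proof (rule integrable_const_bound[where B = "B\<^sup>2"])
    have "p \<in> {0..2*pi} \<times> {0..2*pi}" if "p \<in> space torus" for p
      using that by (cases p) (simp add: torus_def space_restrict_space)
    then show "AE p in torus. norm ((cmod (f p))\<^sup>2) \<le> B\<^sup>2"
      by (intro AE_I2) (simp add: power_mono B)
    show "(\<lambda>p. (cmod (f p))\<^sup>2) \<in> borel_measurable torus"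
      using f by measurable
  qed
qed

lemma sq_integrable_mode_sum: "c \<in> modes \<Longrightarrow> sq_integrable (mode_sum c)"
  by (intro sq_integrable_continuous continuous_mode_sum)

lemma mode_sum_superset:
  assumes "finite S" "{m. c m \<noteq> (\<lambda>_. 0)} \<subseteq> S"
  shows "mode_sum c (x, y) = (\<Sum>m\<in>S. exp (\<i> * of_int m * of_real x) * c m y)"
  unfolding mode_sum_def using assms by (auto intro!: sum.mono_neutral_left)

lemma mode_sum_integral:
  assumes "c \<in> modes"
  shows "((\<lambda>x. exp (\<i> * of_int (- n) * of_real x) * mode_sum c (x, y))
     has_integral 2 * of_real pi * c n y) {0..2*pi}"
proof -
  define S where "S = {m. c m \<noteq> (\<lambda>_. 0)}"
  have S: "finite S" using assms by (simp add: modes_def S_def)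
  have "((\<lambda>x. \<Sum>m\<in>S. exp (\<i> * of_int (m - n) * of_real x) * c m y) has_integral
      (\<Sum>m\<in>S. (if m - n = 0 then 2 * of_real pi else 0) * c m y)) {0..2*pi}"
    by (intro has_integral_sum S has_integral_mult_left integral_exp_mode)
  moreover have "(\<Sum>m\<in>S. (if m - n = 0 then 2 * of_real pi else 0) * c m y) = 2 * of_real pi * c n y"
  proof -
    have "(\<Sum>m\<in>S. (if m - n = 0 then 2 * of_real pi else 0) * c m y)
        = (\<Sum>m\<in>S. if m = n then 2 * of_real pi * c n y else 0)"
      by (intro sum.cong) auto
    also have "\<dots> = 2 * of_real pi * c n y"
      using S by (simp add: sum.delta') (simp add: S_def)
    finally show ?thesis .
  qed
  moreover have "(\<Sum>m\<in>S. exp (\<i> * of_int (m - n) * of_real x) * c m y)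
      = exp (\<i> * of_int (- n) * of_real x) * mode_sum c (x, y)" for x
  proof -
    have "exp (\<i> * of_int (m - n) * of_real x) * c m y
        = exp (\<i> * of_int (- n) * of_real x) * (exp (\<i> * of_int m * of_real x) * c m y)" for m
      by (simp add: algebra_simps exp_diff exp_minus divide_inverse)
    then show ?thesis
      by (simp only: mode_sum_superset[OF S, of c] S_def order_refl sum_distrib_left)
  qed
  ultimately show ?thesis by simp
qed

lemma continuous_AE_torus_eq:
  assumes "continuous_on UNIV f" "continuous_on UNIV g" "AE p in torus. f p = g p"
    and "p \<in> {0<..<2*pi} \<times> {0<..<2*pi}"
  shows "f p = (g p :: complex)"
proof -
  define W where "W = ({0<..<2*pi} \<times> {0<..<2*pi}) \<inter> {p. f p \<noteq> g p}"
  have W: "open W" unfolding W_def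
    using assms(1,2) by (intro open_Int open_Times open_Collect_neq) auto
  have "AE p in lborel. p \<in> {0..<2*pi} \<times> {0..<2*pi} \<longrightarrow> f p = g p"
    using assms(3) square_borel unfolding torus_def
    by (subst (asm) AE_restrict_space_iff) simp_all
  then have "AE p in lborel. p \<notin> W" by eventually_elim (auto simp: W_def)
  then have "W \<in> null_sets lborel"
    using W by (subst AE_iff_null_sets) auto
  then have "negligible W"
    by (simp add: negligible_iff_null_sets null_sets_completionI)
  then have "W = {}" using W open_not_negligible by blast
  then show ?thesis using assms(4) by (auto simp: W_def)
qed

text \<open>The Fourier modes of an element of \<open>\<Phi>\<close> are well defined.\<close>

lemma inj_on_test_fun: "inj_on test_fun modes"
proof (rule inj_onI)
  fix c d assume c: "c \<in> modes" and d: "d \<in> modes" and eq: "test_fun c = test_fun d"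
  have "ae_eq (mode_sum c) (mode_sum d)"
    using eq sq_integrable_mode_sum[OF c] sq_integrable_mode_sum[OF d]
      Quotient3_rel[OF Quotient3_aux_space, of "mode_sum c" "mode_sum d"]
    by (simp add: test_fun_def ae_eq_refl)
  then have AE: "AE p in torus. mode_sum c p = mode_sum d p" by (simp add: ae_eq_def)
  have inner: "c n y = d n y" if y: "y \<in> {0<..<2*pi}" for n y
  proof -
    have "((\<lambda>x. exp (\<i> * of_int (- n) * of_real x) * mode_sum d (x, y))
        has_integral 2 * of_real pi * c n y) {0..2*pi}"
      by (rule has_integral_spike[OF _ _ mode_sum_integral[OF c], of "{0, 2*pi}"])
         (use y continuous_AE_torus_eq[OF continuous_mode_sum[OF c] continuous_mode_sum[OF d] AE] in auto)
    then show ?thesis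
      using has_integral_unique[OF _ mode_sum_integral[OF d]] by fastforce
  qed
  show "c = d"
  proof (intro ext)
    fix n y
    have cs: "circle_smooth (c n)" "circle_smooth (d n)" using c d by (auto simp: modes_def)
    have closed: "c n y = d n y" if "y \<in> {0..2*pi}" for y
    proof -
      have "c n y - d n y = 0"
      proof (rule continuous_constant_on_closure[of "{0<..<2*pi}" "\<lambda>y. c n y - d n y"])
        show "continuous_on (closure {0<..<2*pi}) (\<lambda>y. c n y - d n y)"
          using cs by (intro continuous_intros continuous_circle_smooth)
      qed (use that inner in auto)
      then show ?thesis by simp
    qed
    interpret c: periodic_fun_simple "c n" "2*pi"
      using cs by unfold_locales (auto simp: circle_smooth_def)
    interpret d: periodic_fun_simple "d n" "2*pi"
      using cs by unfold_locales (auto simp: circle_smooth_def)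
    define k where "k = \<lfloor>y / (2*pi)\<rfloor>"
    have "of_int k \<le> y / (2*pi)" "y / (2*pi) \<le> of_int k + 1"
      unfolding k_def by linarith+
    then have "y - of_int k * (2*pi) \<in> {0..2*pi}"
      by (auto simp: field_simps)
    from closed[OF this] show "c n y = d n y"
      by (simp only: c.minus_of_int d.minus_of_int)
  qed
qed

definition mode :: "aux_space \<Rightarrow> int \<Rightarrow> real \<Rightarrow> complex" where
  "mode f = inv_into modes test_fun f"

lemma mode_test_fun: "c \<in> modes \<Longrightarrow> mode (test_fun c) = c"
  by (simp add: mode_def inj_on_test_fun)


section \<open>The constraint and the unitary group it generates\<close>

definition constraint ::
    "(real \<Rightarrow> real) \<Rightarrow> (real \<times> real \<Rightarrow> complex) \<Rightarrow> real \<times> real \<Rightarrow> complex" where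
  "constraint R u = (\<lambda>(x, y). - vderiv (vderiv (\<lambda>x'. u (x', y))) x - of_real (R y) * u (x, y))"

definition evolve_modes ::
    "(real \<Rightarrow> real) \<Rightarrow> real \<Rightarrow> (int \<Rightarrow> real \<Rightarrow> complex) \<Rightarrow> int \<Rightarrow> real \<Rightarrow> complex" where
  "evolve_modes R t c = (\<lambda>m y. exp (- \<i> * of_real (t * ((of_int m)\<^sup>2 - R y))) * c m y)"

definition evolve :: "(real \<Rightarrow> real) \<Rightarrow> real \<Rightarrow> aux_space \<Rightarrow> aux_space" where
  "evolve R t f = test_fun (evolve_modes R t (mode f))"

text \<open>
  The unitary group generated by the constraint is needed on \<open>\<Phi>\<close> only, so \<open>evolve\<close> is its explicit
  action there. The following facts justify it: the constraint multiplies the \<open>m\<close>-th mode by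
  \<open>m\<^sup>2 - R(y)\<close>, and \<open>evolve\<close> starts at the identity and solves the Schroedinger equation.
\<close>

lemma constraint_mode_sum:
  assumes "finite {m. c m \<noteq> (\<lambda>_. 0)}"
  shows "constraint R (mode_sum c) = mode_sum (\<lambda>m y. ((of_int m)\<^sup>2 - of_real (R y)) * c m y)"
proof (intro ext, clarify)
  fix x y
  define S where "S = {m. c m \<noteq> (\<lambda>_. 0)}"
  have S: "finite S" using assms by (simp add: S_def)
  have ms: "mode_sum c (x, y) = (\<Sum>m\<in>S. exp (\<i> * of_int m * of_real x) * c m y)" for x
    by (rule mode_sum_superset[OF S]) (simp add: S_def)
  have D: "vderiv (\<lambda>x. \<Sum>m\<in>S. exp (\<i> * of_int m * of_real x) * a m)
      = (\<lambda>x. \<Sum>m\<in>S. exp (\<i> * of_int m * of_real x) * (\<i> * of_int m * a m))" for a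
    unfolding vderiv_def
  proof (intro ext vector_derivative_at)
    fix x
    show "((\<lambda>x. \<Sum>m\<in>S. exp (\<i> * of_int m * of_real x) * a m) has_vector_derivative
        (\<Sum>m\<in>S. exp (\<i> * of_int m * of_real x) * (\<i> * of_int m * a m))) (at x)"
    proof (rule has_vector_derivative_sum)
      fix m
      show "((\<lambda>x. exp (\<i> * of_int m * of_real x) * a m) has_vector_derivative
          exp (\<i> * of_int m * of_real x) * (\<i> * of_int m * a m)) (at x)"
        using has_vector_derivative_mult_left[OF exp_mode_deriv[of m x UNIV], of "a m"]
        by (simp add: mult_ac)
    qed
  qed
  have "constraint R (mode_sum c) (x, y)
      = (\<Sum>m\<in>S. exp (\<i> * of_int m * of_real x) * (((of_int m)\<^sup>2 - of_real (R y)) * c m y))"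
  proof -
    have "vderiv (vderiv (\<lambda>x'. mode_sum c (x', y))) x
        = (\<Sum>m\<in>S. exp (\<i> * of_int m * of_real x) * (\<i> * of_int m * (\<i> * of_int m * c m y)))"
      by (simp only: ms D)
    moreover have "\<i> * of_int m * (\<i> * of_int m * a) = - ((of_int m)\<^sup>2 * a)" for m a
      by (simp add: power2_eq_square algebra_simps)
    ultimately have "vderiv (vderiv (\<lambda>x'. mode_sum c (x', y))) x
        = - (\<Sum>m\<in>S. exp (\<i> * of_int m * of_real x) * ((of_int m)\<^sup>2 * c m y))"
      by (simp only: mult_minus_right sum_negf)
    then show ?thesis
      by (simp add: constraint_def ms sum_distrib_left left_diff_distrib right_diff_distrib
          sum_subtractf mult.left_commute)
  qed
  also have "\<dots> = mode_sum (\<lambda>m y. ((of_int m)\<^sup>2 - of_real (R y)) * c m y) (x, y)"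
    by (rule mode_sum_superset[OF S, symmetric]) (auto simp: S_def)
  finally show "constraint R (mode_sum c) (x, y)
      = mode_sum (\<lambda>m y. ((of_int m)\<^sup>2 - of_real (R y)) * c m y) (x, y)" .
qed

lemma evolve_modes_0: "evolve_modes R 0 c = c"
  by (simp add: evolve_modes_def)

lemma evolve_modes_schroedinger:
  assumes "finite {m. c m \<noteq> (\<lambda>_. 0)}"
  shows "((\<lambda>s. mode_sum (evolve_modes R s c) p) has_vector_derivative
     - \<i> * constraint R (mode_sum (evolve_modes R t c)) p) (at t)"
proof -
  define S where "S = {m. c m \<noteq> (\<lambda>_. 0)}"
  have S: "finite S" using assms by (simp add: S_def)
  obtain x y where p: "p = (x, y)" by (cases p)
  define w where "w = (\<lambda>m. (of_int m)\<^sup>2 - R y)"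
  have ev: "mode_sum (evolve_modes R s c) (x, y)
      = (\<Sum>m\<in>S. exp (\<i> * of_int m * of_real x) * (exp (- \<i> * of_real (s * w m)) * c m y))" for s
    unfolding w_def
    by (subst mode_sum_superset[OF S]) (auto simp: S_def evolve_modes_def)
  have "((\<lambda>s. exp (- \<i> * of_real (s * r))) has_vector_derivative
      - \<i> * (of_real r * exp (- \<i> * of_real (t * r)))) (at t)" for r
  proof -
    have "((\<lambda>z. exp (- \<i> * (z * of_real r))) has_field_derivative
        - \<i> * (of_real r * exp (- \<i> * (of_real t * of_real r)))) (at (of_real t))"
      by (auto intro!: derivative_eq_intros)
    from has_vector_derivative_real_field[OF this] show ?thesis by simp
  qed
  note D = has_vector_derivative_mult_right[OF has_vector_derivative_mult_left[OF this]]
  have "((\<lambda>s. mode_sum (evolve_modes R s c) (x, y)) has_vector_derivative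
      (\<Sum>m\<in>S. exp (\<i> * of_int m * of_real x) *
        (- \<i> * (of_real (w m) * exp (- \<i> * of_real (t * w m))) * c m y))) (at t)"
    unfolding ev by (intro has_vector_derivative_sum D)
  moreover have "constraint R (mode_sum (evolve_modes R t c)) (x, y)
      = (\<Sum>m\<in>S. exp (\<i> * of_int m * of_real x) *
        (of_real (w m) * (exp (- \<i> * of_real (t * w m)) * c m y)))"
  proof -
    have sub: "{m. evolve_modes R t c m \<noteq> (\<lambda>_. 0)} \<subseteq> S"
      by (auto simp: S_def evolve_modes_def)
    then have "finite {m. evolve_modes R t c m \<noteq> (\<lambda>_. 0)}" using S by (rule finite_subset)
    then have "constraint R (mode_sum (evolve_modes R t c)) (x, y)
        = mode_sum (\<lambda>m y. ((of_int m)\<^sup>2 - of_real (R y)) * evolve_modes R t c m y) (x, y)"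
      by (simp only: constraint_mode_sum)
    also have "\<dots> = (\<Sum>m\<in>S. exp (\<i> * of_int m * of_real x) *
        (((of_int m)\<^sup>2 - of_real (R y)) * evolve_modes R t c m y))"
      by (rule mode_sum_superset[OF S]) (auto simp: S_def evolve_modes_def)
    finally show ?thesis by (simp add: w_def evolve_modes_def)
  qed
  ultimately show ?thesis by (simp add: p sum_distrib_left mult_ac flip: sum_negf)
qed


section \<open>Observables\<close>

text \<open>Densely defined operators are partial functions on the auxiliary Hilbert space.\<close>

definition linear_operator :: "(aux_space \<rightharpoonup> aux_space) \<Rightarrow> bool" where
  "linear_operator T \<longleftrightarrow>
     aux.subspace (dom T) \<and>
     (\<forall>\<phi>\<in>dom T. \<forall>\<psi>\<in>dom T. the (T (\<phi> + \<psi>)) = the (T \<phi>) + the (T \<psi>)) \<and>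
     (\<forall>a. \<forall>\<phi>\<in>dom T. the (T (a *\<^sub>C \<phi>)) = a *\<^sub>C the (T \<phi>))"

definition adjoint_op :: "(aux_space \<rightharpoonup> aux_space) \<Rightarrow> aux_space \<rightharpoonup> aux_space" where
  "adjoint_op T = (\<lambda>\<psi>.
     if \<exists>\<omega>. \<forall>\<phi>\<in>dom T. inner_aux \<psi> (the (T \<phi>)) = inner_aux \<omega> \<phi>
     then Some (THE \<omega>. \<forall>\<phi>\<in>dom T. inner_aux \<psi> (the (T \<phi>)) = inner_aux \<omega> \<phi>)
     else None)"

definition observables :: "(real \<Rightarrow> real) \<Rightarrow> (aux_space \<rightharpoonup> aux_space) set" where
  "observables R = {T.
     linear_operator T \<and> closure (dom T) = UNIV \<and>
     \<Phi> \<subseteq> dom T \<and> \<Phi> \<subseteq> dom (adjoint_op T) \<and>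
     (\<forall>f\<in>\<Phi>. the (T f) \<in> \<Phi> \<and> the (adjoint_op T f) \<in> \<Phi>) \<and>
     (\<forall>t. \<forall>f\<in>\<Phi>. the (T (evolve R t f)) = evolve R t (the (T f)))}"


section \<open>Rigging maps\<close>

text \<open>
  An element of the algebraic dual of \<open>\<Phi>\<close> is represented by its extension by zero to the
  whole auxiliary Hilbert space, so that two functionals that agree on \<open>\<Phi>\<close> are equal.
\<close>

definition scale_fun :: "complex \<Rightarrow> (aux_space \<Rightarrow> complex) \<Rightarrow> aux_space \<Rightarrow> complex" where
  "scale_fun a \<xi> = (\<lambda>g. a * \<xi> g)"

interpretation functional: vector_space scale_fun
  by unfold_locales (auto simp: scale_fun_def plus_fun_def algebra_simps)

definition dual :: "(aux_space \<Rightarrow> complex) set" where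
  "dual = {\<xi>. (\<forall>g\<in>\<Phi>. \<forall>h\<in>\<Phi>. \<xi> (g + h) = \<xi> g + \<xi> h) \<and>
              (\<forall>a. \<forall>g\<in>\<Phi>. \<xi> (a *\<^sub>C g) = a * \<xi> g) \<and>
              (\<forall>g. g \<notin> \<Phi> \<longrightarrow> \<xi> g = 0)}"

definition antilinear_map :: "(aux_space \<Rightarrow> aux_space \<Rightarrow> complex) \<Rightarrow> bool" where
  "antilinear_map \<eta> \<longleftrightarrow>
     (\<forall>f\<in>\<Phi>. \<forall>g\<in>\<Phi>. \<eta> (f + g) = \<eta> f + \<eta> g) \<and>
     (\<forall>a. \<forall>f\<in>\<Phi>. \<eta> (a *\<^sub>C f) = scale_fun (cnj a) (\<eta> f))"

definition rigging_map ::
    "(real \<Rightarrow> real) \<Rightarrow> (aux_space \<Rightarrow> aux_space \<Rightarrow> complex) \<Rightarrow> bool" where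
  "rigging_map R \<eta> \<longleftrightarrow>
     \<eta> ` \<Phi> \<subseteq> dual \<and> antilinear_map \<eta> \<and>
     (\<forall>f\<in>\<Phi>. \<forall>g\<in>\<Phi>. \<eta> f g = cnj (\<eta> g f)) \<and>
     (\<forall>f\<in>\<Phi>. \<eta> f f \<in> \<real>\<^sub>\<ge>\<^sub>0) \<and>
     (\<forall>t. \<forall>f\<in>\<Phi>. \<forall>g\<in>\<Phi>. \<eta> f (evolve R t g) = \<eta> f g) \<and>
     (\<forall>T\<in>observables R. \<forall>f\<in>\<Phi>. \<forall>g\<in>\<Phi>. \<eta> (the (T f)) g = \<eta> f (the (adjoint_op T g)))"

definition finite_dimensional :: "(aux_space \<Rightarrow> complex) set \<Rightarrow> bool" where
  "finite_dimensional W \<longleftrightarrow> (\<exists>B. finite B \<and> W = functional.span B)"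

definition invariant_subspace ::
    "(real \<Rightarrow> real) \<Rightarrow> (aux_space \<Rightarrow> aux_space \<Rightarrow> complex) \<Rightarrow> (aux_space \<Rightarrow> complex) set \<Rightarrow> bool" where
  "invariant_subspace R \<eta> V \<longleftrightarrow>
     functional.subspace V \<and> V \<subseteq> \<eta> ` \<Phi> \<and>
     (\<forall>T\<in>observables R. \<forall>f\<in>\<Phi>. \<eta> f \<in> V \<longrightarrow> \<eta> (the (T f)) \<in> V)"

definition irreducible_representation ::
    "(real \<Rightarrow> real) \<Rightarrow> (aux_space \<Rightarrow> aux_space \<Rightarrow> complex) \<Rightarrow> bool" where
  "irreducible_representation R \<eta> \<longleftrightarrow>
     (\<forall>V. invariant_subspace R \<eta> V \<and> V \<noteq> {0} \<longrightarrow> V = \<eta> ` \<Phi>)"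

definition eta :: "(real \<Rightarrow> real) \<Rightarrow> aux_space \<Rightarrow> aux_space \<Rightarrow> complex" where
  "eta R f = (\<lambda>g. if g \<in> \<Phi> then
     of_real ((2*pi)\<^sup>2) *
       (\<Sum>\<^sub>\<infinity>m::int. \<Sum>y | y \<in> {0..<2*pi} \<and> R y = (of_int m)\<^sup>2.
          cnj (mode f m y) * mode g m y / of_real \<bar>vderiv R y\<bar>)
     else 0)"

end

theory Submission
  imports Defs
begin

text \<open>
  For an observable \<open>T\<close> and test functions \<open>f\<close>, \<open>g\<close>, commutation with the unitary group says that the
  densities \<open>cnj ((T f)\<^sub>m) g\<^sub>m\<close> and \<open>cnj (f\<^sub>m) (T\<^sup>* g)\<^sub>m\<close>, pushed forward along \<open>m\<^sup>2 - R(y)\<close> and summed over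
  \<open>m\<close>, have the same Fourier transform. By Stone-Weierstrass for trigonometric sums they agree on
  every continuous function, in particular on tents shrinking to 0. The regularity of the
  solutions of \<open>R(y) = m\<^sup>2\<close> turns this limit into the sum with weights \<open>1 / \<bar>R'(y)\<bar>\<close>, which is the
  intertwining property.

  The image of \<open>\<eta>\<close> is spanned by the evaluations at the finitely many pairs \<open>(m, y)\<close> with
  \<open>R(y) = m\<^sup>2\<close>. Near two such pairs \<open>R\<close> minus its level is a local coordinate \<open>s\<close>; moving functions
  from one pair to the other along equal \<open>s\<close>, cut off by a bump in \<open>s\<close> and weighted by \<open>\<bar>R'\<bar>\<close>, gives an
  observable whose adjoint is the same construction in the opposite direction. These observables
  carry any nonzero invariant subspace onto every evaluation.
\<close>

section \<open>Differentiability of finite order on open subsets of the line\<close>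

section \<open>Smooth functions\<close>

text \<open>An observable may mix the modes, so commutation with the unitary group constrains only
  the total over all \<open>m\<close> at a common value of \<open>m\<^sup>2 - R(y)\<close>, never a
  single mode; this is why all levels are compared at once. Test functions have finitely many modes,
  hence \<open>m\<^sup>2 - R(y)\<close> stays in a compact interval, and uniform approximation there
  replaces Fourier inversion.

  For the connecting operators, the weight \<open>\<bar>R'\<bar>\<close> is the Jacobian of the
  coordinate \<open>s\<close>: it turns the matrix elements of the operator and of its reverse into
  one integral over \<open>s\<close> in which the two branches play symmetric roles. It stays smooth
  because \<open>R'\<close> has constant sign near each point. The cutoff is narrower than the range
  of \<open>s\<close>, so the transported function vanishes before the local coordinate ends.

  These operators live on \<Phi> only. Membership in \<open>observables\<close> asks for a dense
  domain, and \<open>adjoint_op\<close> picks its value by unique description, which is meaningful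
  only over a dense domain. Hence a substantial share of the proof goes into the density of \<Phi>
  in the auxiliary Hilbert space.\<close>

definition Ck_on :: "nat \<Rightarrow> real set \<Rightarrow> (real \<Rightarrow> 'a::real_normed_vector) \<Rightarrow> bool" where
  "Ck_on n S f \<longleftrightarrow> (\<forall>k<n. \<forall>x\<in>S. (vderiv ^^ k) f differentiable at x)"

lemma smooth_iff_Ck_on: "smooth f \<longleftrightarrow> (\<forall>n. Ck_on n UNIV f)"
  by (auto simp: smooth_def Ck_on_def)

lemma Ck_on_0 [simp]: "Ck_on 0 S f"
  by (simp add: Ck_on_def)

text \<open>Peels off the innermost derivative, so that the closure properties below become
  inductions on the order \<open>n\<close>; plain smoothness offers no such induction.
  Differentiability is \<open>at x\<close>, not within \<open>S\<close>, which makes the condition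
  local and lets it be glued over unions.\<close>

lemma Ck_on_Suc:
  "Ck_on (Suc n) S f \<longleftrightarrow> (\<forall>x\<in>S. f differentiable at x) \<and> Ck_on n S (vderiv f)"
  by (simp add: Ck_on_def All_less_Suc2 funpow_swap1)

lemma Ck_on_Suc_lower: "Ck_on (Suc n) S f \<Longrightarrow> Ck_on n S f"
  by (simp add: Ck_on_def)

lemma Ck_on_subset: "Ck_on n T f \<Longrightarrow> S \<subseteq> T \<Longrightarrow> Ck_on n S f"
  by (auto simp: Ck_on_def)

lemma Ck_on_Un: "Ck_on n S f \<Longrightarrow> Ck_on n T f \<Longrightarrow> Ck_on n (S \<union> T) f"
  by (auto simp: Ck_on_def)

lemma Ck_on_has_vector_derivative:
  assumes "Ck_on (Suc n) S f" "x \<in> S"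
  shows "(f has_vector_derivative vderiv f x) (at x)"
  using assms by (simp add: Ck_on_Suc vderiv_def vector_derivative_works)

text \<open>Equality on an open set is equality near each of its points, so it passes to the
  derivatives.\<close>

lemma Ck_on_cong:
  assumes "open S" "Ck_on n S f" "\<And>x. x \<in> S \<Longrightarrow> f x = g x"
  shows "Ck_on n S g"
  using assms(2,3)
proof (induction n arbitrary: f g)
  case (Suc n)
  have D: "(g has_vector_derivative vderiv f x) (at x)" if "x \<in> S" for x
    using has_vector_derivative_transform_within_open[OF Ck_on_has_vector_derivative[OF Suc.prems(1) that]
        \<open>open S\<close> that Suc.prems(2)] .
  have "vderiv f x = vderiv g x" if "x \<in> S" for x
    using vector_derivative_at[OF D[OF that]] by (simp add: vderiv_def)
  then have "Ck_on n S (vderiv g)"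
    using Suc.IH[of "vderiv f" "vderiv g"] Suc.prems(1) by (simp add: Ck_on_Suc)
  then show ?case
    using D by (auto simp: Ck_on_Suc intro: differentiableI_vector)
qed simp

text \<open>The induction step used throughout: any formula for the derivative that is valid on
  \<open>S\<close> may stand in for \<open>vderiv f\<close>.\<close>

lemma Ck_on_SucI:
  assumes "open S" "Ck_on n S f'" "\<And>x. x \<in> S \<Longrightarrow> (f has_vector_derivative f' x) (at x)"
  shows "Ck_on (Suc n) S f"
proof -
  have "Ck_on n S (vderiv f)"
    by (rule Ck_on_cong[OF assms(1,2)]) (simp add: vderiv_def vector_derivative_at[OF assms(3)])
  then show ?thesis
    using assms(3) by (auto simp: Ck_on_Suc intro: differentiableI_vector)
qed

lemma Ck_on_const: "Ck_on n S (\<lambda>_. c)"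
proof (rule Ck_on_subset[of n UNIV])
  show "Ck_on n UNIV (\<lambda>_. c)"
  proof (induction n arbitrary: c)
    case (Suc n)
    show ?case
      by (rule Ck_on_SucI[OF open_UNIV Suc[of 0]]) (rule has_vector_derivative_const)
  qed simp
qed simp

lemma Ck_on_id: "Ck_on n S (\<lambda>x. x)"
proof (rule Ck_on_subset[of n UNIV])
  show "Ck_on n UNIV (\<lambda>x::real. x)"
    by (cases n) (auto intro!: Ck_on_SucI[OF open_UNIV Ck_on_const[of _ _ 1]])
qed simp

lemma Ck_on_add:
  assumes "open S" "Ck_on n S f" "Ck_on n S g"
  shows "Ck_on n S (\<lambda>x. f x + g x)"
  using assms(2,3)
proof (induction n arbitrary: f g)
  case (Suc n)
  show ?case
  proof (rule Ck_on_SucI[OF \<open>open S\<close>])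
    show "Ck_on n S (\<lambda>x. vderiv f x + vderiv g x)"
      using Suc by (simp add: Ck_on_Suc)
  qed (intro has_vector_derivative_add Ck_on_has_vector_derivative[OF Suc.prems(1)]
      Ck_on_has_vector_derivative[OF Suc.prems(2)])
qed simp

lemma (in bounded_linear) Ck_on_bounded_linear:
  assumes "open S" "Ck_on n S g"
  shows "Ck_on n S (\<lambda>x. f (g x))"
  using assms(2)
proof (induction n arbitrary: g)
  case (Suc n)
  show ?case
    by (rule Ck_on_SucI[OF \<open>open S\<close>, of _ "\<lambda>x. f (vderiv g x)"])
      (use Suc in \<open>auto simp: Ck_on_Suc intro!: has_vector_derivative Ck_on_has_vector_derivative[OF Suc.prems]\<close>)
qed simp

lemma (in bounded_bilinear) Ck_on_prod:
  assumes "open S" "Ck_on n S f" "Ck_on n S g"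
  shows "Ck_on n S (\<lambda>x. prod (f x) (g x))"
  using assms(2,3)
proof (induction n arbitrary: f g)
  case (Suc n)
  show ?case
  proof (rule Ck_on_SucI[OF \<open>open S\<close>])
    show "Ck_on n S (\<lambda>x. prod (f x) (vderiv g x) + prod (vderiv f x) (g x))"
      using Suc.prems Suc.prems[THEN Ck_on_Suc_lower]
      by (auto simp: Ck_on_Suc intro!: Ck_on_add[OF \<open>open S\<close>] Suc.IH)
  qed (intro has_vector_derivative Ck_on_has_vector_derivative[OF Suc.prems(1)]
      Ck_on_has_vector_derivative[OF Suc.prems(2)])
qed simp

lemmas Ck_on_mult = bounded_bilinear.Ck_on_prod[OF bounded_bilinear_mult]
lemmas Ck_on_scaleR = bounded_bilinear.Ck_on_prod[OF bounded_bilinear_scaleR]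
lemmas Ck_on_of_real = bounded_linear.Ck_on_bounded_linear[OF bounded_linear_of_real]

text \<open>The chain rule produces a composition with the new outer function
  \<open>vderiv f\<close>, hence the induction with \<open>f\<close> arbitrary and \<open>g\<close>
  fixed.\<close>

lemma Ck_on_compose:
  assumes "open S" "open T" "Ck_on n T f" "Ck_on n S g" "\<And>x. x \<in> S \<Longrightarrow> g x \<in> T"
  shows "Ck_on n S (\<lambda>x. f (g x))"
  using assms(3,4)
proof (induction n arbitrary: f)
  case (Suc n)
  show ?case
  proof (rule Ck_on_SucI[OF \<open>open S\<close>])
    show "Ck_on n S (\<lambda>x. vderiv g x *\<^sub>R vderiv f (g x))"
      using Suc Ck_on_Suc_lower by (auto simp: Ck_on_Suc intro!: Ck_on_scaleR[OF \<open>open S\<close>])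
    show "((\<lambda>x. f (g x)) has_vector_derivative vderiv g x *\<^sub>R vderiv f (g x)) (at x)" if "x \<in> S" for x
      using vector_diff_chain_at[OF Ck_on_has_vector_derivative[OF Suc.prems(2) that]
          Ck_on_has_vector_derivative[OF Suc.prems(1) assms(5)[OF that]]]
      by (simp add: o_def)
  qed
qed simp

lemma Ck_on_exp:
  fixes g :: "real \<Rightarrow> 'a::{real_normed_field,banach}"
  assumes "open S" "Ck_on n S g"
  shows "Ck_on n S (\<lambda>x. exp (g x))"
  using assms(2)
proof (induction n)
  case (Suc n)
  show ?case
  proof (rule Ck_on_SucI[OF \<open>open S\<close>])
    show "Ck_on n S (\<lambda>x. vderiv g x * exp (g x))"
      using Suc Ck_on_Suc_lower by (auto simp: Ck_on_Suc intro!: Ck_on_mult[OF \<open>open S\<close>])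
    show "((\<lambda>x. exp (g x)) has_vector_derivative vderiv g x * exp (g x)) (at x)" if "x \<in> S" for x
      using field_vector_diff_chain_at[OF Ck_on_has_vector_derivative[OF Suc.prems that] DERIV_exp]
      by (simp add: o_def)
  qed
qed simp

lemma Ck_on_inverse: "Ck_on n (- {0::real}) inverse"
proof (induction n)
  case (Suc n)
  show ?case
  proof (rule Ck_on_SucI)
    show "Ck_on n (- {0::real}) (\<lambda>x. - 1 * (inverse x * inverse x))"
      by (intro Ck_on_mult Ck_on_const Suc) auto
    show "(inverse has_vector_derivative - 1 * (inverse x * inverse x)) (at x)"
      if "x \<in> - {0::real}" for x
      using DERIV_inverse[of x] that
      by (simp add: has_real_derivative_iff_has_vector_derivative numeral_2_eq_2)
  qed auto
qed simp

text \<open>Bootstrap: the derivative of \<psi> is a smooth expression in \<psi> itself, so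
  \<open>n\<close> orders for \<psi> give \<open>n\<close> orders for its derivative.\<close>

lemma Ck_on_inverse_function:
  fixes R \<psi> :: "real \<Rightarrow> real"
  assumes "open J" "open S" "\<And>n. Ck_on n S R"
    and "\<And>s. s \<in> J \<Longrightarrow> \<psi> s \<in> S" "\<And>s. s \<in> J \<Longrightarrow> vderiv R (\<psi> s) \<noteq> 0"
    and D: "\<And>s. s \<in> J \<Longrightarrow> (\<psi> has_vector_derivative inverse (vderiv R (\<psi> s))) (at s)"
  shows "Ck_on n J \<psi>"
proof (induction n)
  case (Suc n)
  have "Ck_on n S (vderiv R)" using assms(3)[of "Suc n"] by (simp add: Ck_on_Suc)
  then have c: "Ck_on n J (\<lambda>s. vderiv R (\<psi> s))"
    by (rule Ck_on_compose[OF \<open>open J\<close> \<open>open S\<close> _ Suc]) (rule assms(4))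
  have "Ck_on n J (\<lambda>s. inverse (vderiv R (\<psi> s)))"
    by (rule Ck_on_compose[OF \<open>open J\<close> _ Ck_on_inverse c]) (auto simp: assms(5))
  then show ?case by (rule Ck_on_SucI[OF \<open>open J\<close>]) (rule D)
qed simp

lemma Ck_on_continuous_on:
  assumes "Ck_on (Suc 0) S f" shows "continuous_on S f"
  using Ck_on_has_vector_derivative[OF assms]
  by (meson continuous_at_imp_continuous_on has_vector_derivative_continuous)

section \<open>The function exp(-1/x) and smooth cutoffs\<close>

subsection \<open>A smooth bump\<close>

text \<open>For \<open>p = 1\<close> this is exp(-1/x) continued by 0. The polynomial in 1/x makes
  the family closed under differentiation.\<close>

definition flat :: "real poly \<Rightarrow> real \<Rightarrow> real" where
  "flat p x = (if x > 0 then poly p (1 / x) * exp (- (1 / x)) else 0)"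

text \<open>With u = 1/x this says that the exponential beats every power of u at infinity.\<close>

lemma flat_tendsto_0: "(flat p \<longlongrightarrow> 0) (at 0)"
proof -
  have "((\<lambda>u. \<Sum>i\<le>degree p. coeff p i * (u ^ i / exp u)) \<longlongrightarrow> (\<Sum>i\<le>degree p. coeff p i * 0)) at_top"
    by (intro tendsto_intros tendsto_power_div_exp_0)
  then have "((\<lambda>u. poly p u * exp (- u)) \<longlongrightarrow> 0) at_top"
    by (simp add: poly_altdef sum_distrib_right exp_minus divide_inverse mult.assoc)
  from filterlim_compose[OF this filterlim_inverse_at_top_right]
  have "((\<lambda>x. poly p (inverse x) * exp (- inverse x)) \<longlongrightarrow> 0) (at_right 0)" .
  then have "(flat p \<longlongrightarrow> 0) (at_right 0)"
    by (rule Lim_transform_eventually)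
      (auto simp: eventually_at_right_field flat_def inverse_eq_divide intro!: exI[of _ 1])
  moreover have "(flat p \<longlongrightarrow> 0) (at_left 0)"
    by (rule Lim_transform_eventually[OF tendsto_const])
      (auto simp: eventually_at_left_field flat_def intro!: exI[of _ "-1"])
  ultimately show ?thesis by (simp add: filterlim_at_split)
qed

text \<open>In the variable u = 1/x the factor \<open>[:0, 0, 1:]\<close> is u^2 = 1/x^2, which the
  chain rule brings out of both the polynomial and the exponential.\<close>

lemma flat_has_derivative:
  "(flat p has_vector_derivative flat ([:0, 0, 1:] * (p - pderiv p)) x) (at x)"
  unfolding has_real_derivative_iff_has_vector_derivative[symmetric]
proof (cases x "0 :: real" rule: linorder_cases)
  case less
  have "(flat p has_real_derivative 0) (at x)"
    by (rule has_field_derivative_transform_within_open[OF DERIV_const, where S = "{..<0}"])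
      (use less in \<open>auto simp: flat_def\<close>)
  then show "(flat p has_real_derivative flat ([:0, 0, 1:] * (p - pderiv p)) x) (at x)"
    using less by (simp add: flat_def)
next
  case equal
  \<comment> \<open>Dividing by \<open>h\<close> multiplies the polynomial by u, so the difference
    quotient at 0 is again a member of the family.\<close>
  have "((\<lambda>h. flat p h / h) \<longlongrightarrow> 0) (at 0)"
    by (rule Lim_transform_eventually[OF flat_tendsto_0[of "pCons 0 p"]])
      (auto simp: flat_def intro!: always_eventually)
  then show "(flat p has_real_derivative flat ([:0, 0, 1:] * (p - pderiv p)) x) (at x)"
    using equal by (simp add: DERIV_def flat_def)
next
  case greater
  have D: "((\<lambda>x. 1 / x) has_real_derivative - (1 / x\<^sup>2)) (at x)"
    using greater by (auto intro!: derivative_eq_intros simp: power2_eq_square)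
  have "((\<lambda>x. poly p (1 / x) * exp (- (1 / x))) has_real_derivative
      flat ([:0, 0, 1:] * (p - pderiv p)) x) (at x)"
    by (rule derivative_eq_intros DERIV_chain2[OF poly_DERIV D] D refl)+
      (use greater in \<open>simp add: flat_def field_simps power2_eq_square\<close>)
  then show "(flat p has_real_derivative flat ([:0, 0, 1:] * (p - pderiv p)) x) (at x)"
    by (rule has_field_derivative_transform_within_open[where S = "{0<..}"])
      (use greater in \<open>auto simp: flat_def\<close>)
qed

lemma Ck_on_flat: "Ck_on n UNIV (flat p)"
proof (induction n arbitrary: p)
  case (Suc n)
  show ?case by (rule Ck_on_SucI[OF open_UNIV Suc flat_has_derivative])
qed simp

text \<open>The classical profile exp(-1/(\<epsilon>^2 - x^2)) on |x| < \<epsilon>, without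
  normalisation.\<close>

definition bump :: "real \<Rightarrow> real \<Rightarrow> real" where
  "bump \<epsilon> x = flat 1 (\<epsilon>\<^sup>2 - x\<^sup>2)"

lemma Ck_on_bump: "Ck_on n UNIV (bump \<epsilon>)"
proof -
  have "Ck_on n UNIV (\<lambda>x. \<epsilon>\<^sup>2 + (- 1) * (x * x))"
    by (intro Ck_on_add Ck_on_mult Ck_on_const Ck_on_id) auto
  then have "Ck_on n UNIV (\<lambda>x. \<epsilon>\<^sup>2 - x\<^sup>2)" by (simp add: power2_eq_square)
  then have "Ck_on n UNIV (\<lambda>x. flat 1 (\<epsilon>\<^sup>2 - x\<^sup>2))"
    by (intro Ck_on_compose[OF open_UNIV open_UNIV Ck_on_flat]) auto
  then show ?thesis by (simp add: bump_def[abs_def])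
qed

lemma bump_zero: "\<epsilon> > 0 \<Longrightarrow> \<bar>x\<bar> \<ge> \<epsilon> \<Longrightarrow> bump \<epsilon> x = 0"
  using abs_le_square_iff[of \<epsilon> x] by (simp add: bump_def flat_def)

lemma bump_0_pos: "\<epsilon> > 0 \<Longrightarrow> bump \<epsilon> 0 > 0"
  by (simp add: bump_def flat_def)

section \<open>Algebra of mode families and the inner product of test functions\<close>

section \<open>The test space\<close>

lemma circle_smooth_iff:
  "circle_smooth f \<longleftrightarrow> (\<forall>n. Ck_on n UNIV f) \<and> (\<forall>y. f (y + 2 * pi) = f y)"
  by (simp add: circle_smooth_def smooth_iff_Ck_on)

lemma circle_smooth_const: "circle_smooth (\<lambda>_. a)"
  by (simp add: circle_smooth_iff Ck_on_const)

lemma circle_smooth_add: "circle_smooth f \<Longrightarrow> circle_smooth g \<Longrightarrow> circle_smooth (\<lambda>y. f y + g y)"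
  by (auto simp: circle_smooth_iff intro!: Ck_on_add)

lemma circle_smooth_mult:
  fixes f g :: "real \<Rightarrow> 'a::real_normed_algebra"
  shows "circle_smooth f \<Longrightarrow> circle_smooth g \<Longrightarrow> circle_smooth (\<lambda>y. f y * g y)"
  by (auto simp: circle_smooth_iff intro!: Ck_on_mult)

lemma circle_smooth_vderiv:
  assumes "circle_smooth f" shows "circle_smooth (vderiv f)"
proof -
  have D: "(f has_vector_derivative vderiv f y) (at y)" for y
    using assms Ck_on_has_vector_derivative[of 0 UNIV f] by (auto simp: circle_smooth_iff)
  have "vderiv f (y + 2 * pi) = vderiv f y" for y
  proof -
    have "((\<lambda>y. f (y + 2 * pi)) has_vector_derivative 1 *\<^sub>R vderiv f (y + 2 * pi)) (at y)"
      using vector_diff_chain_at[of "\<lambda>y. y + 2 * pi" 1 y f, OF _ D]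
        has_vector_derivative_add_const[of "\<lambda>y. y" "2 * pi" 1 "at y"]
      by (simp add: o_def has_vector_derivative_id)
    then have "(f has_vector_derivative vderiv f (y + 2 * pi)) (at y)"
      using assms by (simp add: circle_smooth_iff)
    from vector_derivative_unique_at[OF this D] show ?thesis .
  qed
  moreover have "Ck_on n UNIV (vderiv f)" for n
    using assms by (auto simp: circle_smooth_iff dest: spec[of _ "Suc n"] simp: Ck_on_Suc)
  ultimately show ?thesis by (simp add: circle_smooth_iff)
qed

lemma modesD: "c \<in> modes \<Longrightarrow> circle_smooth (c m)" "c \<in> modes \<Longrightarrow> finite {m. c m \<noteq> (\<lambda>_. 0)}"
  by (auto simp: modes_def)

lemma modes_add:
  assumes "c \<in> modes" "d \<in> modes" shows "(\<lambda>m y. c m y + d m y) \<in> modes"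
proof -
  have "{m. (\<lambda>y. c m y + d m y) \<noteq> (\<lambda>_. 0)} \<subseteq> {m. c m \<noteq> (\<lambda>_. 0)} \<union> {m. d m \<noteq> (\<lambda>_. 0)}"
    by auto
  then show ?thesis
    using assms finite_subset[of "{m. (\<lambda>y. c m y + d m y) \<noteq> (\<lambda>_. 0)}"]
    by (auto simp: modes_def intro: circle_smooth_add)
qed

lemma modes_mult:
  assumes "c \<in> modes" "\<And>m. circle_smooth (a m)" shows "(\<lambda>m y. a m y * c m y) \<in> modes"
proof -
  have "{m. (\<lambda>y. a m y * c m y) \<noteq> (\<lambda>_. 0)} \<subseteq> {m. c m \<noteq> (\<lambda>_. 0)}"
    by auto
  then show ?thesis
    using assms finite_subset[of "{m. (\<lambda>y. a m y * c m y) \<noteq> (\<lambda>_. 0)}"]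
    by (auto simp: modes_def intro: circle_smooth_mult)
qed

lemma modes_scale: "c \<in> modes \<Longrightarrow> (\<lambda>m y. a * c m y) \<in> modes"
  by (rule modes_mult) (auto simp: circle_smooth_const)

definition single_mode :: "int \<Rightarrow> (real \<Rightarrow> complex) \<Rightarrow> int \<Rightarrow> real \<Rightarrow> complex" where
  "single_mode m u = (\<lambda>n y. if n = m then u y else 0)"

lemma single_mode_in_modes: "circle_smooth u \<Longrightarrow> single_mode m u \<in> modes"
proof -
  assume u: "circle_smooth u"
  have "{n. single_mode m u n \<noteq> (\<lambda>_. 0)} \<subseteq> {m}" by (auto simp: single_mode_def)
  then have "finite {n. single_mode m u n \<noteq> (\<lambda>_. 0)}" by (rule finite_subset) simp
  moreover have "circle_smooth (single_mode m u n)" for n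
    using u circle_smooth_const[of 0] by (cases "n = m") (simp_all add: single_mode_def)
  ultimately show ?thesis by (simp add: modes_def)
qed

lemma evolve_modes_in_modes:
  assumes "circle_smooth R" "c \<in> modes" shows "evolve_modes R t c \<in> modes"
  unfolding evolve_modes_def
proof (rule modes_mult[OF assms(2)])
  fix m
  have "Ck_on n UNIV (\<lambda>y. - \<i> * complex_of_real (t * ((of_int m)\<^sup>2 + (- 1) * R y)))" for n
    using assms(1) by (intro Ck_on_mult Ck_on_const Ck_on_of_real Ck_on_add)
      (auto simp: circle_smooth_iff)
  from Ck_on_exp[OF open_UNIV this]
  show "circle_smooth (\<lambda>y. exp (- \<i> * complex_of_real (t * ((of_int m)\<^sup>2 - R y))))"
    using assms(1) by (simp add: circle_smooth_iff)
qed

lemma mode_sum_add: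
  assumes "c \<in> modes" "d \<in> modes"
  shows "mode_sum (\<lambda>m y. c m y + d m y) = (\<lambda>p. mode_sum c p + mode_sum d p)"
proof (intro ext, clarify)
  fix x y
  define S where "S = {m. c m \<noteq> (\<lambda>_. 0)} \<union> {m. d m \<noteq> (\<lambda>_. 0)}"
  have "finite S" using assms by (simp add: S_def modes_def)
  then have "mode_sum e (x, y) = (\<Sum>m\<in>S. exp (\<i> * of_int m * of_real x) * e m y)"
    if "{m. e m \<noteq> (\<lambda>_. 0)} \<subseteq> S" for e using that by (rule mode_sum_superset)
  from this[of c] this[of d] this[of "\<lambda>m y. c m y + d m y"]
  show "mode_sum (\<lambda>m y. c m y + d m y) (x, y) = mode_sum c (x, y) + mode_sum d (x, y)"
    by (force simp: S_def distrib_left sum.distrib)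
qed

lemma mode_sum_scale:
  assumes "c \<in> modes"
  shows "mode_sum (\<lambda>m y. a * c m y) = (\<lambda>p. a * mode_sum c p)"
proof (intro ext, clarify)
  fix x y
  have "mode_sum (\<lambda>m y. a * c m y) (x, y)
      = (\<Sum>m | c m \<noteq> (\<lambda>_. 0). exp (\<i> * of_int m * of_real x) * (a * c m y))"
    by (rule mode_sum_superset) (use assms in \<open>auto simp: modes_def\<close>)
  then show "mode_sum (\<lambda>m y. a * c m y) (x, y) = a * mode_sum c (x, y)"
    by (simp add: mode_sum_def sum_distrib_left mult.left_commute)
qed

lemma mode_sum_single_mode:
  "mode_sum (single_mode m u) (x, y) = exp (\<i> * of_int m * of_real x) * u y"
  by (subst mode_sum_superset[of "{m}"]) (auto simp: single_mode_def)

lemma test_fun_add: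
  assumes "c \<in> modes" "d \<in> modes"
  shows "test_fun (\<lambda>m y. c m y + d m y) = test_fun c + test_fun d"
  using assms
  by (simp add: test_fun_def mode_sum_add plus_aux_space.abs_eq ae_eq_refl sq_integrable_mode_sum)

lemma test_fun_scale:
  assumes "c \<in> modes"
  shows "test_fun (\<lambda>m y. a * c m y) = a *\<^sub>C test_fun c"
  using assms
  by (simp add: test_fun_def mode_sum_scale scaleC.abs_eq ae_eq_refl sq_integrable_mode_sum)

lemma mode_in_modes: "f \<in> \<Phi> \<Longrightarrow> mode f \<in> modes"
  by (auto simp: test_space_def mode_test_fun)

lemma test_fun_mode: "f \<in> \<Phi> \<Longrightarrow> test_fun (mode f) = f"
  by (auto simp: test_space_def mode_test_fun)

lemma test_fun_in_test_space: "c \<in> modes \<Longrightarrow> test_fun c \<in> \<Phi>"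
  by (simp add: test_space_def)

lemma mode_eqI: "c \<in> modes \<Longrightarrow> test_fun c = f \<Longrightarrow> mode f = c"
  using mode_test_fun by blast

lemma add_test_space: "f \<in> \<Phi> \<Longrightarrow> g \<in> \<Phi> \<Longrightarrow> f + g \<in> \<Phi>"
  unfolding test_space_def using modes_add by (auto simp: image_iff test_fun_add[symmetric])

lemma scale_test_space: "f \<in> \<Phi> \<Longrightarrow> a *\<^sub>C f \<in> \<Phi>"
  unfolding test_space_def using modes_scale by (auto simp: image_iff test_fun_scale[symmetric])

lemma mode_add: "f \<in> \<Phi> \<Longrightarrow> g \<in> \<Phi> \<Longrightarrow> mode (f + g) = (\<lambda>m y. mode f m y + mode g m y)"
  by (intro mode_eqI modes_add) (simp_all add: mode_in_modes test_fun_add test_fun_mode)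

lemma mode_scale: "f \<in> \<Phi> \<Longrightarrow> mode (a *\<^sub>C f) = (\<lambda>m y. a * mode f m y)"
  by (intro mode_eqI modes_scale) (simp_all add: mode_in_modes test_fun_scale test_fun_mode)

lemma zero_in_test_space: "0 \<in> \<Phi>"
  using scale_test_space[OF test_fun_in_test_space[OF single_mode_in_modes[OF circle_smooth_const]], of 0]
  by simp

lemma mode_evolve:
  "circle_smooth R \<Longrightarrow> f \<in> \<Phi> \<Longrightarrow> mode (evolve R t f) = evolve_modes R t (mode f)"
  by (simp add: evolve_def mode_test_fun evolve_modes_in_modes mode_in_modes)

lemma evolve_in_test_space: "circle_smooth R \<Longrightarrow> f \<in> \<Phi> \<Longrightarrow> evolve R t f \<in> \<Phi>"
  by (simp add: evolve_def test_fun_in_test_space evolve_modes_in_modes mode_in_modes)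

lemma continuous_on_mode: "f \<in> \<Phi> \<Longrightarrow> continuous_on S (mode f m)"
  using mode_in_modes modesD(1) continuous_circle_smooth by blast

lemma mode_periodic: "f \<in> \<Phi> \<Longrightarrow> mode f m (y + 2 * pi) = mode f m y"
  using mode_in_modes modesD(1) by (auto simp: circle_smooth_def)

text \<open>The half-open square and the closed box differ only inside the negligible frontier of
  the box. The order of integration puts \<open>x\<close> innermost, where the exponentials are
  orthogonal.\<close>

lemma integral_torus:
  fixes F :: "real \<times> real \<Rightarrow> complex"
  assumes F: "continuous_on UNIV F"
  shows "(LINT p|torus. F p) = integral {0..2*pi} (\<lambda>y. integral {0..2*pi} (\<lambda>x. F (x, y)))"
proof -
  define Q where "Q = {0..<2*pi} \<times> {0..<2*pi}"
  have Q: "Q \<in> sets lborel" using square_borel by (simp add: Q_def)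
  have "integrable torus F"
    using sq_integrable_product[OF sq_integrable_continuous sq_integrable_continuous, of "\<lambda>_. 1" F] F
    by simp
  then have si: "set_integrable lborel Q F"
    using Q by (simp add: torus_def Q_def[symmetric] integrable_restrict_space set_integrable_def)
  have "(LINT p|torus. F p) = (LINT p:Q|lborel. F p)"
    using Q by (simp add: torus_def Q_def[symmetric] integral_restrict_space set_lebesgue_integral_def)
  also have "\<dots> = integral Q F"
    by (rule set_borel_integral_eq_integral(2)[OF si])
  also have "\<dots> = integral (cbox (0, 0) (2*pi, 2*pi)) F"
  proof (rule integral_spike_set)
    have "box (0, 0) (2*pi, 2*pi) \<subseteq> Q" "Q \<subseteq> cbox (0, 0) (2*pi, 2*pi)"
      by (auto simp: Q_def box_def cbox_def Basis_prod_def)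
    then show "negligible {p \<in> Q - cbox (0, 0) (2*pi, 2*pi). F p \<noteq> 0}"
      "negligible {p \<in> cbox (0, 0) (2*pi, 2*pi) - Q. F p \<noteq> 0}"
      by (auto intro: negligible_subset[OF negligible_frontier_interval])
  qed
  also have "\<dots> = integral {0..2*pi} (\<lambda>x. integral {0..2*pi} (\<lambda>y. F (x, y)))"
    using integral_prod_continuous[of 0 0 "2*pi" "2*pi" F] continuous_on_subset[OF F] by simp
  also have "\<dots> = integral {0..2*pi} (\<lambda>y. integral {0..2*pi} (\<lambda>x. F (x, y)))"
    using integral_swap_continuous[of 0 0 "2*pi" "2*pi" "\<lambda>x y. F (x, y)"] continuous_on_subset[OF F]
    by simp
  finally show ?thesis .
qed

text \<open>Parseval in \<open>x\<close>: integrating \<open>mode_sum d\<close> against one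
  exponential extracts one mode of \<open>d\<close>, so summing over the support of \<open>c\<close>
  suffices.\<close>

lemma inner_aux_test_fun:
  assumes c: "c \<in> modes" and d: "d \<in> modes" and S: "finite S" "{m. c m \<noteq> (\<lambda>_. 0)} \<subseteq> S"
  shows "inner_aux (test_fun c) (test_fun d)
    = 2 * of_real pi * (\<Sum>m\<in>S. integral {0..2*pi} (\<lambda>y. cnj (c m y) * d m y))"
proof -
  have cont: "continuous_on T (c m)" "continuous_on T (d m)" for T m
    using c d by (auto simp: modes_def intro: continuous_circle_smooth)
  have "inner_aux (test_fun c) (test_fun d) = (LINT p|torus. cnj (mode_sum c p) * mode_sum d p)"
    using c d by (simp add: test_fun_def inner_aux.abs_eq ae_eq_refl sq_integrable_mode_sum)
  also have "\<dots> = integral {0..2*pi} (\<lambda>y. integral {0..2*pi}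
      (\<lambda>x. cnj (mode_sum c (x, y)) * mode_sum d (x, y)))"
    using continuous_mode_sum[OF c] continuous_mode_sum[OF d]
    by (intro integral_torus continuous_intros)
  also have "\<dots> = integral {0..2*pi} (\<lambda>y. \<Sum>m\<in>S. cnj (c m y) * (2 * of_real pi * d m y))"
  proof (intro integral_cong integral_unique)
    fix y
    have eq: "cnj (mode_sum c (x, y)) * mode_sum d (x, y)
        = (\<Sum>m\<in>S. cnj (c m y) * (exp (\<i> * of_int (- m) * of_real x) * mode_sum d (x, y)))" for x
    proof -
      have "cnj (mode_sum c (x, y)) = (\<Sum>m\<in>S. cnj (c m y) * exp (\<i> * of_int (- m) * of_real x))"
        by (simp add: mode_sum_superset[OF S] exp_cnj mult.commute)
      then show ?thesis by (simp only: sum_distrib_right mult.assoc)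
    qed
    show "((\<lambda>x. cnj (mode_sum c (x, y)) * mode_sum d (x, y)) has_integral
        (\<Sum>m\<in>S. cnj (c m y) * (2 * of_real pi * d m y))) {0..2*pi}"
      unfolding eq
      by (intro has_integral_sum has_integral_mult_right mode_sum_integral d S)
  qed
  also have "\<dots> = (\<Sum>m\<in>S. integral {0..2*pi} (\<lambda>y. 2 * of_real pi * (cnj (c m y) * d m y)))"
    by (subst integral_sum)
      (auto intro!: integrable_continuous_real continuous_intros cont S simp: mult_ac)
  also have "\<dots> = 2 * of_real pi * (\<Sum>m\<in>S. integral {0..2*pi} (\<lambda>y. cnj (c m y) * d m y))"
    by (simp add: sum_distrib_left)
  finally show ?thesis .
qed

section \<open>Density of \<Phi>: trigonometric polynomials, continuous, bounded, then arbitrary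
  functions\<close>

subsection \<open>Density\<close>

lemma norm_abs_diff:
  assumes "sq_integrable f" "sq_integrable g"
  shows "norm (abs_aux_space f - abs_aux_space g) = sqrt (LINT p|torus. (cmod (f p - g p))\<^sup>2)"
proof -
  have "abs_aux_space f - abs_aux_space g = abs_aux_space (\<lambda>p. f p + (- 1) * g p)"
    unfolding minus_aux_space_def
    using assms sq_integrable_scale[OF assms(2), of "-1"]
    by (subst scaleC.abs_eq, simp only: ae_eq_refl) (subst plus_aux_space.abs_eq, auto simp only: ae_eq_refl)
  moreover have "sq_integrable (\<lambda>p. f p + (- 1) * g p)"
    by (intro sq_integrable_add sq_integrable_scale assms)
  ultimately show ?thesis
    by (simp add: norm_aux_space_def inner_aux_self sq_norm.abs_eq ae_eq_refl)
qed

text \<open>The limit argument behind every density step: |f n - g|^2 is dominated by 2|w|^2 +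
  2|g|^2, so pointwise convergence becomes convergence in norm.\<close>

lemma closure_test_space_dominated:
  assumes f: "\<And>n. sq_integrable (f n)" "\<And>n. abs_aux_space (f n) \<in> closure \<Phi>"
    and g: "sq_integrable g" and lim: "AE p in torus. (\<lambda>n. f n p) \<longlonglongrightarrow> g p"
    and w: "sq_integrable w" "\<And>n. AE p in torus. cmod (f n p) \<le> cmod (w p)"
  shows "abs_aux_space g \<in> closure \<Phi>"
proof -
  have [measurable]: "f n \<in> borel_measurable torus" "g \<in> borel_measurable torus" for n
    using f g by (auto simp: sq_integrable_def)
  have "(\<lambda>n. LINT p|torus. (cmod (f n p - g p))\<^sup>2) \<longlonglongrightarrow> (LINT p|torus. 0)"
  proof (rule integral_dominated_convergence)
    show "integrable torus (\<lambda>p. 2 * (cmod (w p))\<^sup>2 + 2 * (cmod (g p))\<^sup>2)"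
      using w g by (auto simp: sq_integrable_def)
    show "AE p in torus. (\<lambda>n. (cmod (f n p - g p))\<^sup>2) \<longlonglongrightarrow> 0"
      using lim
    proof eventually_elim
      case (elim p)
      then have "(\<lambda>n. (cmod (f n p - g p))\<^sup>2) \<longlonglongrightarrow> (cmod (g p - g p))\<^sup>2"
        by (intro tendsto_intros)
      then show ?case by simp
    qed
    show "AE p in torus. norm ((cmod (f n p - g p))\<^sup>2) \<le> 2 * (cmod (w p))\<^sup>2 + 2 * (cmod (g p))\<^sup>2" for n
      using w(2)[of n]
    proof eventually_elim
      case (elim p)
      have "(cmod (f n p - g p))\<^sup>2 \<le> (cmod (w p) + cmod (g p))\<^sup>2"
        using elim norm_triangle_ineq4[of "f n p" "g p"] by (intro power_mono) auto
      also have "\<dots> \<le> 2 * (cmod (w p))\<^sup>2 + 2 * (cmod (g p))\<^sup>2"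
        using sum_squares_bound[of "cmod (w p)" "cmod (g p)"] by (simp add: power2_sum)
      finally show ?case by simp
    qed
  qed measurable
  then have "(\<lambda>n. sqrt (LINT p|torus. (cmod (f n p - g p))\<^sup>2)) \<longlonglongrightarrow> sqrt 0"
    by (intro tendsto_intros) simp
  then have "(\<lambda>n. norm (abs_aux_space (f n) - abs_aux_space g)) \<longlonglongrightarrow> 0"
    by (simp add: norm_abs_diff f g)
  then have "(\<lambda>n. abs_aux_space (f n)) \<longlonglongrightarrow> abs_aux_space g"
    by (rule LIM_zero_cancel[OF tendsto_norm_zero_cancel])
  then show ?thesis
    by (rule closed_sequentially[OF closed_closure f(2)])
qed

lemma mode_sum_closed_add:
  assumes "F \<in> mode_sum ` modes" "G \<in> mode_sum ` modes"
  shows "(\<lambda>p. F p + G p) \<in> mode_sum ` modes"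
proof -
  from assms obtain c d where "c \<in> modes" "F = mode_sum c" "d \<in> modes" "G = mode_sum d"
    by auto
  then show ?thesis
    using mode_sum_add[of c d] modes_add[of c d] by (auto intro: rev_image_eqI)
qed

lemma mode_sum_closed_scale:
  assumes "F \<in> mode_sum ` modes"
  shows "(\<lambda>p. a * F p) \<in> mode_sum ` modes"
proof -
  from assms obtain c where "c \<in> modes" "F = mode_sum c" by auto
  then show ?thesis
    using mode_sum_scale[of c a] modes_scale[of c a] by (auto intro: rev_image_eqI)
qed

lemma mode_sum_closed_sum:
  assumes "finite I" "\<And>i. i \<in> I \<Longrightarrow> F i \<in> mode_sum ` modes"
  shows "(\<lambda>p. \<Sum>i\<in>I. F i p) \<in> mode_sum ` modes"
  using assms
proof (induction I)
  case empty
  have "(\<lambda>p. \<Sum>i\<in>{}. F i p) = mode_sum (single_mode 0 (\<lambda>_. 0))"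
    by (simp add: fun_eq_iff mode_sum_single_mode)
  moreover have "single_mode 0 (\<lambda>_. 0) \<in> modes"
    by (rule single_mode_in_modes[OF circle_smooth_const])
  ultimately show ?case by (rule image_eqI)
next
  case (insert i I)
  have "(\<lambda>p. F i p + (\<Sum>i\<in>I. F i p)) \<in> mode_sum ` modes"
    by (intro mode_sum_closed_add insert.prems insert.IH) simp_all
  then show ?case by (simp only: sum.insert[OF insert.hyps])
qed

text \<open>Multiplying exponentials adds frequencies; this makes the mode sums an algebra, as
  polynomial approximation requires.\<close>

lemma mode_sum_closed_mult:
  assumes "F \<in> mode_sum ` modes" "G \<in> mode_sum ` modes"
  shows "(\<lambda>p. F p * G p) \<in> mode_sum ` modes"
proof -
  from assms obtain c d where c: "c \<in> modes" "F = mode_sum c" and d: "d \<in> modes" "G = mode_sum d"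
    by auto
  define S T where "S = {m. c m \<noteq> (\<lambda>_. 0)}" "T = {m. d m \<noteq> (\<lambda>_. 0)}"
  have fin: "finite S" "finite T" using c d by (auto simp: S_T_def modes_def)
  have "F p * G p = (\<Sum>k\<in>S. \<Sum>l\<in>T. mode_sum (single_mode (k + l) (\<lambda>y. c k y * d l y)) p)" for p
  proof (cases p)
    case (Pair x y)
    have "F p * G p = (\<Sum>k\<in>S. exp (\<i> * of_int k * of_real x) * c k y)
        * (\<Sum>l\<in>T. exp (\<i> * of_int l * of_real x) * d l y)"
      by (simp add: Pair c(2) d(2) mode_sum_def S_T_def)
    then show ?thesis
      by (simp add: Pair sum_product mode_sum_single_mode exp_add distrib_left distrib_right mult_ac)
  qed
  then have "(\<lambda>p. F p * G p)
      = (\<lambda>p. \<Sum>k\<in>S. \<Sum>l\<in>T. mode_sum (single_mode (k + l) (\<lambda>y. c k y * d l y)) p)" by blast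
  also have "\<dots> \<in> mode_sum ` modes"
    using c d by (intro mode_sum_closed_sum fin imageI single_mode_in_modes circle_smooth_mult)
      (auto simp: modes_def)
  finally show ?thesis .
qed

lemma exp_in_mode_sum:
  "(\<lambda>p. exp (\<i> * of_int m * of_real (fst p))) \<in> mode_sum ` modes"
  "(\<lambda>p. exp (\<i> * of_int m * of_real (snd p))) \<in> mode_sum ` modes"
proof -
  have "mode_sum (single_mode m (\<lambda>_. 1)) = (\<lambda>p. exp (\<i> * of_int m * of_real (fst p)))"
    by (auto simp: mode_sum_single_mode)
  then show "(\<lambda>p. exp (\<i> * of_int m * of_real (fst p))) \<in> mode_sum ` modes"
    using single_mode_in_modes[OF circle_smooth_const, of m 1] by (auto intro: rev_image_eqI)
  define u where "u y = exp (\<i> * of_int m * complex_of_real y)" for y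
  have "u (y + 2 * pi) = u y" for y
    using exp_integer_2pi[of "of_int m"] by (simp add: u_def distrib_left exp_add mult_ac)
  moreover have "Ck_on n UNIV u" for n
    unfolding u_def by (intro Ck_on_exp Ck_on_mult Ck_on_of_real Ck_on_const Ck_on_id open_UNIV)
  ultimately have "single_mode 0 u \<in> modes"
    by (intro single_mode_in_modes) (simp add: circle_smooth_iff)
  moreover have "mode_sum (single_mode 0 u) = (\<lambda>p. exp (\<i> * of_int m * of_real (snd p)))"
    by (auto simp: mode_sum_single_mode u_def)
  ultimately show "(\<lambda>p. exp (\<i> * of_int m * of_real (snd p))) \<in> mode_sum ` modes"
    by (auto intro: rev_image_eqI)
qed

text \<open>The generators are only real-linear in the pair of complex numbers, so 1 and the
  imaginary unit get separate coefficients. Their values are combinations of cosines and sines, that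
  is, of exponentials of frequency 1 and -1.\<close>

lemma real_polynomial_cis_in_mode_sum:
  assumes "real_polynomial_function q"
  shows "(\<lambda>p. complex_of_real (q (cis (fst p), cis (snd p)))) \<in> mode_sum ` modes"
  using assms
proof (induction rule: real_polynomial_function.induct)
  case (linear h)
  interpret bounded_linear h by fact
  have sc: "h (x, 0) = Re x * h (1, 0) + Im x * h (\<i>, 0)" "h (0, x) = Re x * h (0, 1) + Im x * h (0, \<i>)"
    for x
  proof -
    have "(x, 0) = Re x *\<^sub>R (1, 0) + Im x *\<^sub>R (\<i>, 0)" "(0, x) = Re x *\<^sub>R (0, 1) + Im x *\<^sub>R (0, \<i>)"
      by (simp_all add: complex_eq_iff)
    from this[THEN arg_cong, of h]
    show "h (x, 0) = Re x * h (1, 0) + Im x * h (\<i>, 0)"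
      "h (0, x) = Re x * h (0, 1) + Im x * h (0, \<i>)"
      by (simp_all only: add scaleR real_scaleR_def)
  qed
  have split: "h (x, y) = h (x, 0) + h (0, y)" for x y
    using add[of "(x, 0)" "(0, y)"] by simp
  have trig: "complex_of_real (cos t) = 1/2 * exp (\<i> * of_int 1 * of_real t) + 1/2 * exp (\<i> * of_int (-1) * of_real t)"
    "complex_of_real (sin t) = - \<i>/2 * exp (\<i> * of_int 1 * of_real t) + \<i>/2 * exp (\<i> * of_int (-1) * of_real t)"
    for t
    by (simp_all add: complex_eq_iff Re_exp Im_exp)
  have e: "complex_of_real (h (cis (fst p), cis (snd p)))
      = (of_real (h (1, 0)) * of_real (cos (fst p)) + of_real (h (\<i>, 0)) * of_real (sin (fst p)))
      + (of_real (h (0, 1)) * of_real (cos (snd p)) + of_real (h (0, \<i>)) * of_real (sin (snd p)))" for p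
    unfolding split[of "cis (fst p)" "cis (snd p)"] sc[of "cis (fst p)"] sc[of "cis (snd p)"]
    by (simp add: mult.commute)
  show ?case
    unfolding e trig by (intro mode_sum_closed_add mode_sum_closed_scale exp_in_mode_sum)
next
  case (const a)
  show ?case
    using mode_sum_closed_scale[OF exp_in_mode_sum(1)[of 0], of "of_real a"] by simp
next
  case (add f g)
  then show ?case using mode_sum_closed_add by fastforce
next
  case (mult f g)
  then show ?case using mode_sum_closed_mult by fastforce
qed

lemma polynomial_cis_in_mode_sum:
  fixes q :: "complex \<times> complex \<Rightarrow> complex"
  assumes "polynomial_function q"
  shows "(\<lambda>p. q (cis (fst p), cis (snd p))) \<in> mode_sum ` modes"
proof -
  have "real_polynomial_function (\<lambda>z. Re (q z))" "real_polynomial_function (\<lambda>z. Im (q z))"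
    using assms bounded_linear_Re bounded_linear_Im by (auto simp: polynomial_function_def o_def)
  then have "(\<lambda>p. complex_of_real (Re (q (cis (fst p), cis (snd p))))
      + \<i> * complex_of_real (Im (q (cis (fst p), cis (snd p))))) \<in> mode_sum ` modes"
    by (intro mode_sum_closed_add mode_sum_closed_scale real_polynomial_cis_in_mode_sum)
  then show ?thesis by (simp only: complex_eq[symmetric])
qed

abbreviation circle2 :: "(complex \<times> complex) set" where
  "circle2 \<equiv> sphere 0 1 \<times> sphere 0 1"

lemma continuous_circle2_comp:
  assumes "continuous_on circle2 H"
  shows "continuous_on UNIV (\<lambda>p. H (cis (fst p), cis (snd p)))"
  by (rule continuous_on_compose2[OF assms]) (auto intro!: continuous_intros)

text \<open>Viewing the torus as a compact subset of a Euclidean space makes the polynomial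
  Stone-Weierstrass theorem available; the approximating polynomials pull back to mode sums.\<close>

lemma closure_test_space_circle2:
  fixes H :: "complex \<times> complex \<Rightarrow> complex"
  assumes H: "continuous_on circle2 H"
  shows "abs_aux_space (\<lambda>p. H (cis (fst p), cis (snd p))) \<in> closure \<Phi>"
proof -
  have "\<exists>q. polynomial_function q \<and> (\<forall>z\<in>circle2. norm (H z - q z) < 1 / real (Suc n))" for n
    by (rule Stone_Weierstrass_polynomial_function[OF _ H]) (auto intro: compact_Times)
  then obtain q where q: "\<And>n. polynomial_function (q n)"
    "\<And>n z. z \<in> circle2 \<Longrightarrow> norm (H z - q n z) < 1 / real (Suc n)" by metis
  obtain c where c: "\<And>n. c n \<in> modes" "\<And>n p. q n (cis (fst p), cis (snd p)) = mode_sum (c n) p"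
  proof -
    have "\<forall>n. \<exists>c. c \<in> modes \<and> (\<forall>p. q n (cis (fst p), cis (snd p)) = mode_sum c p)"
      using polynomial_cis_in_mode_sum[OF q(1)] by (simp only: image_iff fun_eq_iff) blast
    then show ?thesis using that by metis
  qed
  have near: "cmod (H (cis (fst p), cis (snd p)) - mode_sum (c n) p) < 1 / real (Suc n)" for n p
    using q(2)[of "(cis (fst p), cis (snd p))" n] by (simp add: c(2))
  note cont = continuous_circle2_comp[OF H]
  show ?thesis
  proof (rule closure_test_space_dominated)
    show "sq_integrable (mode_sum (c n))" for n by (rule sq_integrable_mode_sum[OF c(1)])
    show "abs_aux_space (mode_sum (c n)) \<in> closure \<Phi>" for n
      using test_fun_in_test_space[OF c(1)] closure_subset by (auto simp: test_fun_def)
    show "sq_integrable (\<lambda>p. H (cis (fst p), cis (snd p)))"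
      by (rule sq_integrable_continuous[OF cont])
    \<comment> \<open>All approximation errors are below 1, so |H| + 1 is a common majorant.\<close>
    show "sq_integrable (\<lambda>p. of_real (cmod (H (cis (fst p), cis (snd p))) + 1))"
      by (intro sq_integrable_continuous continuous_intros cont)
    show "AE p in torus. (\<lambda>n. mode_sum (c n) p) \<longlonglongrightarrow> H (cis (fst p), cis (snd p))"
    proof (intro AE_I2)
      fix p
      have "(\<lambda>n. H (cis (fst p), cis (snd p)) - mode_sum (c n) p) \<longlonglongrightarrow> 0"
        by (rule Lim_null_comparison[OF _ LIMSEQ_inverse_real_of_nat])
          (use near[THEN less_imp_le] in \<open>simp add: inverse_eq_divide\<close>)
      from tendsto_diff[OF tendsto_const this, of "H (cis (fst p), cis (snd p))"]
      show "(\<lambda>n. mode_sum (c n) p) \<longlonglongrightarrow> H (cis (fst p), cis (snd p))" by simp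
    qed
    show "AE p in torus. cmod (mode_sum (c n) p) \<le> cmod (of_real (cmod (H (cis (fst p), cis (snd p))) + 1))" for n
    proof (intro AE_I2)
      fix p
      have "cmod (mode_sum (c n) p)
          \<le> cmod (H (cis (fst p), cis (snd p))) + cmod (H (cis (fst p), cis (snd p)) - mode_sum (c n) p)"
        using norm_triangle_ineq4[of "H (cis (fst p), cis (snd p))" "H (cis (fst p), cis (snd p)) - mode_sum (c n) p"]
        by simp
      also have "\<dots> \<le> cmod (H (cis (fst p), cis (snd p))) + 1"
        using near[of p n] order.trans[of _ "1 / real (Suc n)" 1] by (simp add: less_imp_le)
      finally show "cmod (mode_sum (c n) p) \<le> cmod (of_real (cmod (H (cis (fst p), cis (snd p))) + 1))"
        by simp
    qed
  qed
qed

text \<open>For \<open>n > 0\<close> it is 0 when 1 - c \<le> 1/n and 1 when 1 - c \<ge> 2/n. With c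
  = cos x it removes a neighbourhood of the seam x = 0 of the circle.\<close>

definition cutoff :: "nat \<Rightarrow> real \<Rightarrow> real" where
  "cutoff n c = min 1 (max 0 (real n * (1 - c) - 1))"

lemma continuous_on_cutoff [continuous_intros]:
  "continuous_on S f \<Longrightarrow> continuous_on S (\<lambda>x. cutoff n (f x))"
  unfolding cutoff_def by (intro continuous_intros)

lemma cutoff_tendsto_1:
  assumes "c < 1" shows "(\<lambda>n. cutoff n c) \<longlonglongrightarrow> 1"
proof (rule Lim_transform_eventually[OF tendsto_const])
  obtain N :: nat where N: "real N * (1 - c) > 2"
    using reals_Archimedean3[of "1 - c"] assms by auto
  have "cutoff n c = 1" if "n \<ge> N" for n
  proof -
    have "real N * (1 - c) \<le> real n * (1 - c)" using that assms by (intro mult_right_mono) auto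
    with N show ?thesis by (simp add: cutoff_def)
  qed
  then show "\<forall>\<^sub>F n in sequentially. 1 = cutoff n c"
    by (auto simp: eventually_sequentially)
qed

lemma cutoff_Re_eq_0:
  "real n * (1 - c) \<le> 1 \<Longrightarrow> cutoff n c = 0"
  by (simp add: cutoff_def)

lemma Arg2pi_cis: "0 \<le> x \<Longrightarrow> x < 2 * pi \<Longrightarrow> Arg2pi (cis x) = x"
  by (rule Arg2pi_unique[of 1]) (simp_all add: cis_conv_exp)

text \<open>
  \<open>Arg2pi\<close> jumps at 1; the cutoff kills the pulled back function near the jump.
\<close>

lemma continuous_on_circle2_cutoff:
  fixes h :: "real \<times> real \<Rightarrow> complex"
  assumes h: "continuous_on UNIV h"
  shows "continuous_on circle2 (\<lambda>z. complex_of_real (cutoff n (Re (fst z)) * cutoff n (Re (snd z)))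
    * h (Arg2pi (fst z), Arg2pi (snd z)))" (is "continuous_on _ ?H")
proof -
  \<comment> \<open>On \<open>A\<close> both coordinates avoid the jump of \<open>Arg2pi\<close>; on
    \<open>B\<close> one of the cutoffs vanishes. Both sets are relatively open and cover
    \<open>circle2\<close>, so continuity on each suffices.\<close>
  define A where "A = circle2 \<inter> {z. Re (fst z) < 1 \<and> Re (snd z) < 1}"
  define B where "B = circle2 \<inter> {z. real n * (1 - Re (fst z)) < 1 \<or> real n * (1 - Re (snd z)) < 1}"
  have le: "Re z \<le> 1" if "z \<in> sphere 0 1" for z
    using complex_Re_le_cmod[of z] that by simp
  have "z \<in> A \<union> B" if "z \<in> circle2" for z
  proof (cases "Re (fst z) < 1 \<and> Re (snd z) < 1")
    case True
    then show ?thesis using that by (simp add: A_def)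
  next
    case False
    have "fst z \<in> sphere 0 1" "snd z \<in> sphere 0 1" using that by (auto simp: mem_Times_iff)
    with False have "Re (fst z) = 1 \<or> Re (snd z) = 1" using le by fastforce
    then show ?thesis using that by (auto simp: B_def)
  qed
  then have U: "circle2 = A \<union> B" by (auto simp: A_def B_def)
  have "open {z::complex \<times> complex. Re (fst z) < 1 \<and> Re (snd z) < 1}"
    by (intro open_Collect_conj open_Collect_less continuous_intros)
  then have "openin (top_of_set circle2) A"
    unfolding A_def by (rule openin_open_Int)
  then have "openin (top_of_set (A \<union> B)) A" by (simp only: U)
  moreover have "open {z::complex \<times> complex. real n * (1 - Re (fst z)) < 1 \<or> real n * (1 - Re (snd z)) < 1}"
    by (intro open_Collect_disj open_Collect_less continuous_intros)
  then have "openin (top_of_set circle2) B"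
    unfolding B_def by (rule openin_open_Int)
  then have "openin (top_of_set (A \<union> B)) B" by (simp only: U)
  moreover have "continuous_on A ?H"
  proof -
    have nonneg: "z \<notin> \<real>\<^sub>\<ge>\<^sub>0" if "z \<in> sphere 0 1" "Re z < 1" for z
      using that by (auto elim!: nonneg_Reals_cases)
    have arg: "continuous_on (- \<real>\<^sub>\<ge>\<^sub>0) Arg2pi"
      by (intro continuous_at_imp_continuous_on) (auto simp: continuous_at_Arg2pi)
    have "continuous_on A (\<lambda>z. Arg2pi (fst z))" "continuous_on A (\<lambda>z. Arg2pi (snd z))"
      by (rule continuous_on_compose2[OF arg]; use nonneg in \<open>auto simp: A_def intro!: continuous_intros\<close>)+
    then have "continuous_on A (\<lambda>z. h (Arg2pi (fst z), Arg2pi (snd z)))"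
      by (intro continuous_on_compose2[OF h] continuous_intros) auto
    then show ?thesis by (intro continuous_intros)
  qed
  moreover have "continuous_on B ?H"
  proof (subst continuous_on_cong[OF refl, of _ _ "\<lambda>_. 0"])
    show "?H z = 0" if "z \<in> B" for z
      using that cutoff_Re_eq_0[of n "Re (fst z)"] cutoff_Re_eq_0[of n "Re (snd z)"]
      by (auto simp: B_def)
  qed simp
  ultimately show ?thesis
    unfolding U by (rule continuous_on_Un_local_open)
qed

lemma AE_torus_interior: "AE p in torus. p \<in> {0<..<2*pi} \<times> {0<..<2*pi}"
proof -
  have N: "AE p in lborel. p \<bullet> k \<noteq> (0::real)" if "k \<in> Basis" for k :: "real \<times> real"
  proof -
    have "{p. p \<bullet> k = 0} \<in> null_sets lebesgue"
      using negligible_standard_hyperplane[OF that, of 0] by (simp add: negligible_iff_null_sets)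
    from AE_not_in[OF this] show ?thesis by (simp add: AE_completion_iff)
  qed
  have "AE p in lborel. p \<bullet> (1 :: real, 0 :: real) \<noteq> (0::real)" "AE p in lborel. p \<bullet> (0 :: real, 1 :: real) \<noteq> (0::real)"
    by (rule N, force simp: Basis_prod_def)+
  then have "AE p in lborel. p \<in> {0..<2*pi} \<times> {0..<2*pi} \<longrightarrow> p \<in> {0<..<2*pi} \<times> {0<..<2*pi}"
    by eventually_elim auto
  then show ?thesis
    unfolding torus_def using square_borel by (subst AE_restrict_space_iff) simp_all
qed

lemma cos_less_1: "x \<in> {0<..<2*pi} \<Longrightarrow> cos x < 1"
proof -
  assume x: "x \<in> {0<..<2*pi}"
  have "cos x \<noteq> 1"
  proof
    assume "cos x = 1"
    then obtain k :: int where "x = of_int k * 2 * pi" using cos_one_2pi_int[of x] by auto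
    with x have "0 < of_int k * (2 * pi)" "of_int k * (2 * pi) < 1 * (2 * pi)" by auto
    then have "0 < k" "k < 1" by (simp_all add: zero_less_mult_iff mult_less_cancel_right)
    then show False by simp
  qed
  then show "cos x < 1" using cos_le_one[of x] by linarith
qed

text \<open>A continuous \<open>h\<close> on the plane need not match across the seams. Cut off near
  them it becomes a continuous function on \<open>circle2\<close>; the cut-off versions converge to
  \<open>h\<close> inside the square and are dominated by it.\<close>

lemma closure_test_space_continuous:
  fixes h :: "real \<times> real \<Rightarrow> complex"
  assumes h: "continuous_on UNIV h"
  shows "abs_aux_space h \<in> closure \<Phi>"
proof -
  define H where "H n z = complex_of_real (cutoff n (Re (fst z)) * cutoff n (Re (snd z)))
    * h (Arg2pi (fst z), Arg2pi (snd z))" for n z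
  have H: "continuous_on circle2 (H n)" for n
    unfolding H_def by (rule continuous_on_circle2_cutoff[OF h])
  have eq: "H n (cis (fst p), cis (snd p)) = complex_of_real (cutoff n (cos (fst p)) * cutoff n (cos (snd p))) * h p"
    if "p \<in> {0<..<2*pi} \<times> {0<..<2*pi}" for n p
    using that by (auto simp: H_def Arg2pi_cis)
  show ?thesis
  proof (rule closure_test_space_dominated)
    show "sq_integrable (\<lambda>p. H n (cis (fst p), cis (snd p)))" for n
      by (rule sq_integrable_continuous[OF continuous_circle2_comp[OF H]])
    show "abs_aux_space (\<lambda>p. H n (cis (fst p), cis (snd p))) \<in> closure \<Phi>" for n
      by (rule closure_test_space_circle2[OF H])
    show "sq_integrable h" by (rule sq_integrable_continuous[OF h])
    then show "sq_integrable h" .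
    show "AE p in torus. (\<lambda>n. H n (cis (fst p), cis (snd p))) \<longlonglongrightarrow> h p"
      using AE_torus_interior
    proof eventually_elim
      case (elim p)
      have "(\<lambda>n. complex_of_real (cutoff n (cos (fst p)) * cutoff n (cos (snd p))) * h p)
          \<longlonglongrightarrow> complex_of_real (1 * 1) * h p"
        using elim by (intro tendsto_intros cutoff_tendsto_1 cos_less_1) auto
      then show ?case by (simp add: eq[OF elim])
    qed
    show "AE p in torus. cmod (H n (cis (fst p), cis (snd p))) \<le> cmod (h p)" for n
      using AE_torus_interior
    proof eventually_elim
      case (elim p)
      have "0 \<le> cutoff n x" "cutoff n x \<le> 1" for x by (auto simp: cutoff_def)
      then have "\<bar>cutoff n (cos (fst p)) * cutoff n (cos (snd p))\<bar> \<le> 1"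
        by (simp add: mult_le_one)
      then show ?case
        unfolding eq[OF elim] norm_mult norm_of_real by (intro mult_left_le_one_le) auto
    qed
  qed
qed

text \<open>The radial retraction onto the closed disc of radius \<open>K\<close>.\<close>

definition clip :: "real \<Rightarrow> complex \<Rightarrow> complex" where
  "clip K z = of_real (K / max K (cmod z)) * z"

lemma continuous_on_clip: "K > 0 \<Longrightarrow> continuous_on S (clip K)"
  unfolding clip_def by (intro continuous_intros) auto

lemma clip_eq: "K > 0 \<Longrightarrow> cmod z \<le> K \<Longrightarrow> clip K z = z"
  by (simp add: clip_def max_def)

lemma norm_clip_le: "K > 0 \<Longrightarrow> cmod (clip K z) \<le> K" "K > 0 \<Longrightarrow> cmod (clip K z) \<le> cmod z"
  by (auto simp: clip_def norm_mult norm_divide max_def divide_simps intro: mult_right_mono)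

text \<open>A measurable function is almost everywhere a limit of continuous ones, but without a
  common bound. Clipping is continuous, so it preserves the limit, and it supplies the constant
  majorant \<open>K\<close>.\<close>

lemma closure_test_space_clip:
  assumes f: "f \<in> borel_measurable torus" and K: "K > 0"
  shows "abs_aux_space (\<lambda>p. clip K (f p)) \<in> closure \<Phi>" "sq_integrable (\<lambda>p. clip K (f p))"
proof -
  define Q where "Q = {0..<2*pi} \<times> {0..<2*pi}"
  have Q: "Q \<in> sets lborel" using square_borel by (simp add: Q_def)
  have "(\<lambda>p. indicator Q p *\<^sub>R f p) \<in> borel_measurable lborel"
    using f Q by (simp add: torus_def Q_def[symmetric] borel_measurable_restrict_space_iff)
  then have "(\<lambda>p. indicator Q p *\<^sub>R f p) \<in> borel_measurable lebesgue"
    by (rule measurable_completion)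
  then have "(\<lambda>p. indicator Q p *\<^sub>R f p) measurable_on UNIV"
    by (rule lebesgue_measurable_imp_measurable_on) simp
  then obtain N g where N: "negligible N" and g: "\<And>n. continuous_on UNIV (g n)"
    and lim: "\<And>p. p \<notin> N \<Longrightarrow> (\<lambda>n. g n p) \<longlonglongrightarrow> indicator Q p *\<^sub>R f p"
    by (auto simp: measurable_on_def)
  have "N \<in> null_sets lebesgue" using N by (simp add: negligible_iff_null_sets)
  then have "AE p in lborel. p \<notin> N" by (metis AE_completion_iff AE_not_in)
  then have AE: "AE p in torus. (\<lambda>n. g n p) \<longlonglongrightarrow> f p"
    unfolding torus_def using Q lim
    by (subst AE_restrict_space_iff) (auto simp: Q_def[symmetric] elim!: eventually_mono dest!: lim)
  have cont: "continuous_on UNIV (\<lambda>p. clip K (g n p))" for n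
    by (rule continuous_on_compose2[OF continuous_on_clip[OF K] g]) auto
  have [measurable]: "clip K \<in> borel_measurable borel"
    by (rule borel_measurable_continuous_onI[OF continuous_on_clip[OF K]])
  interpret finite_measure torus by (rule finite_measure_torus)
  show si: "sq_integrable (\<lambda>p. clip K (f p))"
    unfolding sq_integrable_def
  proof
    show "integrable torus (\<lambda>p. (cmod (clip K (f p)))\<^sup>2)"
      by (rule integrable_const_bound[where B = "K\<^sup>2"])
        (use f in \<open>auto intro!: power_mono norm_clip_le K\<close>)
  qed (use f in measurable)
  show "abs_aux_space (\<lambda>p. clip K (f p)) \<in> closure \<Phi>"
  proof (rule closure_test_space_dominated)
    show "sq_integrable (\<lambda>p. clip K (g n p))" for n
      by (rule sq_integrable_continuous[OF cont])
    show "abs_aux_space (\<lambda>p. clip K (g n p)) \<in> closure \<Phi>" for n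
      by (rule closure_test_space_continuous[OF cont])
    show "sq_integrable (\<lambda>p. clip K (f p))" by (rule si)
    show "sq_integrable (\<lambda>_. of_real K)" by (rule sq_integrable_continuous) simp
    show "AE p in torus. (\<lambda>n. clip K (g n p)) \<longlonglongrightarrow> clip K (f p)"
      using AE
    proof eventually_elim
      case (elim p)
      then show ?case
        by (rule continuous_on_tendsto_compose[OF continuous_on_clip[OF K, of UNIV]]) auto
    qed
    show "AE p in torus. cmod (clip K (g n p)) \<le> cmod (of_real K)" for n
      using norm_clip_le(1)[OF K] K by simp
  qed
qed

text \<open>Clipping at levels that tend to infinity leaves each value eventually unchanged and is
  dominated by the function itself.\<close>

theorem closure_test_space: "closure \<Phi> = UNIV"
proof -
  have "\<phi> \<in> closure \<Phi>" for \<phi>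
  proof (induct \<phi> rule: aux_space.abs_induct)
    case (1 f)
    then have f: "sq_integrable f" by (simp add: ae_eq_refl)
    have fm: "f \<in> borel_measurable torus" using f by (simp add: sq_integrable_def)
    show ?case
    proof (rule closure_test_space_dominated)
      show "sq_integrable (\<lambda>p. clip (real (Suc n)) (f p))"
        "abs_aux_space (\<lambda>p. clip (real (Suc n)) (f p)) \<in> closure \<Phi>" for n
        using closure_test_space_clip[OF fm, of "real (Suc n)"] by auto
      show "AE p in torus. (\<lambda>n. clip (real (Suc n)) (f p)) \<longlonglongrightarrow> f p"
      proof (intro AE_I2 Lim_transform_eventually[OF tendsto_const])
        fix p
        obtain N :: nat where N: "cmod (f p) \<le> real N" using real_arch_simple by blast
        then have "f p = clip (real (Suc n)) (f p)" if "n \<ge> N" for n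
          using that by (intro clip_eq[symmetric]) auto
        then show "\<forall>\<^sub>F n in sequentially. f p = clip (real (Suc n)) (f p)"
          by (auto simp: eventually_sequentially)
      qed
      show "AE p in torus. cmod (clip (real (Suc n)) (f p)) \<le> cmod (f p)" for n
        by (simp add: norm_clip_le)
    qed (rule f)+
  qed
  then show ?thesis by blast
qed

section \<open>Uniqueness of the adjoint on a dense domain\<close>

section \<open>Adjoints\<close>

text \<open>The real part of \<open>inner_aux\<close> is the real inner product of the space; it is
  continuous and already separates points.\<close>

lemma inner_aux_eq_on_dense:
  assumes "closure D = UNIV" "\<And>\<phi>. \<phi> \<in> D \<Longrightarrow> inner_aux \<omega> \<phi> = inner_aux \<omega>' \<phi>"
  shows "\<omega> = \<omega>'"
proof -
  have "D \<subseteq> {\<phi>. inner \<omega> \<phi> = inner \<omega>' \<phi>}"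
    using assms(2) by (auto simp: inner_aux_space_def)
  moreover have "closed {\<phi>. inner \<omega> \<phi> = inner \<omega>' \<phi>}"
    by (intro closed_Collect_eq continuous_intros)
  ultimately have "closure D \<subseteq> {\<phi>. inner \<omega> \<phi> = inner \<omega>' \<phi>}" by (rule closure_minimal)
  then have "inner \<omega> \<phi> = inner \<omega>' \<phi>" for \<phi> using assms(1) by blast
  then have "inner (\<omega> - \<omega>') (\<omega> - \<omega>') = 0" by (simp add: inner_diff_left)
  then show ?thesis by simp
qed

lemma adjoint_op_eqI:
  assumes "closure (dom T) = UNIV"
    and "\<And>\<phi>. \<phi> \<in> dom T \<Longrightarrow> inner_aux \<psi> (the (T \<phi>)) = inner_aux \<omega> \<phi>"
  shows "adjoint_op T \<psi> = Some \<omega>"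
proof -
  have "(THE \<omega>. \<forall>\<phi>\<in>dom T. inner_aux \<psi> (the (T \<phi>)) = inner_aux \<omega> \<phi>) = \<omega>"
    using assms inner_aux_eq_on_dense[OF assms(1)] by (intro the_equality) (simp, metis)
  then show ?thesis using assms(2) by (auto simp: adjoint_op_def)
qed

lemma inner_aux_adjoint_op:
  assumes "closure (dom T) = UNIV" "\<psi> \<in> dom (adjoint_op T)" "\<phi> \<in> dom T"
  shows "inner_aux \<psi> (the (T \<phi>)) = inner_aux (the (adjoint_op T \<psi>)) \<phi>"
proof -
  obtain \<omega> where \<omega>: "\<And>\<phi>. \<phi> \<in> dom T \<Longrightarrow> inner_aux \<psi> (the (T \<phi>)) = inner_aux \<omega> \<phi>"
    using assms(2) by (auto simp: adjoint_op_def split: if_splits)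
  from adjoint_op_eqI[OF assms(1) this] \<omega>[OF assms(3)] show ?thesis by simp
qed

section \<open>Approximate delta functions composed with a function having regular zeros\<close>

section \<open>Concentration on level sets\<close>

text \<open>A hat of height 1/\<epsilon> over a base of length 2\<epsilon>, hence of mass 1 for
  \<epsilon> > 0: an approximate delta at 0.\<close>

definition tent :: "real \<Rightarrow> real \<Rightarrow> real" where
  "tent \<epsilon> x = max 0 (\<epsilon> - \<bar>x\<bar>) / \<epsilon>\<^sup>2"

lemma tent_nonneg: "tent \<epsilon> x \<ge> 0"
  by (simp add: tent_def)

lemma tent_eq_0: "\<epsilon> \<le> \<bar>x\<bar> \<Longrightarrow> tent \<epsilon> x = 0"
  by (simp add: tent_def)

lemma tent_minus: "tent \<epsilon> (- x) = tent \<epsilon> x"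
  by (simp add: tent_def)

lemma continuous_on_tent:
  "continuous_on S f \<Longrightarrow> continuous_on S (\<lambda>x. tent \<epsilon> (f x))"
  unfolding tent_def by (cases "\<epsilon> = 0") (auto intro!: continuous_intros)

lemma has_integral_tent:
  assumes "\<epsilon> > 0" "u \<le> - \<epsilon>" "\<epsilon> \<le> v"
  shows "(tent \<epsilon> has_integral 1) {u..v}"
proof -
  have "((\<lambda>x. (\<epsilon> + x) / \<epsilon>\<^sup>2) has_integral (\<epsilon> * 0 + 0\<^sup>2 / 2) / \<epsilon>\<^sup>2 - (\<epsilon> * (- \<epsilon>) + (- \<epsilon>)\<^sup>2 / 2) / \<epsilon>\<^sup>2) {- \<epsilon>..0}"
  proof (rule fundamental_theorem_of_calculus[where f = "\<lambda>x. (\<epsilon> * x + x\<^sup>2 / 2) / \<epsilon>\<^sup>2"])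
    have "((\<lambda>x. (\<epsilon> * x + x\<^sup>2 / 2) / \<epsilon>\<^sup>2) has_real_derivative (\<epsilon> + x) / \<epsilon>\<^sup>2) (at x within S)" for x S
      by (rule DERIV_cdivide) (auto intro!: derivative_eq_intros)
    then show "((\<lambda>x. (\<epsilon> * x + x\<^sup>2 / 2) / \<epsilon>\<^sup>2) has_vector_derivative (\<epsilon> + x) / \<epsilon>\<^sup>2) (at x within {- \<epsilon>..0})" for x
      by (simp only: has_real_derivative_iff_has_vector_derivative)
  qed (use assms in simp)
  moreover have "(\<epsilon> * 0 + 0\<^sup>2 / 2) / \<epsilon>\<^sup>2 - (\<epsilon> * (- \<epsilon>) + (- \<epsilon>)\<^sup>2 / 2) / \<epsilon>\<^sup>2 = 1/2"
    using assms by (simp add: field_simps power2_eq_square)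
  ultimately have "((\<lambda>x. (\<epsilon> + x) / \<epsilon>\<^sup>2) has_integral 1/2) {- \<epsilon>..0}" by (simp only:)
  then have left: "(tent \<epsilon> has_integral 1/2) {- \<epsilon>..0}"
    by (rule has_integral_eq[rotated]) (use assms in \<open>auto simp: tent_def\<close>)
  have "((\<lambda>x. tent \<epsilon> (- x)) has_integral 1/2) {- 0..- (- \<epsilon>)}"
    using left by (subst has_integral_reflect_real) simp
  then have right: "(tent \<epsilon> has_integral 1/2) {0..\<epsilon>}" by (simp add: tent_minus)
  have "(tent \<epsilon> has_integral 1/2 + 1/2) {- \<epsilon>..\<epsilon>}"
    using assms by (intro has_integral_combine[OF _ _ left right]) auto
  then have "(tent \<epsilon> has_integral 1) {- \<epsilon>..\<epsilon>}" by simp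
  then show ?thesis
    by (rule has_integral_on_superset) (use assms in \<open>auto intro!: tent_eq_0\<close>)
qed

text \<open>The factor \<sigma>, a sign in the applications, treats increasing and decreasing
  branches together.\<close>

lemma derivative_sign_strict_mono:
  fixes H :: "real \<Rightarrow> real"
  assumes D: "\<And>y. y \<in> {c..d} \<Longrightarrow> (H has_real_derivative H' y) (at y)"
    and pos: "\<And>y. y \<in> {c..d} \<Longrightarrow> \<sigma> * H' y > 0"
    and xy: "c \<le> x" "x < y" "y \<le> d"
  shows "\<sigma> * H x < \<sigma> * H y"
proof (rule DERIV_pos_imp_increasing[OF xy(2)])
  fix z assume "x \<le> z" "z \<le> y"
  then have z: "z \<in> {c..d}" using xy by auto
  show "\<exists>D. ((\<lambda>z. \<sigma> * H z) has_real_derivative D) (at z) \<and> 0 < D"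
    using DERIV_cmult[OF D[OF z]] pos[OF z] by blast
qed

lemma derivative_sign_inj_on:
  fixes H :: "real \<Rightarrow> real"
  assumes D: "\<And>y. y \<in> {c..d} \<Longrightarrow> (H has_real_derivative H' y) (at y)"
    and pos: "\<And>y. y \<in> {c..d} \<Longrightarrow> \<sigma> * H' y > 0"
  shows "inj_on H {c..d}"
proof (rule linorder_inj_onI')
  fix x y assume xy: "x < y" "x \<in> {c..d}" "y \<in> {c..d}"
  have "\<sigma> * H x < \<sigma> * H y"
    by (rule derivative_sign_strict_mono[of c d H H', OF D pos]) (use xy in auto)
  then show "H x \<noteq> H y" by auto
qed

lemma derivative_sign_near:
  fixes H' :: "real \<Rightarrow> real"
  assumes "continuous_on UNIV H'" "H' y0 \<noteq> (0::real)" "0 < \<delta>0"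
  obtains \<delta> where "0 < \<delta>" "\<delta> < \<delta>0" "\<And>y. y \<in> {y0 - \<delta>..y0 + \<delta>} \<Longrightarrow> sgn (H' y0) * H' y > 0"
proof -
  have "open ((\<lambda>y. sgn (H' y0) * H' y) -` {0<..})"
    using assms(1) by (intro open_vimage continuous_intros) auto
  moreover have "y0 \<in> (\<lambda>y. sgn (H' y0) * H' y) -` {0<..}"
    using assms(2) by (simp add: sgn_real_def zero_less_mult_iff)
  ultimately obtain e where e: "e > 0" "ball y0 e \<subseteq> (\<lambda>y. sgn (H' y0) * H' y) -` {0<..}"
    by (meson open_contains_ball)
  define \<delta> where "\<delta> = min e \<delta>0 / 2"
  have \<delta>: "0 < \<delta>" "\<delta> < e" "\<delta> < \<delta>0" using e(1) assms(3) by (auto simp: \<delta>_def min_def)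
  have "sgn (H' y0) * H' y > 0" if "y \<in> {y0 - \<delta>..y0 + \<delta>}" for y
  proof -
    have "\<bar>y0 - y\<bar> < e" using that \<delta>(2) by (auto simp: abs_less_iff)
    then have "y \<in> ball y0 e" by (simp add: dist_real_def)
    then have "y \<in> (\<lambda>y. sgn (H' y0) * H' y) -` {0<..}" using e(2) by blast
    then show ?thesis by simp
  qed
  with \<delta> show thesis using that by blast
qed

text \<open>An accumulation point of the level set would belong to it by continuity, yet
  \<open>H\<close> is injective near a point where its derivative is nonzero.\<close>

lemma finite_regular_level_set:
  fixes H :: "real \<Rightarrow> real"
  assumes D: "\<And>y. (H has_real_derivative H' y) (at y)" and cont: "continuous_on UNIV H'"
    and reg: "\<And>y. H y = l \<Longrightarrow> H' y \<noteq> 0"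
  shows "finite {y \<in> {a..b}. H y = l}"
proof (rule ccontr)
  let ?Z = "{y \<in> {a..b}. H y = l}"
  assume "infinite ?Z"
  then obtain x where x: "x \<in> {a..b}" "x islimpt ?Z"
    using compact_Icc[of a b, unfolded compact_eq_Bolzano_Weierstrass, rule_format, of ?Z] by blast
  have cH: "continuous_on UNIV H"
    using DERIV_isCont[OF D] by (intro continuous_at_imp_continuous_on) blast
  have "closed {y. H y = l}" by (intro closed_Collect_eq cH continuous_intros)
  moreover have "x islimpt {y. H y = l}" by (rule islimpt_subset[OF x(2)]) auto
  ultimately have "H x = l" by (auto simp: closed_limpt)
  obtain \<delta> where \<delta>: "0 < \<delta>" "\<And>y. y \<in> {x - \<delta>..x + \<delta>} \<Longrightarrow> sgn (H' x) * H' y > 0"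
    using derivative_sign_near[OF cont reg[OF \<open>H x = l\<close>] zero_less_one] by metis
  obtain y where y: "y \<in> ?Z" "y \<noteq> x" "dist y x < \<delta>"
    using x(2) \<delta>(1) unfolding islimpt_approachable by blast
  have "inj_on H {x - \<delta>..x + \<delta>}" by (rule derivative_sign_inj_on[OF D \<delta>(2)])
  moreover have "y \<in> {x - \<delta>..x + \<delta>}" "x \<in> {x - \<delta>..x + \<delta>}" "H y = H x"
    using y \<open>H x = l\<close> \<delta>(1) by (auto simp: dist_real_def)
  ultimately show False using y(2) inj_onD by metis
qed

text \<open>By the substitution s = H(y), \<open>H'\<close> times the tent has mass 1. The integral
  is therefore an average of the continuous function \<open>K = A / H'\<close>, taken ever closer to
  \<open>y0\<close>.\<close>

lemma tent_tendsto_increasing: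
  fixes H :: "real \<Rightarrow> real" and A :: "real \<Rightarrow> complex"
  assumes D: "\<And>y. (H has_real_derivative H' y) (at y)" and cont: "continuous_on UNIV H'"
    and A: "continuous_on UNIV A"
    and pos: "\<And>y. y \<in> {c..d} \<Longrightarrow> H' y > 0" and y0: "c < y0" "y0 < d" "H y0 = 0"
  shows "((\<lambda>\<epsilon>. integral {c..d} (\<lambda>y. of_real (tent \<epsilon> (H y)) * A y)) \<longlongrightarrow> A y0 / of_real (H' y0)) (at_right 0)"
proof (rule tendstoI)
  fix e :: real assume e: "e > 0"
  have cH: "continuous_on S H" for S
    using DERIV_isCont[OF D] by (intro continuous_at_imp_continuous_on) blast
  have mono: "H x < H y" if "c \<le> x" "x < y" "y \<le> d" for x y
    using derivative_sign_strict_mono[OF D, of c d 1 x y] pos that by simp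
  have ends: "H c < 0" "H d > 0" using mono[of c y0] mono[of y0 d] y0 by auto
  define K where "K y = A y / of_real (H' y)" for y
  have cK: "continuous_on {c..d} K"
    unfolding K_def using pos
    by (intro continuous_intros continuous_on_subset[OF A] continuous_on_subset[OF cont]) force+
  obtain \<delta> where \<delta>: "\<delta> > 0" "\<And>y. y \<in> {c..d} \<Longrightarrow> dist y y0 < \<delta> \<Longrightarrow> dist (K y) (K y0) < e / 2"
    using cK[unfolded continuous_on_iff, rule_format, of y0 "e / 2"] y0 e by auto
  \<comment> \<open>Off the ball, |H| has a positive lower bound \<epsilon>0 by compactness, so
    narrow tents vanish on \<open>C\<close>.\<close>
  define C where "C = {c..d} - ball y0 \<delta>"
  have "compact C" unfolding C_def by (intro compact_diff) auto
  have "\<exists>\<epsilon>0>0. \<forall>y\<in>C. \<epsilon>0 \<le> \<bar>H y\<bar>"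
  proof (cases "C = {}")
    case False
    moreover have "continuous_on C (\<lambda>y. \<bar>H y\<bar>)" by (intro continuous_intros cH)
    ultimately obtain z where z: "z \<in> C" "\<And>y. y \<in> C \<Longrightarrow> \<bar>H z\<bar> \<le> \<bar>H y\<bar>"
      using continuous_attains_inf[OF \<open>compact C\<close>, of "\<lambda>y. \<bar>H y\<bar>"] by auto
    have "z \<noteq> y0" "z \<in> {c..d}" using z(1) \<delta>(1) by (auto simp: C_def)
    then have "H z \<noteq> 0" using mono[of z y0] mono[of y0 z] y0 by (cases "z < y0") auto
    with z show ?thesis by (intro exI[of _ "\<bar>H z\<bar>"]) auto
  qed (auto intro: exI[of _ 1])
  then obtain \<epsilon>0 where \<epsilon>0: "\<epsilon>0 > 0" "\<And>y. y \<in> C \<Longrightarrow> \<epsilon>0 \<le> \<bar>H y\<bar>" by blast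
  \<comment> \<open>The bounds by \<open>- H c\<close> and \<open>H d\<close> keep the whole support
    of the tent inside the range of \<open>H\<close>, so that its full mass 1 is captured; the bound
    by \<epsilon>0 removes \<open>C\<close>.\<close>
  have "dist (integral {c..d} (\<lambda>y. of_real (tent \<epsilon> (H y)) * A y)) (A y0 / of_real (H' y0)) < e"
    if \<epsilon>: "\<epsilon> > 0" "\<epsilon> < min \<epsilon>0 (min (- H c) (H d))" for \<epsilon>
  proof -
    have int1: "((\<lambda>y. H' y *\<^sub>R tent \<epsilon> (H y)) has_integral 1) {c..d}"
    proof -
      have "H ` {c..d} \<subseteq> {H c..H d}"
        using mono by (auto simp: less_eq_real_def)
      then have "((\<lambda>y. H' y *\<^sub>R tent \<epsilon> (H y)) has_integral integral {H c..H d} (tent \<epsilon>)) {c..d}"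
        using y0 ends D
        by (intro has_integral_substitution[of _ _ _ "H c" "H d"] continuous_on_tent continuous_intros)
          (auto intro: DERIV_subset)
      moreover have "integral {H c..H d} (tent \<epsilon>) = 1"
        using \<epsilon> by (intro integral_unique has_integral_tent) auto
      ultimately show ?thesis by simp
    qed
    have eq: "of_real (tent \<epsilon> (H y)) * A y = of_real (H' y *\<^sub>R tent \<epsilon> (H y)) * K y" if "y \<in> {c..d}" for y
      using pos[OF that] by (simp add: K_def)
    have I: "(\<lambda>y. of_real (tent \<epsilon> (H y)) * A y) integrable_on {c..d}"
      by (intro integrable_continuous_real continuous_intros continuous_on_tent cH
          continuous_on_subset[OF A]) auto
    have J: "((\<lambda>y. of_real (H' y *\<^sub>R tent \<epsilon> (H y)) * K y0) has_integral of_real 1 * K y0) {c..d}"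
      by (intro has_integral_mult_left has_integral_of_real int1)
    have L: "((\<lambda>y. of_real (tent \<epsilon> (H y)) * A y - of_real (H' y *\<^sub>R tent \<epsilon> (H y)) * K y0) has_integral
        integral {c..d} (\<lambda>y. of_real (tent \<epsilon> (H y)) * A y) - of_real 1 * K y0) {c..d}"
      by (intro has_integral_diff integrable_integral I J)
    have "norm (integral {c..d} (\<lambda>y. of_real (tent \<epsilon> (H y)) * A y - of_real (H' y *\<^sub>R tent \<epsilon> (H y)) * K y0))
        \<le> integral {c..d} (\<lambda>y. H' y *\<^sub>R tent \<epsilon> (H y) * (e / 2))"
    proof (rule integral_norm_bound_integral)
      show "(\<lambda>y. H' y *\<^sub>R tent \<epsilon> (H y) * (e / 2)) integrable_on {c..d}"
        using has_integral_mult_left[OF int1] by blast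
      fix y assume y: "y \<in> {c..d}"
      show "norm (of_real (tent \<epsilon> (H y)) * A y - of_real (H' y *\<^sub>R tent \<epsilon> (H y)) * K y0)
          \<le> H' y *\<^sub>R tent \<epsilon> (H y) * (e / 2)"
      proof (cases "y \<in> C")
        case True
        then have "tent \<epsilon> (H y) = 0" using \<epsilon> \<epsilon>0(2)[OF True] by (intro tent_eq_0) auto
        then show ?thesis by simp
      next
        case False
        then have "norm (K y - K y0) \<le> e / 2"
          using \<delta>(2)[OF y] y by (auto simp: C_def dist_norm dist_commute norm_minus_commute abs_minus_commute)
        moreover have "H' y *\<^sub>R tent \<epsilon> (H y) \<ge> 0" using pos[OF y] tent_nonneg by simp
        ultimately show ?thesis
          unfolding eq[OF y] right_diff_distrib[symmetric] norm_mult norm_of_real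
          by (simp only: abs_of_nonneg mult_left_mono)
      qed
    qed (rule has_integral_integrable[OF L])
    moreover have "integral {c..d} (\<lambda>y. H' y *\<^sub>R tent \<epsilon> (H y) * (e / 2)) = 1 * (e / 2)"
      by (rule integral_unique[OF has_integral_mult_left[OF int1]])
    ultimately have "norm (integral {c..d} (\<lambda>y. of_real (tent \<epsilon> (H y)) * A y) - of_real 1 * K y0) \<le> e / 2"
      by (simp only: integral_unique[OF L] mult_1)
    then show ?thesis using e by (simp add: dist_norm K_def)
  qed
  moreover have "min \<epsilon>0 (min (- H c) (H d)) > 0" using \<epsilon>0 ends by simp
  ultimately show "\<forall>\<^sub>F \<epsilon> in at_right 0. dist (integral {c..d} (\<lambda>y. of_real (tent \<epsilon> (H y)) * A y)) (A y0 / of_real (H' y0)) < e"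
    unfolding eventually_at_right_field by blast
qed

text \<open>Strong induction on the number of zeros, splitting off a short interval around one of
  them; a decreasing branch is handled through -H because the tent is even. Zeros at the end points
  are excluded since such a zero would catch only half of its tent.\<close>

lemma tent_tendsto_interval:
  fixes H :: "real \<Rightarrow> real" and A :: "real \<Rightarrow> complex"
  assumes D: "\<And>y. (H has_real_derivative H' y) (at y)" and cont: "continuous_on UNIV H'"
    and A: "continuous_on UNIV A" and reg: "\<And>y. H y = 0 \<Longrightarrow> H' y \<noteq> 0"
    and ab: "a \<le> b" "H a \<noteq> 0" "H b \<noteq> 0"
  shows "((\<lambda>\<epsilon>. integral {a..b} (\<lambda>y. of_real (tent \<epsilon> (H y)) * A y))
    \<longlongrightarrow> (\<Sum>y | y \<in> {a..b} \<and> H y = 0. A y / of_real \<bar>H' y\<bar>)) (at_right 0)"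
  using ab
proof (induction "card {y \<in> {a..b}. H y = 0}" arbitrary: a b rule: less_induct)
  case (less a b)
  let ?Z = "\<lambda>a b. {y. y \<in> {a..b} \<and> H y = 0}"
  let ?I = "\<lambda>a b \<epsilon>. integral {a..b} (\<lambda>y. of_real (tent \<epsilon> (H y)) * A y)"
  have fin: "finite (?Z a b)" for a b
    using finite_regular_level_set[of H H' 0 a b, OF D cont reg] by simp
  have cH: "continuous_on S H" for S
    using DERIV_isCont[OF D] by (intro continuous_at_imp_continuous_on) blast
  show ?case
  proof (cases "?Z a b = {}")
    case True
    have "continuous_on {a..b} (\<lambda>y. \<bar>H y\<bar>)" by (intro continuous_intros cH)
    then obtain z where z: "z \<in> {a..b}" "\<And>y. y \<in> {a..b} \<Longrightarrow> \<bar>H z\<bar> \<le> \<bar>H y\<bar>"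
      using continuous_attains_inf[OF compact_Icc, of a b "\<lambda>y. \<bar>H y\<bar>"] less.prems by auto
    have "?I a b \<epsilon> = 0" if "\<epsilon> < \<bar>H z\<bar>" for \<epsilon>
    proof -
      have "?I a b \<epsilon> = integral {a..b} (\<lambda>y. 0)"
        using z that by (intro integral_cong) (force intro: tent_eq_0)
      then show ?thesis by simp
    qed
    moreover have "0 < \<bar>H z\<bar>" using True z(1) by auto
    ultimately have "\<forall>\<^sub>F \<epsilon> in at_right 0. 0 = ?I a b \<epsilon>"
      unfolding eventually_at_right_field by (intro exI[of _ "\<bar>H z\<bar>"]) simp
    from Lim_transform_eventually[OF tendsto_const this] show ?thesis
      by (simp only: True sum.empty)
  next
    case False
    then obtain y0 where y0: "a \<le> y0" "y0 \<le> b" "H y0 = 0" by auto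
    then have "a < y0" "y0 < b" using less.prems by (auto simp: less_le)
    define \<sigma> where "\<sigma> = sgn (H' y0)"
    obtain \<delta> where \<delta>: "0 < \<delta>" "\<delta> < min (y0 - a) (b - y0)"
        "\<And>y. y \<in> {y0 - \<delta>..y0 + \<delta>} \<Longrightarrow> \<sigma> * H' y > 0"
      unfolding \<sigma>_def
      by (rule derivative_sign_near[OF cont reg[OF y0(3)], of "min (y0 - a) (b - y0)"])
        (use \<open>a < y0\<close> \<open>y0 < b\<close> in auto)
    \<comment> \<open>\<open>H\<close> is injective here, so \<open>y0\<close> is the only zero and
      the new end points are not zeros, as the induction hypothesis for the two outer intervals
      requires.\<close>
    define c d where "c = y0 - \<delta>" "d = y0 + \<delta>"
    have cd: "a < c" "c < y0" "y0 < d" "d < b" using \<delta> by (auto simp: c_d_def)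
    have inj: "inj_on H {c..d}" unfolding c_d_def by (rule derivative_sign_inj_on[OF D \<delta>(3)])
    have only: "y = y0" if "y \<in> {c..d}" "H y = 0" for y
      using inj_onD[OF inj, of y y0] that y0 cd by auto
    have Hcd: "H c \<noteq> 0" "H d \<noteq> 0" using only[of c] only[of d] cd by auto
    have "?Z a c \<subseteq> ?Z a b" "?Z d b \<subseteq> ?Z a b" "y0 \<in> ?Z a b" "y0 \<notin> ?Z a c" "y0 \<notin> ?Z d b"
      using y0 cd by auto
    then have "?Z a c \<subset> ?Z a b" "?Z d b \<subset> ?Z a b" by blast+
    then have "card (?Z a c) < card (?Z a b)" "card (?Z d b) < card (?Z a b)"
      by (blast intro: psubset_card_mono fin)+
    note card_less = this
    have IH: "(?I a c \<longlongrightarrow> (\<Sum>y\<in>?Z a c. A y / of_real \<bar>H' y\<bar>)) (at_right 0)"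
      "(?I d b \<longlongrightarrow> (\<Sum>y\<in>?Z d b. A y / of_real \<bar>H' y\<bar>)) (at_right 0)"
      using less.hyps[OF card_less(1)] less.hyps[OF card_less(2)] less.prems cd Hcd by simp_all
    have mid: "(?I c d \<longlongrightarrow> A y0 / of_real \<bar>H' y0\<bar>) (at_right 0)"
    proof (cases "H' y0 > 0")
      case True
      then have "H' y > 0" if "y \<in> {c..d}" for y using \<delta>(3) that by (auto simp: \<sigma>_def c_d_def)
      then have "(?I c d \<longlongrightarrow> A y0 / of_real (H' y0)) (at_right 0)"
        by (intro tent_tendsto_increasing D cont A cd y0(3))
      with True show ?thesis by simp
    next
      case False
      then have neg: "H' y0 < 0" using reg[OF y0(3)] by linarith
      then have "- H' y > 0" if "y \<in> {c..d}" for y using \<delta>(3) that by (auto simp: \<sigma>_def c_d_def)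
      then have "((\<lambda>\<epsilon>. integral {c..d} (\<lambda>y. of_real (tent \<epsilon> (- H y)) * A y))
          \<longlongrightarrow> A y0 / of_real (- H' y0)) (at_right 0)"
        by (intro tent_tendsto_increasing[where H = "\<lambda>y. - H y"] DERIV_minus D continuous_on_minus cont A cd)
          (simp_all add: y0)
      with neg show ?thesis by (simp add: tent_minus)
    qed
    have int: "(\<lambda>y. of_real (tent \<epsilon> (H y)) * A y) integrable_on {u..v}" for u v \<epsilon>
      by (intro integrable_continuous_real continuous_intros continuous_on_tent cH
          continuous_on_subset[OF A]) auto
    have split: "?I a b \<epsilon> = ?I a c \<epsilon> + ?I c d \<epsilon> + ?I d b \<epsilon>" for \<epsilon>
      using cd by (simp add: Henstock_Kurzweil_Integration.integral_combine int less_imp_le)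
    have Z: "?Z a b = insert y0 (?Z a c \<union> ?Z d b)"
    proof (intro equalityI subsetI)
      fix y assume y: "y \<in> ?Z a b"
      show "y \<in> insert y0 (?Z a c \<union> ?Z d b)"
      proof (cases "y \<in> {c..d}")
        case True
        then show ?thesis using only[OF True] y by blast
      next
        case False
        then show ?thesis using y cd by auto
      qed
    qed (use y0 cd in auto)
    have notin: "y0 \<notin> ?Z a c \<union> ?Z d b" "?Z a c \<inter> ?Z d b = {}"
      using cd by (auto simp del: Collect_empty_eq)
    have "(\<Sum>y\<in>?Z a b. A y / of_real \<bar>H' y\<bar>) = (\<Sum>y\<in>?Z a c. A y / of_real \<bar>H' y\<bar>)
        + A y0 / of_real \<bar>H' y0\<bar> + (\<Sum>y\<in>?Z d b. A y / of_real \<bar>H' y\<bar>)"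
      unfolding Z
      by (subst sum.insert[OF finite_UnI[OF fin fin] notin(1)], subst sum.union_disjoint[OF fin fin notin(2)])
        (simp only: add_ac)
    then show ?thesis
      unfolding split by (simp only:) (intro tendsto_add IH mid)
  qed
qed

lemma integral_period_shift:
  fixes f :: "real \<Rightarrow> complex"
  assumes "continuous_on UNIV f" "\<And>y. f (y + T) = f y" "0 \<le> s" "s \<le> T"
  shows "integral {s..s + T} f = integral {0..T} f"
proof -
  have int: "f integrable_on {u..v}" for u v
    using assms(1) by (intro integrable_continuous_real) (rule continuous_on_subset, auto)
  have "integral {T..s + T} f = integral {0..s} (f \<circ> (\<lambda>y. y + T))"
    using integral_shift[of 0 T s f] continuous_on_subset[OF assms(1)] by (simp add: add.commute)
  also have "\<dots> = integral {0..s} f" using assms(2) by (simp add: o_def)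
  finally have "integral {s..T} f + integral {T..s + T} f = integral {s..T} f + integral {0..s} f"
    by simp
  then show ?thesis
    using Henstock_Kurzweil_Integration.integral_combine[of s T "s + T" f]
      Henstock_Kurzweil_Integration.integral_combine[of 0 s T f] assms(3,4) int
    by (simp add: add.commute)
qed

lemma integral_period:
  fixes f :: "real \<Rightarrow> complex"
  assumes "continuous_on UNIV f" "\<And>y. f (y + T) = f y" "0 < T"
  shows "integral {s..s + T} f = integral {0..T} f"
proof -
  interpret periodic_fun_simple f T by unfold_locales (rule assms(2))
  define k where "k = \<lfloor>s / T\<rfloor>"
  define r where "r = s - of_int k * T"
  have "of_int k \<le> s / T" "s / T < of_int k + 1" unfolding k_def by linarith+
  then have r: "0 \<le> r" "r \<le> T" using assms(3) by (auto simp: r_def field_simps)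
  have "integral {s..s + T} f = integral {r..r + T} (f \<circ> (\<lambda>y. y + of_int k * T))"
    using integral_shift[of r "of_int k * T" "r + T" f] continuous_on_subset[OF assms(1)]
    by (simp add: r_def algebra_simps)
  also have "\<dots> = integral {r..r + T} f" by (simp add: o_def plus_of_int)
  also have "\<dots> = integral {0..T} f" by (rule integral_period_shift[OF assms(1,2) r])
  finally show ?thesis .
qed

text \<open>A solution may sit exactly at the seam 0. As the level set is finite, the circle can be
  cut at a point \<open>s\<close> off the level instead, and periodicity carries integral and sum
  back to the standard period.\<close>

theorem tent_tendsto_circle:
  fixes R :: "real \<Rightarrow> real" and A :: "real \<Rightarrow> complex"
  assumes R: "circle_smooth R" and reg: "\<And>y. R y = l \<Longrightarrow> vderiv R y \<noteq> 0"
    and A: "continuous_on UNIV A" "\<And>y. A (y + 2 * pi) = A y"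
  shows "((\<lambda>\<epsilon>. integral {0..2 * pi} (\<lambda>y. of_real (tent \<epsilon> (R y - l)) * A y))
    \<longlongrightarrow> (\<Sum>y | y \<in> {0..<2 * pi} \<and> R y = l. A y / of_real \<bar>vderiv R y\<bar>)) (at_right 0)"
proof -
  have DR: "(R has_real_derivative vderiv R y) (at y)" for y
    using R Ck_on_has_vector_derivative[of 0 UNIV R]
    by (simp add: circle_smooth_iff has_real_derivative_iff_has_vector_derivative)
  then have D: "((\<lambda>y. R y - l) has_real_derivative vderiv R y) (at y)" for y
    by (auto intro!: derivative_eq_intros)
  have cont: "continuous_on S (vderiv R)" for S
    by (intro continuous_circle_smooth circle_smooth_vderiv R)
  have per: "R (y + 2 * pi) = R y" "vderiv R (y + 2 * pi) = vderiv R y" for y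
    using R circle_smooth_vderiv[OF R] by (auto simp: circle_smooth_iff)
  have fin: "finite {y \<in> {a..b}. R y = l}" for a b
    using finite_regular_level_set[of R "vderiv R" l a b, OF DR cont reg] by simp
  have "infinite {0..<2 * pi}" by simp
  then have "\<exists>s\<in>{0..<2 * pi}. R s \<noteq> l"
    using finite_subset[OF _ fin[of 0 "2 * pi"], of "{0..<2 * pi}"] by fastforce
  then obtain s where s: "0 \<le> s" "s < 2 * pi" "R s \<noteq> l" by auto
  have I: "integral {s..s + 2 * pi} (\<lambda>y. of_real (tent \<epsilon> (R y - l)) * A y)
      = integral {0..2 * pi} (\<lambda>y. of_real (tent \<epsilon> (R y - l)) * A y)" for \<epsilon>
    by (intro integral_period continuous_intros continuous_on_tent continuous_circle_smooth[OF R] A)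
      (simp_all add: A per)
  let ?B = "\<lambda>y. A y / of_real \<bar>vderiv R y\<bar>"
  have "(\<Sum>y | y \<in> {s..s + 2 * pi} \<and> R y - l = 0. ?B y) = (\<Sum>y | y \<in> {0..<2 * pi} \<and> R y = l. ?B y)"
  proof -
    \<comment> \<open>The period starting at \<open>s\<close> is the standard one with the piece
      from 0 to \<open>s\<close> moved up by 2 pi.\<close>
    let ?X = "{y. y \<in> {s..<2 * pi} \<and> R y = l}" and ?Y = "{y. y \<in> {0..<s} \<and> R y = l}"
    have fX: "finite ?X" "finite ?Y"
      by (rule finite_subset[OF _ fin[of 0 "2 * pi"]], use s in force)+
    have im: "(\<lambda>y. y + 2 * pi) ` ?Y = {y. y \<in> {2 * pi..<s + 2 * pi} \<and> R y = l}"
    proof (intro equalityI subsetI)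
      fix y assume "y \<in> {y. y \<in> {2 * pi..<s + 2 * pi} \<and> R y = l}"
      then have "y - 2 * pi \<in> ?Y" using per(1)[of "y - 2 * pi"] by auto
      then show "y \<in> (\<lambda>y. y + 2 * pi) ` ?Y" by (rule rev_image_eqI) simp
    qed (auto simp: per)
    have "{y. y \<in> {s..s + 2 * pi} \<and> R y - l = 0} = ?X \<union> (\<lambda>y. y + 2 * pi) ` ?Y"
      unfolding im using s per(1)[of s] by (auto simp: less_le)
    moreover have "?X \<inter> (\<lambda>y. y + 2 * pi) ` ?Y = {}" unfolding im by auto
    ultimately have "(\<Sum>y | y \<in> {s..s + 2 * pi} \<and> R y - l = 0. ?B y)
        = sum ?B ?X + sum ?B ((\<lambda>y. y + 2 * pi) ` ?Y)"
      using fX by (simp only: sum.union_disjoint finite_imageI)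
    also have "sum ?B ((\<lambda>y. y + 2 * pi) ` ?Y) = sum ?B ?Y"
      by (subst sum.reindex) (auto simp: A per o_def)
    also have "sum ?B ?X + sum ?B ?Y = sum ?B (?X \<union> ?Y)"
      using fX by (intro sum.union_disjoint[symmetric]) auto
    also have "?X \<union> ?Y = {y. y \<in> {0..<2 * pi} \<and> R y = l}" using s by auto
    finally show ?thesis .
  qed
  moreover have "((\<lambda>\<epsilon>. integral {s..s + 2 * pi} (\<lambda>y. of_real (tent \<epsilon> (R y - l)) * A y))
    \<longlongrightarrow> (\<Sum>y | y \<in> {s..s + 2 * pi} \<and> R y - l = 0. ?B y)) (at_right 0)"
    by (rule tent_tendsto_interval[where H = "\<lambda>y. R y - l" and H' = "vderiv R", OF D cont A(1)])
      (use reg s per(1)[of s] in auto)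
  ultimately show ?thesis by (simp add: I)
qed

section \<open>Trigonometric approximation and equality of the level-set sums\<close>

section \<open>The intertwining property\<close>

text \<open>The frequencies are arbitrary reals, like the times in the unitary group. Constants
  arise at \<open>t = 0\<close>, and the product formulas keep products inside the set.\<close>

inductive_set trig_sums :: "(real \<Rightarrow> real) set" where
  cos: "(\<lambda>x. a * cos (t * x)) \<in> trig_sums"
| sin: "(\<lambda>x. a * sin (t * x)) \<in> trig_sums"
| add: "f \<in> trig_sums \<Longrightarrow> g \<in> trig_sums \<Longrightarrow> (\<lambda>x. f x + g x) \<in> trig_sums"

text \<open>Shaped so that both resulting summands are literally generators of
  \<open>trig_sums\<close>, amplitude first.\<close>

lemma product_to_sum:
  fixes p q u v a b :: real
  shows "p * q = (u + v) / 2 \<Longrightarrow> a * p * (b * q) = (a * b / 2) * u + (a * b / 2) * v"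
    and "p * q = (u - v) / 2 \<Longrightarrow> a * p * (b * q) = (a * b / 2) * u + (- (a * b / 2)) * v"
proof -
  have e: "a * p * (b * q) = a * b * (p * q)" by simp
  show "a * p * (b * q) = (a * b / 2) * u + (a * b / 2) * v" if "p * q = (u + v) / 2"
    unfolding e that by (simp add: field_simps)
  show "a * p * (b * q) = (a * b / 2) * u + (- (a * b / 2)) * v" if "p * q = (u - v) / 2"
    unfolding e that by (simp add: field_simps)
qed

lemma trig_sums_mult_cos:
  assumes "g \<in> trig_sums" shows "(\<lambda>x. a * cos (t * x) * g x) \<in> trig_sums"
  using assms
proof induction
  case (cos b s)
  have "(\<lambda>x. a * cos (t * x) * (b * cos (s * x)))
      = (\<lambda>x. (a * b / 2) * cos ((t - s) * x) + (a * b / 2) * cos ((t + s) * x))"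
    by (simp only: product_to_sum(1)[OF cos_times_cos] left_diff_distrib distrib_right)
  then show ?case by (simp only: trig_sums.intros)
next
  case (sin b s)
  have "(\<lambda>x. a * cos (t * x) * (b * sin (s * x)))
      = (\<lambda>x. (a * b / 2) * sin ((t + s) * x) + (- (a * b / 2)) * sin ((t - s) * x))"
    by (simp only: product_to_sum(2)[OF cos_times_sin] left_diff_distrib distrib_right)
  then show ?case by (simp only: trig_sums.intros)
next
  case (add f g)
  then show ?case using trig_sums.add by (simp add: distrib_left)
qed

lemma trig_sums_mult_sin:
  assumes "g \<in> trig_sums" shows "(\<lambda>x. a * sin (t * x) * g x) \<in> trig_sums"
  using assms
proof induction
  case (cos b s)
  have "(\<lambda>x. a * sin (t * x) * (b * cos (s * x)))
      = (\<lambda>x. (a * b / 2) * sin ((t + s) * x) + (a * b / 2) * sin ((t - s) * x))"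
    by (simp only: product_to_sum(1)[OF sin_times_cos] left_diff_distrib distrib_right)
  then show ?case by (simp only: trig_sums.intros)
next
  case (sin b s)
  have "(\<lambda>x. a * sin (t * x) * (b * sin (s * x)))
      = (\<lambda>x. (a * b / 2) * cos ((t - s) * x) + (- (a * b / 2)) * cos ((t + s) * x))"
    by (simp only: product_to_sum(2)[OF sin_times_sin] left_diff_distrib distrib_right)
  then show ?case by (simp only: trig_sums.intros)
next
  case (add f g)
  then show ?case using trig_sums.add by (simp add: distrib_left)
qed

lemma trig_sums_mult:
  assumes "f \<in> trig_sums" "g \<in> trig_sums" shows "(\<lambda>x. f x * g x) \<in> trig_sums"
  using assms
proof induction
  case (add f1 f2)
  then show ?case using trig_sums.add by (simp add: distrib_right)
qed (simp_all add: trig_sums_mult_cos trig_sums_mult_sin)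

lemma continuous_on_trig_sums: "f \<in> trig_sums \<Longrightarrow> continuous_on S f"
  by (induction rule: trig_sums.induct) (auto intro!: continuous_intros)

lemma function_ring_on_trig_sums:
  assumes "L > 0" shows "function_ring_on trig_sums {- L..L}"
proof
  show "(\<lambda>_. c) \<in> trig_sums" for c using trig_sums.cos[of c 0] by simp
  fix x y assume xy: "x \<in> {- L..L}" "y \<in> {- L..L}" "x \<noteq> y"
  \<comment> \<open>Frequency 1/L squeezes the interval into [-1, 1], on which the sine is
    injective; that one function separates all points.\<close>
  have bound: "- (pi / 2) \<le> z / L \<and> z / L \<le> pi / 2" if "z \<in> {- L..L}" for z
  proof -
    have "- 1 \<le> z / L" "z / L \<le> 1" using that assms by (auto simp: field_simps)
    then show ?thesis using pi_ge_two by linarith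
  qed
  have "sin (x / L) \<noteq> sin (y / L)"
  proof
    assume "sin (x / L) = sin (y / L)"
    then have "x / L = y / L" using bound[OF xy(1)] bound[OF xy(2)] by (metis arcsin_sin)
    with xy(3) assms show False by simp
  qed
  then show "\<exists>f\<in>trig_sums. f x \<noteq> f y"
    using trig_sums.sin[of 1 "1 / L"] by (intro bexI) auto
qed (auto intro: continuous_on_trig_sums trig_sums.add trig_sums_mult)

text \<open>The functional \<Lambda> sees \<open>q\<close> only through its values on an interval
  [-L, L] containing all \<open>w m y\<close>, and is bounded there in the supremum norm by
  \<open>M\<close>, the total mass of the \<open>C m\<close>. It kills exponentials, hence
  \<open>trig_sums\<close>, hence all their uniform limits.\<close>

lemma vanishing_Fourier_integrals:
  fixes w :: "'i \<Rightarrow> real \<Rightarrow> real" and C :: "'i \<Rightarrow> real \<Rightarrow> complex"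
  assumes S: "finite S" and w: "\<And>m. continuous_on {a..b} (w m)" and C: "\<And>m. continuous_on {a..b} (C m)"
    and zero: "\<And>t. (\<Sum>m\<in>S. integral {a..b} (\<lambda>y. exp (\<i> * of_real (t * w m y)) * C m y)) = 0"
    and q: "continuous_on UNIV q"
  shows "(\<Sum>m\<in>S. integral {a..b} (\<lambda>y. of_real (q (w m y)) * C m y)) = 0"
proof -
  define \<Lambda> where "\<Lambda> q = (\<Sum>m\<in>S. integral {a..b} (\<lambda>y. q (w m y) * C m y))" for q :: "real \<Rightarrow> complex"
  have int: "(\<lambda>y. q (w m y) * C m y) integrable_on {a..b}" if "continuous_on UNIV q" for q :: "real \<Rightarrow> complex" and m
    by (intro integrable_continuous_real continuous_on_mult C continuous_on_compose2[OF that w]) auto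
  have \<Lambda>_lin: "\<Lambda> (\<lambda>x. r * q x + s * q' x) = r * \<Lambda> q + s * \<Lambda> q'"
    if "continuous_on UNIV q" "continuous_on UNIV q'" for q q' r s
  proof -
    have "integral {a..b} (\<lambda>y. (r * q (w m y) + s * q' (w m y)) * C m y)
      = r * integral {a..b} (\<lambda>y. q (w m y) * C m y) + s * integral {a..b} (\<lambda>y. q' (w m y) * C m y)" for m
    proof -
      have "(\<lambda>y. (r * q (w m y) + s * q' (w m y)) * C m y)
          = (\<lambda>y. r * (q (w m y) * C m y) + s * (q' (w m y) * C m y))"
        by (simp add: fun_eq_iff algebra_simps)
      then show ?thesis
        using int[OF that(1), of m] int[OF that(2), of m]
        by (simp add: Henstock_Kurzweil_Integration.integral_add integrable_on_mult_right)
    qed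
    then show ?thesis by (simp add: \<Lambda>_def sum.distrib sum_distrib_left)
  qed
  have \<Lambda>_exp: "\<Lambda> (\<lambda>x. exp (\<i> * of_real (t * x))) = 0" for t
    using zero[of t] by (simp add: \<Lambda>_def)
  have cexp: "continuous_on UNIV (\<lambda>x. exp (\<i> * complex_of_real (t * x)))" for t
    by (intro continuous_intros)
  have \<Lambda>_trig: "\<Lambda> (\<lambda>x. of_real (p x)) = 0" if "p \<in> trig_sums" for p
    using that
  proof induction
    case (cos r t)
    have "complex_of_real (r * cos (t * x)) = of_real r / 2 * exp (\<i> * of_real (t * x))
        + of_real r / 2 * exp (\<i> * of_real ((- t) * x))" for x
      by (simp add: complex_eq_iff Re_exp Im_exp)
    then show ?case by (simp only: \<Lambda>_lin[OF cexp cexp] \<Lambda>_exp) simp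
  next
    case (sin r t)
    have "complex_of_real (r * sin (t * x)) = - \<i> * of_real r / 2 * exp (\<i> * of_real (t * x))
        + \<i> * of_real r / 2 * exp (\<i> * of_real ((- t) * x))" for x
      by (simp add: complex_eq_iff Re_exp Im_exp)
    then show ?case by (simp only: \<Lambda>_lin[OF cexp cexp] \<Lambda>_exp) simp
  next
    case (add f g)
    then show ?case
      using \<Lambda>_lin[of "\<lambda>x. of_real (f x)" "\<lambda>x. of_real (g x)" 1 1]
      by (simp add: continuous_on_of_real continuous_on_trig_sums)
  qed
  have "\<exists>L>0. \<forall>m\<in>S. \<forall>y\<in>{a..b}. \<bar>w m y\<bar> \<le> L"
  proof -
    have "compact (\<Union>m\<in>S. w m ` {a..b})"
      by (intro compact_UN S compact_continuous_image w compact_Icc)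
    then have "bounded (\<Union>m\<in>S. w m ` {a..b})" by (rule compact_imp_bounded)
    then obtain L where "L > 0" "\<forall>x\<in>(\<Union>m\<in>S. w m ` {a..b}). norm x \<le> L"
      by (auto simp: bounded_pos)
    then show ?thesis by (intro exI[of _ L]) auto
  qed
  then obtain L where L0: "L > 0" "\<And>m y. m \<in> S \<Longrightarrow> y \<in> {a..b} \<Longrightarrow> \<bar>w m y\<bar> \<le> L"
    by blast
  have L: "L > 0" "\<And>m y. m \<in> S \<Longrightarrow> y \<in> {a..b} \<Longrightarrow> w m y \<in> {- L..L}"
    using L0 by (auto simp: abs_le_iff minus_le_iff)
  interpret function_ring_on trig_sums "{- L..L}" by (rule function_ring_on_trig_sums[OF L(1)])
  define M where "M = (\<Sum>m\<in>S. integral {a..b} (\<lambda>y. norm (C m y)))"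
  have "norm (\<Lambda> (\<lambda>x. of_real (q x))) \<le> e * M" if e: "e > 0" for e
  proof -
    obtain p where p: "p \<in> trig_sums" "\<And>x. x \<in> {- L..L} \<Longrightarrow> \<bar>q x - p x\<bar> < e"
      using Stone_Weierstrass_basic[OF continuous_on_subset[OF q subset_UNIV] e] by auto
    have cp: "continuous_on UNIV p" by (rule continuous_on_trig_sums[OF p(1)])
    have "\<Lambda> (\<lambda>x. of_real (q x)) = \<Lambda> (\<lambda>x. of_real (q x - p x))"
      using \<Lambda>_lin[of "\<lambda>x. of_real (q x)" "\<lambda>x. of_real (p x)" 1 "-1"] q cp \<Lambda>_trig[OF p(1)]
      by (simp add: continuous_on_of_real)
    also have "norm \<dots> \<le> (\<Sum>m\<in>S. norm (integral {a..b} (\<lambda>y. of_real (q (w m y) - p (w m y)) * C m y)))"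
      unfolding \<Lambda>_def by (rule norm_sum)
    also have "\<dots> \<le> (\<Sum>m\<in>S. e * integral {a..b} (\<lambda>y. norm (C m y)))"
    proof (rule sum_mono)
      fix m assume m: "m \<in> S"
      have "norm (integral {a..b} (\<lambda>y. of_real (q (w m y) - p (w m y)) * C m y))
          \<le> integral {a..b} (\<lambda>y. e * norm (C m y))"
      proof (rule integral_norm_bound_integral)
        show "(\<lambda>y. of_real (q (w m y) - p (w m y)) * C m y) integrable_on {a..b}"
          by (rule int) (intro continuous_intros q cp)
        show "(\<lambda>y. e * norm (C m y)) integrable_on {a..b}"
          by (intro integrable_continuous_real continuous_intros C)
        show "norm (of_real (q (w m y) - p (w m y)) * C m y) \<le> e * norm (C m y)" if "y \<in> {a..b}" for y
          using p(2)[OF L(2)[OF m that]] unfolding norm_mult norm_of_real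
          by (intro mult_right_mono) auto
      qed
      then show "norm (integral {a..b} (\<lambda>y. of_real (q (w m y) - p (w m y)) * C m y))
          \<le> e * integral {a..b} (\<lambda>y. norm (C m y))" by simp
    qed
    finally show ?thesis by (simp add: M_def sum_distrib_left)
  qed
  note small = this
  have "norm (\<Lambda> (\<lambda>x. of_real (q x))) \<le> 0"
  proof (rule field_le_epsilon)
    fix e :: real assume e: "e > 0"
    have "M \<ge> 0" unfolding M_def by (intro sum_nonneg integral_nonneg)
      (auto intro!: integrable_continuous_real continuous_intros C)
    \<comment> \<open>The denominator \<open>M + 1\<close> covers the case
      \<open>M = 0\<close>.\<close>
    then have "e / (M + 1) * M \<le> e" using e by (simp add: field_simps)
    then show "norm (\<Lambda> (\<lambda>x. of_real (q x))) \<le> 0 + e"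
      using small[of "e / (M + 1)"] e \<open>M \<ge> 0\<close> by simp
  qed
  then show ?thesis by (simp add: \<Lambda>_def)
qed

text \<open>The modes of \<open>f\<close> alone reduce the infinite sum to a finite one. The set
  \<open>S\<close> may exceed them so that two test functions can share one index set.\<close>

lemma eta_eq_sum:
  assumes "g \<in> \<Phi>" "finite S" "{m. mode f m \<noteq> (\<lambda>_. 0)} \<subseteq> S"
  shows "eta R f g = of_real ((2*pi)\<^sup>2) * (\<Sum>m\<in>S. \<Sum>y | y \<in> {0..<2*pi} \<and> R y = (of_int m)\<^sup>2.
    cnj (mode f m y) * mode g m y / of_real \<bar>vderiv R y\<bar>)"
proof -
  have "(\<Sum>\<^sub>\<infinity>m::int. \<Sum>y | y \<in> {0..<2*pi} \<and> R y = (of_int m)\<^sup>2.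
      cnj (mode f m y) * mode g m y / of_real \<bar>vderiv R y\<bar>)
    = (\<Sum>\<^sub>\<infinity>m\<in>S. \<Sum>y | y \<in> {0..<2*pi} \<and> R y = (of_int m)\<^sup>2.
      cnj (mode f m y) * mode g m y / of_real \<bar>vderiv R y\<bar>)"
  proof (rule infsum_cong_neutral)
    fix m assume "m \<in> UNIV - S"
    then have "mode f m = (\<lambda>_. 0)" using assms(3) by auto
    then show "(\<Sum>y | y \<in> {0..<2*pi} \<and> R y = (of_int m)\<^sup>2.
      cnj (mode f m y) * mode g m y / of_real \<bar>vderiv R y\<bar>) = 0" by simp
  qed auto
  then show ?thesis using assms(1,2) by (simp add: eta_def)
qed

lemma inner_aux_evolve:
  assumes R: "circle_smooth R" and f: "f \<in> \<Phi>" and g: "g \<in> \<Phi>"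
    and S: "finite S" "{m. mode f m \<noteq> (\<lambda>_. 0)} \<subseteq> S"
  shows "inner_aux (evolve R t f) g = 2 * of_real pi * (\<Sum>m\<in>S. integral {0..2*pi}
    (\<lambda>y. exp (\<i> * of_real (t * ((of_int m)\<^sup>2 - R y))) * (cnj (mode f m y) * mode g m y)))"
proof -
  have "{m. evolve_modes R t (mode f) m \<noteq> (\<lambda>_. 0)} \<subseteq> S"
    using S(2) by (auto simp: evolve_modes_def)
  then have "inner_aux (evolve R t f) (test_fun (mode g)) = 2 * of_real pi * (\<Sum>m\<in>S. integral {0..2*pi}
    (\<lambda>y. cnj (evolve_modes R t (mode f) m y) * mode g m y))"
    unfolding evolve_def
    by (intro inner_aux_test_fun evolve_modes_in_modes mode_in_modes R f g S(1))
  moreover have "cnj (evolve_modes R t (mode f) m y) * mode g m y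
      = exp (\<i> * of_real (t * ((of_int m)\<^sup>2 - R y))) * (cnj (mode f m y) * mode g m y)" for m y
    by (simp add: evolve_modes_def exp_cnj mult.assoc)
  ultimately show ?thesis by (simp only: test_fun_mode[OF g])
qed

text \<open>The evolution stands in the first argument on both sides, so
  \<open>inner_aux_evolve\<close> turns both into integrals against the same phases.\<close>

lemma observable_evolve_adjoint:
  assumes R: "circle_smooth R" and T: "T \<in> observables R" and f: "f \<in> \<Phi>" and g: "g \<in> \<Phi>"
  shows "inner_aux (evolve R t (the (T f))) g = inner_aux (evolve R t f) (the (adjoint_op T g))"
proof -
  have "inner_aux g (the (T (evolve R t f))) = inner_aux (the (adjoint_op T g)) (evolve R t f)"
    using T f g evolve_in_test_space[OF R f]
    by (intro inner_aux_adjoint_op) (auto simp: observables_def)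
  moreover have "the (T (evolve R t f)) = evolve R t (the (T f))"
    using T f by (auto simp: observables_def)
  ultimately show ?thesis
    by (simp add: inner_aux_commute[of g] inner_aux_commute[of "the (adjoint_op T g)"])
qed

theorem eta_intertwining:
  assumes R: "circle_smooth R"
    and reg: "\<And>(m::int) y. R y = (of_int m)\<^sup>2 \<Longrightarrow> vderiv R y \<noteq> 0"
    and T: "T \<in> observables R" and f: "f \<in> \<Phi>" and g: "g \<in> \<Phi>"
  shows "eta R (the (T f)) g = eta R f (the (adjoint_op T g))"
proof -
  define f' g' where "f' = the (T f)" and "g' = the (adjoint_op T g)"
  have fg': "f' \<in> \<Phi>" "g' \<in> \<Phi>" using T f g by (auto simp: observables_def f'_def g'_def)
  \<comment> \<open>One index set for \<open>f\<close> and its image, so that the two families of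
    integrals can be subtracted term by term.\<close>
  define S where "S = {m. mode f m \<noteq> (\<lambda>_. 0)} \<union> {m. mode f' m \<noteq> (\<lambda>_. 0)}"
  have S: "finite S" "{m. mode f m \<noteq> (\<lambda>_. 0)} \<subseteq> S" "{m. mode f' m \<noteq> (\<lambda>_. 0)} \<subseteq> S"
    using mode_in_modes[OF f] mode_in_modes[OF fg'(1)] by (auto simp: S_def modes_def)
  define A where "A m y = cnj (mode f' m y) * mode g m y" for m y
  define B where "B m y = cnj (mode f m y) * mode g' m y" for m y
  have AB: "continuous_on X (A m)" "continuous_on X (B m)" for X m
    unfolding A_def B_def by (intro continuous_intros continuous_on_mode f g fg')+
  have AB_per: "A m (y + 2 * pi) = A m y" "B m (y + 2 * pi) = B m y" for m y
    by (simp_all add: A_def B_def mode_periodic f g fg')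
  have cR: "continuous_on X R" for X by (rule continuous_circle_smooth[OF R])
  have diff: "(\<Sum>m\<in>S. integral {0..2*pi} (\<lambda>y. k m y * (A m y - B m y)))
      = (\<Sum>m\<in>S. integral {0..2*pi} (\<lambda>y. k m y * A m y)) - (\<Sum>m\<in>S. integral {0..2*pi} (\<lambda>y. k m y * B m y))"
    if "\<And>m. continuous_on {0..2*pi} (k m)" for k
    by (simp add: right_diff_distrib sum_subtractf[symmetric] Henstock_Kurzweil_Integration.integral_diff
        integrable_continuous_real continuous_on_mult that AB)
  have "(\<Sum>m\<in>S. integral {0..2*pi} (\<lambda>y. exp (\<i> * of_real (t * ((of_int m)\<^sup>2 - R y))) * (A m y - B m y))) = 0" for t
  proof (subst diff)
    show "continuous_on {0..2*pi} (\<lambda>y. exp (\<i> * complex_of_real (t * ((of_int m)\<^sup>2 - R y))))" for m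
      by (intro continuous_intros cR)
    show "(\<Sum>m\<in>S. integral {0..2*pi} (\<lambda>y. exp (\<i> * of_real (t * ((of_int m)\<^sup>2 - R y))) * A m y))
      - (\<Sum>m\<in>S. integral {0..2*pi} (\<lambda>y. exp (\<i> * of_real (t * ((of_int m)\<^sup>2 - R y))) * B m y)) = 0"
      using observable_evolve_adjoint[OF R T f g, of t]
        inner_aux_evolve[OF R fg'(1) g S(1,3)] inner_aux_evolve[OF R f fg'(2) S(1,2)]
      by (simp add: A_def B_def f'_def g'_def)
  qed
  from vanishing_Fourier_integrals[OF S(1) _ _ this continuous_on_tent[OF continuous_on_id]]
  have "(\<Sum>m\<in>S. integral {0..2*pi} (\<lambda>y. of_real (tent \<epsilon> ((of_int m)\<^sup>2 - R y)) * (A m y - B m y))) = 0" for \<epsilon>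
    by (simp add: AB cR continuous_on_diff continuous_on_const)
  moreover have "tent \<epsilon> ((of_int m)\<^sup>2 - R y) = tent \<epsilon> (R y - (of_int m)\<^sup>2)" for \<epsilon> m y
    using tent_minus[of \<epsilon> "R y - (of_int m)\<^sup>2"] by simp
  ultimately have eq: "(\<Sum>m\<in>S. integral {0..2*pi} (\<lambda>y. of_real (tent \<epsilon> (R y - (of_int m)\<^sup>2)) * A m y))
      = (\<Sum>m\<in>S. integral {0..2*pi} (\<lambda>y. of_real (tent \<epsilon> (R y - (of_int m)\<^sup>2)) * B m y))" for \<epsilon>
    by (subst (asm) diff) (auto intro!: continuous_on_of_real continuous_on_tent continuous_intros cR)
  have lim: "((\<lambda>\<epsilon>. \<Sum>m\<in>S. integral {0..2*pi} (\<lambda>y. of_real (tent \<epsilon> (R y - (of_int m)\<^sup>2)) * D m y))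
    \<longlongrightarrow> (\<Sum>m\<in>S. \<Sum>y | y \<in> {0..<2 * pi} \<and> R y = (of_int m)\<^sup>2. D m y / of_real \<bar>vderiv R y\<bar>)) (at_right 0)"
    if "\<And>m. continuous_on UNIV (D m)" "\<And>m y. D m (y + 2 * pi) = D m y" for D :: "int \<Rightarrow> real \<Rightarrow> complex"
    by (intro tendsto_sum tent_tendsto_circle R that reg)
  \<comment> \<open>By \<open>eq\<close> the two families indexed by \<epsilon> coincide, so their
    limits at 0 do.\<close>
  have "(\<Sum>m\<in>S. \<Sum>y | y \<in> {0..<2 * pi} \<and> R y = (of_int m)\<^sup>2. A m y / of_real \<bar>vderiv R y\<bar>)
      = (\<Sum>m\<in>S. \<Sum>y | y \<in> {0..<2 * pi} \<and> R y = (of_int m)\<^sup>2. B m y / of_real \<bar>vderiv R y\<bar>)"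
    using lim[of A, OF AB(1) AB_per(1)] lim[of B, OF AB(2) AB_per(2)] unfolding eq
    by (rule tendsto_unique[rotated]) simp
  then show ?thesis
    unfolding f'_def[symmetric] g'_def[symmetric]
    by (simp only: eta_eq_sum[OF g S(1,3)] eta_eq_sum[OF fg'(2) S(1,2)] A_def B_def)
qed

section \<open>Local inverse branches of \<open>R\<close> and transport along them\<close>

section \<open>Local inverses and transfer operators\<close>

text \<open>Here \<psi> inverts the coordinate s = R(y) - l around \<open>y0\<close>. The bound
  \<delta> < pi makes the interval an honest arc of the circle, and \<open>ends\<close> keeps its
  end points outside the range |s| < \<epsilon> of the coordinate.\<close>

locale branch =
  fixes R :: "real \<Rightarrow> real" and l y0 \<delta> \<epsilon> :: real and \<psi> :: "real \<Rightarrow> real"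
  assumes smooth_R: "circle_smooth R"
    and delta: "0 < \<delta>" "\<delta> < pi" and eps: "0 < \<epsilon>"
    and level: "R y0 = l"
    and sign: "y \<in> {y0 - \<delta>..y0 + \<delta>} \<Longrightarrow> sgn (vderiv R y0) * vderiv R y > 0"
    and ends: "\<epsilon> \<le> \<bar>R (y0 - \<delta>) - l\<bar>" "\<epsilon> \<le> \<bar>R (y0 + \<delta>) - l\<bar>"
    and inverse: "\<bar>s\<bar> < \<epsilon> \<Longrightarrow> \<psi> s \<in> {y0 - \<delta>..y0 + \<delta>}" "\<bar>s\<bar> < \<epsilon> \<Longrightarrow> R (\<psi> s) = l + s"
    and smooth_inverse: "Ck_on n {- \<epsilon><..<\<epsilon>} \<psi>"

lemma circle_smooth_has_derivative:
  "circle_smooth R \<Longrightarrow> (R has_real_derivative vderiv R y) (at y)"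
  using Ck_on_has_vector_derivative[of 0 UNIV R]
  by (simp add: circle_smooth_iff has_real_derivative_iff_has_vector_derivative)

text \<open>Lets two branches be shrunk to a common range of \<open>s\<close>.\<close>

lemma branch_mono: "branch R l y0 \<delta> \<epsilon> \<psi> \<Longrightarrow> 0 < \<epsilon>' \<Longrightarrow> \<epsilon>' \<le> \<epsilon> \<Longrightarrow> branch R l y0 \<delta> \<epsilon>' \<psi>"
  unfolding branch_def by (auto intro: Ck_on_subset)

text \<open>The one-dimensional inverse function theorem with explicit ranges: the sign of
  \<open>R'\<close> gives injectivity, the intermediate value theorem surjectivity, and
  \<open>Ck_on_inverse_function\<close> smoothness.\<close>

lemma branch_exists:
  assumes R: "circle_smooth R" and y0: "R y0 = l" "vderiv R y0 \<noteq> 0"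
  shows "\<exists>\<delta> \<epsilon> \<psi>. branch R l y0 \<delta> \<epsilon> \<psi>"
proof -
  have cont: "continuous_on X (vderiv R)" "continuous_on X R" for X
    by (intro continuous_circle_smooth circle_smooth_vderiv R)+
  note D = circle_smooth_has_derivative[OF R]
  define \<sigma> where "\<sigma> = sgn (vderiv R y0)"
  have \<sigma>: "\<sigma> = 1 \<or> \<sigma> = - 1" using y0(2) by (auto simp: \<sigma>_def sgn_real_def)
  obtain \<delta> where \<delta>: "0 < \<delta>" "\<delta> < pi" "\<And>y. y \<in> {y0 - \<delta>..y0 + \<delta>} \<Longrightarrow> \<sigma> * vderiv R y > 0"
    unfolding \<sigma>_def
    by (rule derivative_sign_near[OF cont(1) y0(2) pi_gt_zero]) (use that in blast)
  define c d where "c = y0 - \<delta>" "d = y0 + \<delta>"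
  have mono: "\<sigma> * R x < \<sigma> * R y" if "c \<le> x" "x < y" "y \<le> d" for x y
    using that \<delta>(3) by (intro derivative_sign_strict_mono[of c d R "vderiv R"] D) (auto simp: c_d_def)
  have inj: "x = y" if "x \<in> {c..d}" "y \<in> {c..d}" "R x = R y" for x y
    using mono[of x y] mono[of y x] that by (cases x y rule: linorder_cases) auto
  \<comment> \<open>The smaller of the changes of \<open>R\<close> from \<open>y0\<close> to either
    end: every level closer to \<open>l\<close> than this is attained strictly inside the
    interval.\<close>
  define \<epsilon> where "\<epsilon> = min (\<sigma> * l - \<sigma> * R c) (\<sigma> * R d - \<sigma> * l)"
  have \<epsilon>: "0 < \<epsilon>" using mono[of c y0] mono[of y0 d] \<delta>(1) y0(1) by (auto simp: \<epsilon>_def c_d_def)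
  have surj: "\<exists>y. c < y \<and> y < d \<and> R y = l + s" if s: "\<bar>s\<bar> < \<epsilon>" for s
  proof -
    have \<sigma>s: "\<bar>\<sigma> * s\<bar> < \<epsilon>" using s \<sigma> by auto
    have "\<sigma> * R c < \<sigma> * (l + s)" "\<sigma> * (l + s) < \<sigma> * R d"
      using \<sigma>s unfolding \<epsilon>_def distrib_left by linarith+
    moreover have "continuous_on {c..d} (\<lambda>y. \<sigma> * R y)" by (intro continuous_intros cont)
    ultimately obtain y where y: "c \<le> y" "y \<le> d" "\<sigma> * R y = \<sigma> * (l + s)"
      using IVT'[of "\<lambda>y. \<sigma> * R y" c "\<sigma> * (l + s)" d] \<delta>(1) by (auto simp: c_d_def)
    then have "R y = l + s" using \<sigma> by auto
    moreover have "y \<noteq> c" "y \<noteq> d" using y(3) \<open>\<sigma> * R c < _\<close> \<open>_ < \<sigma> * R d\<close> by auto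
    ultimately show ?thesis using y by (intro exI[of _ y]) auto
  qed
  define \<psi> where "\<psi> s = (SOME y. c < y \<and> y < d \<and> R y = l + s)" for s
  have \<psi>: "c < \<psi> s" "\<psi> s < d" "R (\<psi> s) = l + s" if "\<bar>s\<bar> < \<epsilon>" for s
    using someI_ex[OF surj[OF that]] by (auto simp: \<psi>_def)
  have D\<psi>: "(\<psi> has_real_derivative inverse (vderiv R (\<psi> s))) (at s)" if s: "s \<in> {- \<epsilon><..<\<epsilon>}" for s
  proof (rule DERIV_inverse_function[where f = "\<lambda>y. R y - l"])
    have s': "\<bar>s\<bar> < \<epsilon>" using s by auto
    show "((\<lambda>y. R y - l) has_real_derivative vderiv R (\<psi> s)) (at (\<psi> s))"
      by (auto intro!: derivative_eq_intros D)
    show "vderiv R (\<psi> s) \<noteq> 0" using \<delta>(3)[of "\<psi> s"] \<psi>[OF s'] by (auto simp: c_d_def)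
    show "- \<epsilon> < s" "s < \<epsilon>" using s by auto
    show "R (\<psi> t) - l = t" if "- \<epsilon> < t" "t < \<epsilon>" for t using \<psi>(3)[of t] that by simp
    \<comment> \<open>Continuity of \<psi> at \<open>s\<close> needs a neighbourhood of
      \<open>\<psi> s\<close> on which \<psi> is a left inverse, so it has to stay inside the
      interval and inside |R - l| < \<epsilon>.\<close>
    have "open ({c<..<d} \<inter> (\<lambda>y. \<bar>R y - l\<bar>) -` {..<\<epsilon>})"
      by (intro open_Int open_vimage open_greaterThanLessThan open_lessThan continuous_intros cont)
    moreover have "\<psi> s \<in> {c<..<d} \<inter> (\<lambda>y. \<bar>R y - l\<bar>) -` {..<\<epsilon>}" using \<psi>[OF s'] s' by simp
    ultimately obtain e where e: "e > 0" "cball (\<psi> s) e \<subseteq> {c<..<d} \<inter> (\<lambda>y. \<bar>R y - l\<bar>) -` {..<\<epsilon>}"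
      by (meson open_contains_cball)
    have "isCont \<psi> (R (\<psi> s) - l)"
    proof (rule isCont_inverse_function[where f = "\<lambda>y. R y - l", OF e(1)])
      fix z assume "\<bar>z - \<psi> s\<bar> \<le> e"
      then have "z \<in> cball (\<psi> s) e" by (simp add: dist_real_def abs_minus_commute)
      then have z: "c < z" "z < d" "\<bar>R z - l\<bar> < \<epsilon>" using e(2) by auto
      show "\<psi> (R z - l) = z" by (rule inj) (use \<psi>[OF z(3)] z in auto)
      show "isCont (\<lambda>y. R y - l) z" using DERIV_isCont[OF D] by (intro continuous_intros)
    qed
    then show "isCont \<psi> s" using \<psi>(3)[OF s'] by simp
  qed
  have "Ck_on n {- \<epsilon><..<\<epsilon>} \<psi>" for n
  proof (rule Ck_on_inverse_function[of _ UNIV R])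
    show "vderiv R (\<psi> s) \<noteq> 0" if "s \<in> {- \<epsilon><..<\<epsilon>}" for s
    proof -
      have "\<bar>s\<bar> < \<epsilon>" using that by auto
      from \<delta>(3)[of "\<psi> s"] \<psi>[OF this] show ?thesis by (auto simp: c_d_def)
    qed
    show "(\<psi> has_vector_derivative inverse (vderiv R (\<psi> s))) (at s)" if "s \<in> {- \<epsilon><..<\<epsilon>}" for s
      using D\<psi>[OF that] by (simp only: has_real_derivative_iff_has_vector_derivative)
  qed (use R in \<open>auto simp: circle_smooth_iff\<close>)
  note Ck = this
  have "branch R l y0 \<delta> \<epsilon> \<psi>"
  proof unfold_locales
    show "circle_smooth R" "0 < \<delta>" "\<delta> < pi" "0 < \<epsilon>" "R y0 = l" by (rule R \<delta> \<epsilon> y0)+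
    show "0 < sgn (vderiv R y0) * vderiv R y" if "y \<in> {y0 - \<delta>..y0 + \<delta>}" for y
      using \<delta>(3)[OF that] by (simp only: \<sigma>_def)
    show "\<epsilon> \<le> \<bar>R (y0 - \<delta>) - l\<bar>" "\<epsilon> \<le> \<bar>R (y0 + \<delta>) - l\<bar>"
      using \<sigma> by (auto simp: \<epsilon>_def c_d_def)
    show "\<psi> s \<in> {y0 - \<delta>..y0 + \<delta>}" "R (\<psi> s) = l + s" if "\<bar>s\<bar> < \<epsilon>" for s
      using \<psi>[OF that] by (simp_all add: c_d_def)
    show "Ck_on n {- \<epsilon><..<\<epsilon>} \<psi>" for n by (rule Ck)
  qed
  then show ?thesis by blast
qed

text \<open>Comparing cosines is a periodic way to say that \<open>y\<close> lies within \<delta> of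
  \<open>y0\<close> on the circle, so no representative has to be chosen. The data \<open>l\<close>,
  \<open>y0\<close>, \<delta> describe the target arc; \<psi> belongs to the source and finds the
  point with the same \<open>s\<close>.\<close>

definition transfer ::
    "(real \<Rightarrow> real) \<Rightarrow> (real \<Rightarrow> real) \<Rightarrow> real \<Rightarrow> real \<Rightarrow> real \<Rightarrow> (real \<Rightarrow> real) \<Rightarrow> (real \<Rightarrow> complex) \<Rightarrow> real \<Rightarrow> complex" where
  "transfer R \<beta> l y0 \<delta> \<psi> u y =
     (if cos (y - y0) > cos \<delta> then of_real (\<beta> (R y - l) * \<bar>vderiv R y\<bar>) * u (\<psi> (R y - l)) else 0)"

lemma transfer_add:
  "transfer R \<beta> l y0 \<delta> \<psi> (\<lambda>y. u y + v y) y = transfer R \<beta> l y0 \<delta> \<psi> u y + transfer R \<beta> l y0 \<delta> \<psi> v y"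
  by (simp add: transfer_def distrib_left)

lemma transfer_scale:
  "transfer R \<beta> l y0 \<delta> \<psi> (\<lambda>y. a * u y) y = a * transfer R \<beta> l y0 \<delta> \<psi> u y"
  by (simp add: transfer_def)

lemma mod_2pi_near:
  obtains k :: int where "\<bar>y + of_int k * (2 * pi) - y0\<bar> \<le> pi"
proof -
  define j where "j = \<lfloor>(y - y0 + pi) / (2 * pi)\<rfloor>"
  have "of_int j \<le> (y - y0 + pi) / (2 * pi)" "(y - y0 + pi) / (2 * pi) < of_int j + 1"
    unfolding j_def by linarith+
  then have "of_int j * (2 * pi) \<le> y - y0 + pi" "y - y0 + pi < (of_int j + 1) * (2 * pi)"
    by (simp_all only: pos_le_divide_eq pos_divide_less_eq pi_gt_zero zero_less_mult_iff zero_less_numeral simp_thms)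
  then have "\<bar>y + of_int (- j) * (2 * pi) - y0\<bar> \<le> pi"
    unfolding abs_le_iff distrib_right of_int_minus mult_minus_left mult_1 by linarith
  then show thesis by (rule that)
qed

context branch
begin

lemma periodic: "R (y + of_int k * (2 * pi)) = R y" "vderiv R (y + of_int k * (2 * pi)) = vderiv R y"
proof -
  interpret R: periodic_fun_simple R "2 * pi"
    using smooth_R by unfold_locales (auto simp: circle_smooth_iff)
  interpret R': periodic_fun_simple "vderiv R" "2 * pi"
    using circle_smooth_vderiv[OF smooth_R] by unfold_locales (auto simp: circle_smooth_iff)
  show "R (y + of_int k * (2 * pi)) = R y" "vderiv R (y + of_int k * (2 * pi)) = vderiv R y"
    by (rule R.plus_of_int R'.plus_of_int)+
qed

lemma has_derivative_R: "(R has_real_derivative vderiv R y) (at y)"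
  by (rule circle_smooth_has_derivative[OF smooth_R])

lemma continuous: "continuous_on X R" "continuous_on X (vderiv R)"
  by (intro continuous_circle_smooth circle_smooth_vderiv smooth_R)+

lemma inj: "x \<in> {y0 - \<delta>..y0 + \<delta>} \<Longrightarrow> y \<in> {y0 - \<delta>..y0 + \<delta>} \<Longrightarrow> R x = R y \<Longrightarrow> x = y"
  using inj_onD[OF derivative_sign_inj_on[where H = R and H' = "vderiv R", OF has_derivative_R sign]]
  by blast

lemma left_inverse: "y \<in> {y0 - \<delta>..y0 + \<delta>} \<Longrightarrow> \<bar>R y - l\<bar> < \<epsilon> \<Longrightarrow> \<psi> (R y - l) = y"
  by (rule inj) (use inverse[of "R y - l"] in auto)

lemma cos_shift: "cos (y + of_int k * (2 * pi) - y0) = cos (y - y0)"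
proof -
  have "y + of_int k * (2 * pi) - y0 = (y - y0) + of_int k * (2 * pi)" by simp
  then show ?thesis using cos.plus_of_int[of "y - y0" k] by (simp only: of_real_eq_id id_apply)
qed

lemma cos_abs_diff: "cos \<bar>y - y0\<bar> = cos (y - y0)"
  by simp

lemma arc_iff: "\<bar>y - y0\<bar> \<le> pi \<Longrightarrow> cos (y - y0) > cos \<delta> \<longleftrightarrow> \<bar>y - y0\<bar> < \<delta>"
  using cos_mono_less_eq[of \<delta> "\<bar>y - y0\<bar>"] delta by (simp add: cos_abs_diff)

lemma arc_representative:
  assumes "cos (y - y0) > cos \<delta>"
  obtains k :: int where "\<bar>y + of_int k * (2 * pi) - y0\<bar> < \<delta>"
proof -
  obtain k :: int where k: "\<bar>y + of_int k * (2 * pi) - y0\<bar> \<le> pi" by (rule mod_2pi_near)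
  with arc_iff[OF k] assms show thesis by (intro that[of k]) (simp add: cos_shift)
qed

text \<open>On the arc the absolute value of \<open>R'\<close> is a fixed sign times
  \<open>R'\<close>, and so as smooth as \<open>R'\<close>.\<close>

lemma sign_arc:
  assumes "cos (y - y0) > cos \<delta>" shows "\<bar>vderiv R y\<bar> = sgn (vderiv R y0) * vderiv R y"
proof -
  obtain k :: int where k: "\<bar>y + of_int k * (2 * pi) - y0\<bar> < \<delta>"
    by (rule arc_representative[OF assms])
  then have "sgn (vderiv R y0) * vderiv R (y + of_int k * (2 * pi)) > 0"
    by (intro sign) (auto simp: abs_less_iff)
  then have "sgn (vderiv R y0) * vderiv R y > 0" by (simp add: periodic)
  then show ?thesis by (auto simp: sgn_real_def split: if_splits)
qed

text \<open>At the ends of the arc the bump of width \<epsilon>/2 has already vanished, so the case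
  distinction in \<open>transfer\<close> creates no jump.\<close>

lemma arc_boundary:
  assumes "cos (y - y0) = cos \<delta>" shows "\<epsilon> \<le> \<bar>R y - l\<bar>"
proof -
  obtain k :: int where k: "\<bar>y + of_int k * (2 * pi) - y0\<bar> \<le> pi" by (rule mod_2pi_near)
  have "cos \<bar>y + of_int k * (2 * pi) - y0\<bar> = cos \<delta>" by (simp add: cos_abs_diff cos_shift assms)
  then have "\<bar>y + of_int k * (2 * pi) - y0\<bar> = \<delta>"
    using k delta by (metis abs_ge_zero cos_inj_pi less_imp_le)
  then have "y + of_int k * (2 * pi) = y0 + \<delta> \<or> y + of_int k * (2 * pi) = y0 - \<delta>" by linarith
  then show ?thesis using ends periodic(1)[of y k] by auto
qed

lemma transfer_smooth:
  assumes u: "circle_smooth u" and \<psi>': "\<And>n. Ck_on n {- \<epsilon><..<\<epsilon>} \<psi>'"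
  shows "circle_smooth (transfer R (bump (\<epsilon> / 2)) l y0 \<delta> \<psi>' u)" (is "circle_smooth ?G")
proof -
  have per: "?G (y + 2 * pi) = ?G y" for y
    using periodic[of y 1] cos_shift[of y 1] by (simp add: transfer_def)
  have "Ck_on n UNIV ?G" for n
  proof -
    \<comment> \<open>\<open>A\<close> carries the smooth formula, while \<open>transfer\<close> is
      zero on \<open>B\<close> and \<open>C\<close>. The boundary of the arc lies in
      \<open>C\<close>, and |s| < \<epsilon> overlaps |s| > \<epsilon>/2: this is why the bump has
      half the width of the coordinate range.\<close>
    define A where "A = {y. cos (y - y0) > cos \<delta> \<and> \<bar>R y - l\<bar> < \<epsilon>}"
    define B where "B = {y. cos (y - y0) < cos \<delta>}"
    define C where "C = {y. \<epsilon> / 2 < \<bar>R y - l\<bar>}"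
    have openA: "open A" unfolding A_def
      by (intro open_Collect_conj open_Collect_less continuous_intros continuous)
    have "open (B \<union> C)" unfolding B_def C_def
      by (intro open_Un open_Collect_less continuous_intros continuous)
    moreover have "?G y = 0" if "y \<in> B \<union> C" for y
      using that eps bump_zero[of "\<epsilon> / 2" "R y - l"] by (auto simp: B_def C_def transfer_def)
    ultimately have BC: "Ck_on n (B \<union> C) ?G"
      by (intro Ck_on_cong[OF _ Ck_on_const[of n _ 0]]) auto
    have "Ck_on n A R" using smooth_R by (auto simp: circle_smooth_iff intro: Ck_on_subset[OF _ subset_UNIV])
    then have s: "Ck_on n A (\<lambda>y. R y + (- l))" by (rule Ck_on_add[OF openA _ Ck_on_const])
    have "Ck_on n A (\<lambda>y. of_real (bump (\<epsilon> / 2) (R y + (- l)) * (sgn (vderiv R y0) * vderiv R y))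
        * u (\<psi>' (R y + (- l))))"
    proof (intro Ck_on_mult[OF openA] Ck_on_of_real[OF openA] Ck_on_const)
      show "Ck_on n A (\<lambda>y. bump (\<epsilon> / 2) (R y + - l))"
        by (rule Ck_on_compose[OF openA open_UNIV Ck_on_bump s]) simp
      show "Ck_on n A (vderiv R)"
        using circle_smooth_vderiv[OF smooth_R] by (auto simp: circle_smooth_iff intro: Ck_on_subset[OF _ subset_UNIV])
      have c: "Ck_on n A (\<lambda>y. \<psi>' (R y + - l))"
        by (rule Ck_on_compose[OF openA _ \<psi>' s]) (auto simp: A_def)
      have "Ck_on n UNIV u" using u by (simp add: circle_smooth_iff)
      then show "Ck_on n A (\<lambda>y. u (\<psi>' (R y + - l)))"
        by (rule Ck_on_compose[OF openA open_UNIV _ c]) simp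
    qed
    then have A: "Ck_on n A ?G"
      by (rule Ck_on_cong[OF openA]) (auto simp: A_def transfer_def sign_arc)
    have "y \<in> A \<union> (B \<union> C)" for y
      using arc_boundary[of y] eps
      by (cases "cos (y - y0)" "cos \<delta>" rule: linorder_cases) (auto simp: A_def B_def C_def)
    then show ?thesis using Ck_on_Un[OF A BC] by (auto intro: Ck_on_subset)
  qed
  then show ?thesis using per by (simp add: circle_smooth_iff)
qed

text \<open>The substitution s = R(y) - l absorbs the weight |R'|. Up to conjugation the result is
  unchanged when \<open>u\<close> and \<open>v\<close> are swapped together with the branches, which
  yields the adjoint.\<close>

lemma integral_transfer:
  assumes u: "circle_smooth u" and v: "circle_smooth v" and \<psi>': "\<And>n. Ck_on n {- \<epsilon><..<\<epsilon>} \<psi>'"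
  shows "integral {0..2*pi} (\<lambda>y. cnj (v y) * transfer R (bump (\<epsilon> / 2)) l y0 \<delta> \<psi>' u y)
    = integral {- \<epsilon>..\<epsilon>} (\<lambda>s. of_real (bump (\<epsilon> / 2) s) * (cnj (v (\<psi> s)) * u (\<psi>' s)))"
proof -
  define F where "F y = cnj (v y) * transfer R (bump (\<epsilon> / 2)) l y0 \<delta> \<psi>' u y" for y
  define G where "G s = of_real (bump (\<epsilon> / 2) s) * (cnj (v (\<psi> s)) * u (\<psi>' s))" for s
  define \<sigma> where "\<sigma> = sgn (vderiv R y0)"
  have \<sigma>: "\<sigma> = 1 \<or> \<sigma> = - 1" using sign[of y0] delta by (auto simp: \<sigma>_def sgn_real_def split: if_splits)
  note tr = transfer_smooth[OF u \<psi>']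
  have contF: "continuous_on X F" for X
    unfolding F_def by (intro continuous_intros continuous_circle_smooth v tr)
  have perF: "F (y + 2 * pi) = F y" for y
    using v tr by (simp add: F_def circle_smooth_iff)
  have G0: "G s = 0" if "\<epsilon> / 2 \<le> \<bar>s\<bar>" for s
    using that eps bump_zero[of "\<epsilon> / 2" s] by (simp add: G_def)
  have contG: "continuous_on X G" for X
  proof -
    have "continuous_on {- \<epsilon><..<\<epsilon>} G"
      unfolding G_def using Ck_on_continuous_on[OF Ck_on_bump]
      by (intro continuous_intros continuous_on_compose2[OF continuous_circle_smooth[OF u, of UNIV]]
          continuous_on_compose2[OF continuous_circle_smooth[OF v, of UNIV]]
          Ck_on_continuous_on[OF smooth_inverse] Ck_on_continuous_on[OF \<psi>'])
        (auto intro: continuous_on_subset)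
    moreover have "open {s. \<epsilon> / 2 < \<bar>s\<bar>}" by (intro open_Collect_less continuous_intros)
    moreover have "continuous_on {s. \<epsilon> / 2 < \<bar>s\<bar>} G"
      by (subst continuous_on_cong[OF refl, of _ _ "\<lambda>_. 0"]) (auto intro: G0)
    ultimately have "continuous_on ({- \<epsilon><..<\<epsilon>} \<union> {s. \<epsilon> / 2 < \<bar>s\<bar>}) G"
      by (intro continuous_on_open_Un) auto
    then show ?thesis by (rule continuous_on_subset) (use eps in auto)
  qed
  define c d where "c = y0 - \<delta>" "d = y0 + \<delta>"
  have F_eq: "F y = \<sigma> *\<^sub>R (vderiv R y *\<^sub>R G (R y - l))" if y: "y \<in> {c..d}" for y
  proof (cases "\<bar>R y - l\<bar> < \<epsilon>")
    case True
    have "\<bar>y - y0\<bar> \<le> \<delta>" using y by (auto simp: c_d_def abs_le_iff)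
    moreover have "\<bar>y - y0\<bar> \<noteq> \<delta>"
    proof
      assume "\<bar>y - y0\<bar> = \<delta>"
      then have "y = y0 + \<delta> \<or> y = y0 - \<delta>" by linarith
      with True ends show False by auto
    qed
    ultimately have "\<bar>y - y0\<bar> < \<delta>" by simp
    then have arc: "cos (y - y0) > cos \<delta>" using delta by (subst arc_iff) auto
    have "\<psi> (R y - l) = y" using True y by (intro left_inverse) (auto simp: c_d_def)
    with arc show ?thesis
      by (simp add: F_def G_def transfer_def sign_arc \<sigma>_def scaleR_conv_of_real mult_ac)
  next
    case False
    then have "G (R y - l) = 0" "bump (\<epsilon> / 2) (R y - l) = 0"
      using eps G0[of "R y - l"] bump_zero[of "\<epsilon> / 2" "R y - l"] by auto
    then show ?thesis by (simp add: F_def transfer_def)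
  qed
  \<comment> \<open>A substitution valid for either monotonicity of \<open>R\<close>: it returns the
    integral between the end values with orientation, as a difference of two integrals.\<close>
  have sub: "((\<lambda>y. vderiv R y *\<^sub>R G (R y - l)) has_integral
      integral {R c - l..R d - l} G - integral {R d - l..R c - l} G) {c..d}"
  proof -
    have "compact ((\<lambda>y. R y - l) ` {c..d})"
      by (intro compact_continuous_image continuous_intros continuous compact_Icc)
    then have "bounded ((\<lambda>y. R y - l) ` {c..d})" by (rule compact_imp_bounded)
    then obtain M where "\<forall>y\<in>{c..d}. \<bar>R y - l\<bar> \<le> M"
      unfolding bounded_iff by auto
    then have M: "\<bar>R y - l\<bar> \<le> M" if "y \<in> {c..d}" for y using that by blast
    have "(\<lambda>y. R y - l) ` {c..d} \<subseteq> {- M..M}"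
    proof clarify
      fix y assume "y \<in> {c..d}"
      from M[OF this] show "R y - l \<in> {- M..M}" by (simp add: abs_le_iff minus_le_iff)
    qed
    then show ?thesis
      using delta
      by (intro has_integral_substitution_general[of "{}" _ _ _ "- M" M] contG continuous_intros continuous)
        (auto simp: c_d_def intro!: derivative_eq_intros DERIV_subset[OF has_derivative_R])
  qed
  have Gint: "integral {a..b} G = integral {- \<epsilon>..\<epsilon>} G" if "a \<le> - \<epsilon>" "\<epsilon> \<le> b" for a b
  proof (rule integral_unique, rule has_integral_on_superset)
    show "(G has_integral integral {- \<epsilon>..\<epsilon>} G) {- \<epsilon>..\<epsilon>}"
      by (intro integrable_integral integrable_continuous_real contG)
  qed (use that eps in \<open>auto intro!: G0\<close>)
  \<comment> \<open>One of the two integrals runs over an empty interval; \<sigma> corrects the sign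
    when \<open>R\<close> decreases.\<close>
  have "\<sigma> *\<^sub>R (integral {R c - l..R d - l} G - integral {R d - l..R c - l} G) = integral {- \<epsilon>..\<epsilon>} G"
  proof -
    have mono: "\<sigma> * R x < \<sigma> * R y" if "c \<le> x" "x < y" "y \<le> d" for x y
      using that sign
      by (intro derivative_sign_strict_mono[of c d R "vderiv R"] has_derivative_R) (auto simp: c_d_def \<sigma>_def)
    have cd: "\<sigma> * R c < \<sigma> * l" "\<sigma> * l < \<sigma> * R d"
      using mono[of c y0] mono[of y0 d] delta level by (auto simp: c_d_def)
    have e: "\<epsilon> \<le> \<bar>R c - l\<bar>" "\<epsilon> \<le> \<bar>R d - l\<bar>" using ends by (auto simp: c_d_def)
    from \<sigma> show ?thesis
    proof
      assume [simp]: "\<sigma> = 1"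
      have "R c - l \<le> - \<epsilon>" "\<epsilon> \<le> R d - l" using cd e by auto
      then show ?thesis using Gint[of "R c - l" "R d - l"] eps by simp
    next
      assume [simp]: "\<sigma> = - 1"
      have "R d - l \<le> - \<epsilon>" "\<epsilon> \<le> R c - l" using cd e by auto
      then show ?thesis using Gint[of "R d - l" "R c - l"] eps by simp
    qed
  qed
  then have "((\<lambda>y. \<sigma> *\<^sub>R (vderiv R y *\<^sub>R G (R y - l))) has_integral integral {- \<epsilon>..\<epsilon>} G) {c..d}"
    using has_integral_cmul[OF sub, of \<sigma>] by simp
  then have "(F has_integral integral {- \<epsilon>..\<epsilon>} G) {c..d}"
    by (rule has_integral_eq[rotated]) (simp add: F_eq)
  \<comment> \<open>The period is centred at \<open>y0\<close>, so that the arc is not cut by its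
    ends; periodicity returns to the standard one afterwards.\<close>
  moreover have "{c..d} \<subseteq> {y0 - pi..y0 - pi + 2 * pi}" using delta by (auto simp: c_d_def)
  ultimately have "((\<lambda>y. if y \<in> {c..d} then F y else 0) has_integral integral {- \<epsilon>..\<epsilon>} G) {y0 - pi..y0 - pi + 2 * pi}"
    by (simp only: has_integral_restrict)
  then have "(F has_integral integral {- \<epsilon>..\<epsilon>} G) {y0 - pi..y0 - pi + 2 * pi}"
  proof (rule has_integral_eq[rotated])
    fix y assume y: "y \<in> {y0 - pi..y0 - pi + 2 * pi}"
    show "(if y \<in> {c..d} then F y else 0) = F y"
    proof (cases "y \<in> {c..d}")
      case False
      then have "\<bar>y - y0\<bar> \<le> pi" "\<not> \<bar>y - y0\<bar> < \<delta>"
        using y by (auto simp: c_d_def abs_le_iff abs_less_iff)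
      then show ?thesis using arc_iff[of y] False by (simp add: F_def transfer_def)
    qed simp
  qed
  then have "integral {y0 - pi..y0 - pi + 2 * pi} F = integral {- \<epsilon>..\<epsilon>} G"
    by (rule integral_unique)
  moreover have "integral {y0 - pi..y0 - pi + 2 * pi} F = integral {0..2 * pi} F"
    by (rule integral_period[OF contF perF]) simp
  ultimately show ?thesis by (simp only: F_def[abs_def] G_def[abs_def])
qed

end

section \<open>Operators between two fibres, their adjoints and their values on the constraint
  points\<close>

section \<open>Observables that connect two points of the constraint surface\<close>

lemma inner_aux_single_mode:
  assumes w: "circle_smooth w" and h: "h \<in> \<Phi>"
  shows "inner_aux (test_fun (single_mode m w)) h = 2 * of_real pi * integral {0..2*pi} (\<lambda>y. cnj (w y) * mode h m y)"
proof -
  have "inner_aux (test_fun (single_mode m w)) (test_fun (mode h))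
      = 2 * of_real pi * (\<Sum>n\<in>{m}. integral {0..2*pi} (\<lambda>y. cnj (single_mode m w n y) * mode h n y))"
    by (rule inner_aux_test_fun[OF single_mode_in_modes[OF w] mode_in_modes[OF h]])
      (auto simp: single_mode_def)
  then show ?thesis by (simp add: test_fun_mode[OF h] single_mode_def)
qed

lemma mode_test_fun_single_mode:
  "circle_smooth w \<Longrightarrow> mode (test_fun (single_mode m w)) n y = (if n = m then w y else 0)"
  by (simp add: mode_test_fun single_mode_in_modes) (simp add: single_mode_def)

lemma circle_smooth_mode: "f \<in> \<Phi> \<Longrightarrow> circle_smooth (mode f m)"
  by (rule modesD(1)[OF mode_in_modes])

text \<open>The common \<epsilon> gives source \<open>(m, y0)\<close> and target
  \<open>(m', y0')\<close> the same range of \<open>s\<close>; exchanging the two branches gives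
  another instance of the locale.\<close>

locale two_branches =
  p: branch R "(of_int m)\<^sup>2" y0 \<delta> \<epsilon> \<psi> + p': branch R "(of_int m')\<^sup>2" y0' \<delta>' \<epsilon> \<psi>'
  for R :: "real \<Rightarrow> real" and m m' :: int and y0 y0' \<delta> \<delta>' \<epsilon> :: real and \<psi> \<psi>' :: "real \<Rightarrow> real"
begin

definition fibre_map :: "(real \<Rightarrow> complex) \<Rightarrow> real \<Rightarrow> complex" where
  "fibre_map = transfer R (bump (\<epsilon> / 2)) ((of_int m')\<^sup>2) y0' \<delta>' \<psi>"

definition fibre_op :: "aux_space \<Rightarrow> aux_space" where
  "fibre_op f = test_fun (single_mode m' (fibre_map (mode f m)))"

lemma fibre_map_smooth: "circle_smooth u \<Longrightarrow> circle_smooth (fibre_map u)"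
  unfolding fibre_map_def by (rule p'.transfer_smooth[OF _ p.smooth_inverse])

lemma fibre_op_in_test_space: "f \<in> \<Phi> \<Longrightarrow> fibre_op f \<in> \<Phi>"
  unfolding fibre_op_def
  by (intro test_fun_in_test_space single_mode_in_modes fibre_map_smooth circle_smooth_mode)

lemma mode_fibre_op: "f \<in> \<Phi> \<Longrightarrow> mode (fibre_op f) n y = (if n = m' then fibre_map (mode f m) y else 0)"
  unfolding fibre_op_def by (rule mode_test_fun_single_mode[OF fibre_map_smooth[OF circle_smooth_mode]])

lemma fibre_op_add:
  assumes "f \<in> \<Phi>" "g \<in> \<Phi>" shows "fibre_op (f + g) = fibre_op f + fibre_op g"
proof -
  have "single_mode m' (fibre_map (mode (f + g) m))
      = (\<lambda>n y. single_mode m' (fibre_map (mode f m)) n y + single_mode m' (fibre_map (mode g m)) n y)"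
    by (simp add: mode_add[OF assms] fibre_map_def transfer_add single_mode_def fun_eq_iff)
  then show ?thesis
    using assms unfolding fibre_op_def
    by (simp add: test_fun_add single_mode_in_modes fibre_map_smooth circle_smooth_mode)
qed

lemma fibre_op_scale:
  assumes "f \<in> \<Phi>" shows "fibre_op (a *\<^sub>C f) = a *\<^sub>C fibre_op f"
proof -
  have "single_mode m' (fibre_map (mode (a *\<^sub>C f) m))
      = (\<lambda>n y. a * single_mode m' (fibre_map (mode f m)) n y)"
    by (simp add: mode_scale[OF assms] fibre_map_def transfer_scale single_mode_def fun_eq_iff)
  then show ?thesis
    using assms unfolding fibre_op_def
    by (simp add: test_fun_scale single_mode_in_modes fibre_map_smooth circle_smooth_mode)
qed

text \<open>
  The inverse branch over \<open>m\<close> satisfies \<open>m\<^sup>2 - R (\<psi> s) = - s\<close>, and so does the one over \<open>m'\<close>, so the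
  phase picked up at the two ends is the same.
\<close>

lemma fibre_op_evolve:
  assumes "f \<in> \<Phi>" shows "fibre_op (evolve R t f) = evolve R t (fibre_op f)"
proof -
  have "fibre_map (mode (evolve R t f) m) y
      = exp (- \<i> * of_real (t * ((of_int m')\<^sup>2 - R y))) * fibre_map (mode f m) y" for y
  proof (cases "\<bar>R y - (of_int m')\<^sup>2\<bar> < \<epsilon>")
    case True
    then show ?thesis
      using p.inverse(2)[OF True]
      by (simp add: fibre_map_def transfer_def mode_evolve[OF p.smooth_R assms] evolve_modes_def)
  next
    case False
    then have "bump (\<epsilon> / 2) (R y - (of_int m')\<^sup>2) = 0"
      using p.eps by (intro bump_zero) auto
    then show ?thesis by (simp add: fibre_map_def transfer_def)
  qed
  then have "single_mode m' (fibre_map (mode (evolve R t f) m))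
      = evolve_modes R t (single_mode m' (fibre_map (mode f m)))"
    by (simp add: single_mode_def evolve_modes_def fun_eq_iff)
  then show ?thesis
    using assms
    by (simp add: fibre_op_def evolve_def mode_test_fun single_mode_in_modes fibre_map_smooth circle_smooth_mode)
qed

end

text \<open>The adjoint is the operator of the exchanged branches: both matrix elements reduce to
  the same integral over \<open>s\<close>, because the bump is real.\<close>

lemma (in two_branches) fibre_op_adjoint:
  assumes f: "f \<in> \<Phi>" and g: "g \<in> \<Phi>"
  shows "inner_aux g (fibre_op f) = inner_aux (two_branches.fibre_op R m' m y0 \<delta> \<epsilon> \<psi>' g) f"
proof -
  interpret adj: two_branches R m' m y0' y0 \<delta>' \<delta> \<epsilon> \<psi>' \<psi> by unfold_locales
  let ?u = "mode f m" and ?v = "mode g m'"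
  let ?I = "integral {- \<epsilon>..\<epsilon>} (\<lambda>s. of_real (bump (\<epsilon> / 2) s) * (cnj (?v (\<psi>' s)) * ?u (\<psi> s)))"
  note u = circle_smooth_mode[OF f, of m] and v = circle_smooth_mode[OF g, of m']
  have "integral {0..2*pi} (\<lambda>y. cnj (?v y) * fibre_map ?u y) = ?I"
    unfolding fibre_map_def by (rule p'.integral_transfer[OF u v p.smooth_inverse])
  then have "cnj (integral {0..2*pi} (\<lambda>y. cnj (fibre_map ?u y) * ?v y)) = ?I"
    by (simp add: integral_cnj mult.commute)
  then have 1: "inner_aux g (fibre_op f) = 2 * of_real pi * ?I"
    by (subst inner_aux_commute)
      (simp add: fibre_op_def inner_aux_single_mode[OF fibre_map_smooth[OF u] g])
  have "integral {0..2*pi} (\<lambda>y. cnj (?u y) * adj.fibre_map ?v y)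
      = integral {- \<epsilon>..\<epsilon>} (\<lambda>s. of_real (bump (\<epsilon> / 2) s) * (cnj (?u (\<psi> s)) * ?v (\<psi>' s)))"
    unfolding adj.fibre_map_def by (rule p.integral_transfer[OF v u p'.smooth_inverse])
  then have "cnj (integral {0..2*pi} (\<lambda>y. cnj (?u y) * adj.fibre_map ?v y)) = ?I"
    by (simp add: integral_cnj mult.commute)
  then have "integral {0..2*pi} (\<lambda>y. cnj (adj.fibre_map ?v y) * ?u y) = ?I"
    by (simp add: integral_cnj mult.commute)
  then have "inner_aux (adj.fibre_op g) f = 2 * of_real pi * ?I"
    by (simp add: adj.fibre_op_def inner_aux_single_mode[OF adj.fibre_map_smooth[OF v] f])
  with 1 show ?thesis by simp
qed

text \<open>The domain is \<Phi> exactly. Its density serves twice: as the density condition on the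
  operator and for the uniqueness of the adjoint value.\<close>

lemma (in two_branches) fibre_op_observable:
  "(\<lambda>\<phi>. if \<phi> \<in> \<Phi> then Some (fibre_op \<phi>) else None) \<in> observables R" (is "?T \<in> _")
proof -
  interpret adj: two_branches R m' m y0' y0 \<delta>' \<delta> \<epsilon> \<psi>' \<psi> by unfold_locales
  have dom: "dom ?T = \<Phi>" by (auto simp: dom_def)
  have adjoint: "adjoint_op ?T g = Some (adj.fibre_op g)" if "g \<in> \<Phi>" for g
    by (rule adjoint_op_eqI) (simp_all add: dom closure_test_space fibre_op_adjoint that)
  have "aux.subspace \<Phi>"
    by (intro aux.subspaceI zero_in_test_space add_test_space scale_test_space)
  then have "linear_operator ?T"
    unfolding linear_operator_def dom
    by (simp add: fibre_op_add fibre_op_scale add_test_space scale_test_space)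
  then show ?thesis
    unfolding observables_def
    by (auto simp: dom closure_test_space adjoint fibre_op_in_test_space adj.fibre_op_in_test_space
        fibre_op_evolve evolve_in_test_space p.smooth_R dom_def[of "adjoint_op ?T"])
qed

text \<open>On the level itself s = 0 and the source point is \<open>y0\<close>. By injectivity of
  \<open>R\<close> on the target arc no other solution on that level lies in it.\<close>

lemma (in two_branches) fibre_map_at_level:
  assumes "y0' \<in> {0..<2*pi}" "z \<in> {0..<2*pi}" "R z = (of_int m')\<^sup>2"
  shows "fibre_map u z = (if z = y0' then of_real (bump (\<epsilon> / 2) 0 * \<bar>vderiv R y0'\<bar>) * u y0 else 0)"
proof -
  have \<psi>0: "\<psi> 0 = y0"
    using p.left_inverse[of y0] p.level p.delta p.eps by simp
  have "cos (z - y0') > cos \<delta>' \<longleftrightarrow> z = y0'"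
  proof
    assume "cos (z - y0') > cos \<delta>'"
    then obtain k :: int where k: "\<bar>z + of_int k * (2 * pi) - y0'\<bar> < \<delta>'"
      by (rule p'.arc_representative)
    have "z + of_int k * (2 * pi) = y0'"
      by (rule p'.inj) (use k p'.delta p'.level p'.periodic(1) assms(3) in \<open>auto simp: abs_less_iff\<close>)
    \<comment> \<open>Two points of the same half-open period differ by less than 2 pi.\<close>
    then have "\<bar>of_int k * (2 * pi)\<bar> < 1 * (2 * pi)" using assms by auto
    then have "\<bar>real_of_int k\<bar> < 1" by (simp add: abs_mult)
    then have "k = 0" by linarith
    with \<open>z + _ = y0'\<close> show "z = y0'" by simp
  next
    assume "z = y0'"
    then show "cos (z - y0') > cos \<delta>'" using p'.delta by (subst p'.arc_iff) auto
  qed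
  then show ?thesis using assms(3) p'.level \<psi>0 by (simp add: fibre_map_def transfer_def)
qed

text \<open>On the values at the constraint points, \<open>T\<close> acts as a nonzero multiple of
  the matrix unit from \<open>(m, y0)\<close> to \<open>(m', y0')\<close>; irreducibility rests on
  having all of these.\<close>

lemma connecting_observable:
  assumes R: "circle_smooth R"
    and p: "R y0 = (of_int m)\<^sup>2" "vderiv R y0 \<noteq> 0"
    and p': "y0' \<in> {0..<2*pi}" "R y0' = (of_int m')\<^sup>2" "vderiv R y0' \<noteq> 0"
  shows "\<exists>T\<in>observables R. \<exists>a. a \<noteq> 0 \<and> (\<forall>f\<in>\<Phi>. the (T f) \<in> \<Phi> \<and> (\<forall>n z. z \<in> {0..<2*pi} \<longrightarrow> R z = (of_int n)\<^sup>2 \<longrightarrow>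
    mode (the (T f)) n z = (if n = m' \<and> z = y0' then a * mode f m y0 else 0)))"
proof -
  obtain \<delta> \<epsilon> \<psi> where b: "branch R ((of_int m)\<^sup>2) y0 \<delta> \<epsilon> \<psi>"
    using branch_exists[OF R p] by blast
  obtain \<delta>' \<epsilon>' \<psi>' where b': "branch R ((of_int m')\<^sup>2) y0' \<delta>' \<epsilon>' \<psi>'"
    using branch_exists[OF R p'(2,3)] by blast
  define e where "e = min \<epsilon> \<epsilon>'"
  have e: "0 < e" "e \<le> \<epsilon>" "e \<le> \<epsilon>'" using branch.eps[OF b] branch.eps[OF b'] by (auto simp: e_def)
  interpret two_branches R m m' y0 y0' \<delta> \<delta>' e \<psi> \<psi>'
    using branch_mono[OF b e(1,2)] branch_mono[OF b' e(1,3)] by (simp add: two_branches_def)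
  let ?T = "\<lambda>\<phi>. if \<phi> \<in> \<Phi> then Some (fibre_op \<phi>) else None"
  let ?a = "complex_of_real (bump (e / 2) 0 * \<bar>vderiv R y0'\<bar>)"
  have "?a \<noteq> 0" using bump_0_pos[of "e / 2"] e(1) p'(3) by simp
  moreover have "the (?T f) \<in> \<Phi> \<and> (\<forall>n z. z \<in> {0..<2*pi} \<longrightarrow> R z = (of_int n)\<^sup>2 \<longrightarrow>
    mode (the (?T f)) n z = (if n = m' \<and> z = y0' then ?a * mode f m y0 else 0))" if "f \<in> \<Phi>" for f
    using that by (auto simp: fibre_op_in_test_space mode_fibre_op fibre_map_at_level[OF p'(1)])
  ultimately show ?thesis
    by (intro bexI[OF _ fibre_op_observable] exI[of _ ?a]) simp
qed

section \<open>Evaluations at the constraint points as a spanning set, and irreducibility\<close>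

section \<open>The physical Hilbert space\<close>

text \<open>A solution of \<open>q\<^sup>2 = R(y)\<close> with q > 0 is counted twice, for the modes
  q and -q.\<close>

definition constraint_points :: "(real \<Rightarrow> real) \<Rightarrow> (int \<times> real) set" where
  "constraint_points R = {(m, y). y \<in> {0..<2*pi} \<and> R y = (of_int m)\<^sup>2}"

definition evaluation :: "int \<times> real \<Rightarrow> aux_space \<Rightarrow> complex" where
  "evaluation p = (\<lambda>g. if g \<in> \<Phi> then mode g (fst p) (snd p) else 0)"

text \<open>\<open>R\<close> is bounded and |m| \<le> m^2 for integers, so finitely many modes
  occur; each level is regular and hence finite.\<close>

lemma finite_constraint_points:
  assumes R: "circle_smooth R" and reg: "\<forall>(m::int) y. R y = (of_int m)\<^sup>2 \<longrightarrow> vderiv R y \<noteq> 0"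
  shows "finite (constraint_points R)"
proof -
  have "bounded (R ` {0..2*pi})"
    by (intro compact_imp_bounded compact_continuous_image continuous_circle_smooth R compact_Icc)
  then obtain B where "\<forall>y\<in>{0..2*pi}. \<bar>R y\<bar> \<le> B" unfolding bounded_iff by auto
  then have B: "\<bar>R y\<bar> \<le> B" if "y \<in> {0..2*pi}" for y using that by blast
  have m: "m \<in> {- \<lceil>B\<rceil>..\<lceil>B\<rceil>}" if "y \<in> {0..2*pi}" "R y = (of_int m)\<^sup>2" for m :: int and y
  proof -
    have "of_int \<bar>m\<bar> \<le> (of_int (m\<^sup>2) :: real)"
      unfolding of_int_le_iff using self_le_power[of "\<bar>m\<bar>" 2] by (cases "m = 0") auto
    also have "\<dots> \<le> B" using B[OF that(1)] that(2) by simp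
    finally have "\<bar>m\<bar> \<le> \<lceil>B\<rceil>" by linarith
    then show ?thesis by auto
  qed
  have "finite {y \<in> {0..2*pi}. R y = (of_int m)\<^sup>2}" for m :: int
    using circle_smooth_has_derivative[OF R] continuous_circle_smooth[OF circle_smooth_vderiv[OF R]] reg
    by (intro finite_regular_level_set[where H' = "vderiv R"]) auto
  then have "finite (SIGMA m:{- \<lceil>B\<rceil>..\<lceil>B\<rceil>}. {y \<in> {0..2*pi}. R y = (of_int m)\<^sup>2})"
    by (intro finite_SigmaI) auto
  moreover have "constraint_points R \<subseteq> (SIGMA m:{- \<lceil>B\<rceil>..\<lceil>B\<rceil>}. {y \<in> {0..2*pi}. R y = (of_int m)\<^sup>2})"
  proof
    fix p assume p: "p \<in> constraint_points R"
    obtain a b where ab: "p = (a, b)" by (cases p)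
    with p have "b \<in> {0..2*pi}" "R b = (of_int a)\<^sup>2" by (auto simp: constraint_points_def)
    with m[OF this] show "p \<in> (SIGMA m:{- \<lceil>B\<rceil>..\<lceil>B\<rceil>}. {y \<in> {0..2*pi}. R y = (of_int m)\<^sup>2})"
      unfolding ab by blast
  qed
  ultimately show ?thesis by (rule finite_subset[rotated])
qed

lemma sum_constraint_points:
  fixes h :: "int \<Rightarrow> real \<Rightarrow> complex"
  assumes fin: "finite (constraint_points R)" and S: "finite S" "\<And>m y. m \<notin> S \<Longrightarrow> h m y = 0"
  shows "(\<Sum>m\<in>S. \<Sum>y | y \<in> {0..<2*pi} \<and> R y = (of_int m)\<^sup>2. h m y) = (\<Sum>(m, y)\<in>constraint_points R. h m y)"
proof -
  have "finite {y. y \<in> {0..<2*pi} \<and> R y = (of_int m)\<^sup>2}" for m :: int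
  proof (rule finite_subset[OF _ finite_imageI[OF fin, of snd]], rule subsetI)
    fix y assume "y \<in> {y. y \<in> {0..<2*pi} \<and> R y = (of_int m)\<^sup>2}"
    then have "(m, y) \<in> constraint_points R" by (simp add: constraint_points_def)
    then show "y \<in> snd ` constraint_points R" by (rule rev_image_eqI) simp
  qed
  then have "(\<Sum>m\<in>S. \<Sum>y | y \<in> {0..<2*pi} \<and> R y = (of_int m)\<^sup>2. h m y)
      = (\<Sum>(m, y)\<in>(SIGMA m:S. {y. y \<in> {0..<2*pi} \<and> R y = (of_int m)\<^sup>2}). h m y)"
    by (intro sum.Sigma S) auto
  also have "\<dots> = (\<Sum>(m, y)\<in>constraint_points R. h m y)"
  proof (rule sum.mono_neutral_left[OF fin])
    show "\<forall>p\<in>constraint_points R - (SIGMA m:S. {y. y \<in> {0..<2*pi} \<and> R y = (of_int m)\<^sup>2}).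
      (case p of (m, y) \<Rightarrow> h m y) = 0"
    proof
      fix p assume p: "p \<in> constraint_points R - (SIGMA m:S. {y. y \<in> {0..<2*pi} \<and> R y = (of_int m)\<^sup>2})"
      obtain m y where my: "p = (m, y)" by (cases p)
      with p have "m \<notin> S" by (auto simp: constraint_points_def)
      then show "(case p of (m, y) \<Rightarrow> h m y) = 0" by (simp add: my S(2))
    qed
  qed (simp add: constraint_points_def subset_iff)
  finally show ?thesis .
qed

lemma eta_eq_constraint_points:
  assumes fin: "finite (constraint_points R)" and f: "f \<in> \<Phi>" and g: "g \<in> \<Phi>"
  shows "eta R f g = of_real ((2*pi)\<^sup>2) *
    (\<Sum>(m, y)\<in>constraint_points R. cnj (mode f m y) * mode g m y / of_real \<bar>vderiv R y\<bar>)"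
proof -
  have S: "finite {m. mode f m \<noteq> (\<lambda>_. 0)}" by (rule modesD(2)[OF mode_in_modes[OF f]])
  show ?thesis
    unfolding eta_eq_sum[OF g S order_refl]
    by (subst sum_constraint_points[OF fin S]) auto
qed

lemma eta_eq_evaluation:
  assumes fin: "finite (constraint_points R)" and f: "f \<in> \<Phi>"
  shows "eta R f = (\<Sum>p\<in>constraint_points R.
    scale_fun (of_real ((2*pi)\<^sup>2) * cnj (mode f (fst p) (snd p)) / of_real \<bar>vderiv R (snd p)\<bar>) (evaluation p))"
proof
  fix g
  have sum_fun: "(\<Sum>p\<in>P. F p) g = (\<Sum>p\<in>P. F p g)" for P and F :: "int \<times> real \<Rightarrow> aux_space \<Rightarrow> complex"
    by (induction P rule: infinite_finite_induct) (simp_all add: zero_fun_def plus_fun_def)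
  show "eta R f g = (\<Sum>p\<in>constraint_points R.
    scale_fun (of_real ((2*pi)\<^sup>2) * cnj (mode f (fst p) (snd p)) / of_real \<bar>vderiv R (snd p)\<bar>) (evaluation p)) g"
  proof (cases "g \<in> \<Phi>")
    case True
    then show ?thesis
      unfolding sum_fun eta_eq_constraint_points[OF fin f True] sum_distrib_left
      by (intro sum.cong) (auto simp: scale_fun_def evaluation_def)
  next
    case False
    then show ?thesis unfolding sum_fun by (simp add: eta_def scale_fun_def evaluation_def)
  qed
qed

lemma antilinear_eta:
  assumes fin: "finite (constraint_points R)"
  shows "antilinear_map (eta R)"
  unfolding antilinear_map_def
proof (intro conjI ballI allI ext)
  fix f g h assume f: "f \<in> \<Phi>" and g: "g \<in> \<Phi>"
  show "eta R (f + g) h = (eta R f + eta R g) h"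
  proof (cases "h \<in> \<Phi>")
    case True
    then show ?thesis
      unfolding plus_fun_def eta_eq_constraint_points[OF fin f True] eta_eq_constraint_points[OF fin g True]
        eta_eq_constraint_points[OF fin add_test_space[OF f g] True] mode_add[OF f g]
      by (simp add: case_prod_unfold distrib_right distrib_left add_divide_distrib sum.distrib)
  qed (simp add: eta_def plus_fun_def)
next
  fix a f h assume f: "f \<in> \<Phi>"
  show "eta R (a *\<^sub>C f) h = scale_fun (cnj a) (eta R f) h"
  proof (cases "h \<in> \<Phi>")
    case True
    then show ?thesis
      unfolding scale_fun_def eta_eq_constraint_points[OF fin f True]
        eta_eq_constraint_points[OF fin scale_test_space[OF f] True] mode_scale[OF f]
      by (simp add: sum_distrib_left case_prod_unfold mult_ac)
  qed (simp add: eta_def scale_fun_def)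
qed

lemma eta_in_dual:
  assumes fin: "finite (constraint_points R)" and f: "f \<in> \<Phi>"
  shows "eta R f \<in> dual"
  unfolding dual_def
proof (intro CollectI conjI ballI allI impI)
  fix g h assume g: "g \<in> \<Phi>" and h: "h \<in> \<Phi>"
  show "eta R f (g + h) = eta R f g + eta R f h"
    unfolding eta_eq_constraint_points[OF fin f g] eta_eq_constraint_points[OF fin f h]
      eta_eq_constraint_points[OF fin f add_test_space[OF g h]] mode_add[OF g h]
    by (simp add: case_prod_unfold distrib_left add_divide_distrib sum.distrib)
next
  fix a g assume g: "g \<in> \<Phi>"
  show "eta R f (a *\<^sub>C g) = a * eta R f g"
    unfolding eta_eq_constraint_points[OF fin f g]
      eta_eq_constraint_points[OF fin f scale_test_space[OF g]] mode_scale[OF g]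
    by (simp add: sum_distrib_left case_prod_unfold mult_ac)
qed (simp add: eta_def)

lemma rigging_map_eta:
  assumes R: "circle_smooth R" and reg: "\<forall>(m::int) y. R y = (of_int m)\<^sup>2 \<longrightarrow> vderiv R y \<noteq> 0"
  shows "rigging_map R (eta R)"
  unfolding rigging_map_def
proof (intro conjI allI ballI)
  note fin = finite_constraint_points[OF R reg]
  note eta = eta_eq_constraint_points[OF fin]
  show "eta R ` \<Phi> \<subseteq> dual" using eta_in_dual[OF fin] by blast
  show "antilinear_map (eta R)" by (rule antilinear_eta[OF fin])
  show "eta R f g = cnj (eta R g f)" if "f \<in> \<Phi>" "g \<in> \<Phi>" for f g
    using that by (simp add: eta case_prod_unfold cnj_sum mult.commute)
  show "eta R f f \<in> \<real>\<^sub>\<ge>\<^sub>0" if "f \<in> \<Phi>" for f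
  proof -
    have sq: "cnj z * z = of_real ((cmod z)\<^sup>2)" for z
      by (simp only: complex_norm_square mult.commute)
    have "eta R f f = of_real ((2*pi)\<^sup>2 * (\<Sum>(m, y)\<in>constraint_points R. (cmod (mode f m y))\<^sup>2 / \<bar>vderiv R y\<bar>))"
      unfolding eta[OF that that]
      by (simp only: case_prod_unfold sq of_real_mult of_real_sum of_real_divide)
    also have "\<dots> \<in> \<real>\<^sub>\<ge>\<^sub>0"
      unfolding nonneg_Reals_of_real_iff case_prod_unfold by (intro mult_nonneg_nonneg sum_nonneg) auto
    finally show ?thesis .
  qed
  \<comment> \<open>At a constraint point \<open>m\<^sup>2 - R(y)\<close> is zero, so every phase is
    1.\<close>
  show "eta R f (evolve R t g) = eta R f g" if "f \<in> \<Phi>" "g \<in> \<Phi>" for t f g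
    unfolding eta[OF that(1) evolve_in_test_space[OF R that(2)]] eta[OF that]
    by (intro arg_cong2[of _ _ _ _ "(*)"] refl sum.cong)
      (auto simp: constraint_points_def mode_evolve[OF R that(2)] evolve_modes_def)
  show "eta R (the (T f)) g = eta R f (the (adjoint_op T g))"
    if "T \<in> observables R" "f \<in> \<Phi>" "g \<in> \<Phi>" for T f g
    by (rule eta_intertwining[OF R _ that]) (use reg in blast)
qed

lemma eta_concentrated:
  assumes fin: "finite (constraint_points R)" and p: "p \<in> constraint_points R" and f: "f \<in> \<Phi>"
    and m: "\<And>q. q \<in> constraint_points R \<Longrightarrow> mode f (fst q) (snd q) = (if q = p then a else 0)"
  shows "eta R f = scale_fun (of_real ((2*pi)\<^sup>2) * cnj a / of_real \<bar>vderiv R (snd p)\<bar>) (evaluation p)"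
proof -
  have "eta R f = (\<Sum>q\<in>constraint_points R. if q = p
    then scale_fun (of_real ((2*pi)\<^sup>2) * cnj a / of_real \<bar>vderiv R (snd p)\<bar>) (evaluation p) else 0)"
    unfolding eta_eq_evaluation[OF fin f]
    by (intro sum.cong refl) (simp add: m scale_fun_def zero_fun_def)
  then show ?thesis using fin p by simp
qed

text \<open>The connecting observable sends \<open>eta R f\<close> to a multiple of the evaluation
  at \<open>q\<close>, with a factor that is nonzero because \<open>f\<close> does not vanish at the
  source point.\<close>

lemma evaluation_in_invariant_subspace:
  assumes R: "circle_smooth R" and reg: "\<forall>(m::int) y. R y = (of_int m)\<^sup>2 \<longrightarrow> vderiv R y \<noteq> 0"
    and V: "invariant_subspace R (eta R) V"
    and f: "f \<in> \<Phi>" "eta R f \<in> V" and p: "(m, y) \<in> constraint_points R" "mode f m y \<noteq> 0"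
    and q: "q \<in> constraint_points R"
  shows "evaluation q \<in> V"
proof -
  note fin = finite_constraint_points[OF R reg]
  obtain m' y' where q': "q = (m', y')" by (cases q)
  have py: "R y = (of_int m)\<^sup>2" and qy: "y' \<in> {0..<2*pi}" "R y' = (of_int m')\<^sup>2"
    using p q by (auto simp: constraint_points_def q')
  obtain T a where T: "T \<in> observables R" "a \<noteq> 0" "the (T f) \<in> \<Phi>"
    "\<And>n z. z \<in> {0..<2*pi} \<Longrightarrow> R z = (of_int n)\<^sup>2 \<Longrightarrow>
      mode (the (T f)) n z = (if n = m' \<and> z = y' then a * mode f m y else 0)"
    using connecting_observable[OF R py reg[rule_format, OF py] qy reg[rule_format, OF qy(2)]] f(1) by blast
  define k where "k = complex_of_real ((2*pi)\<^sup>2) * cnj (a * mode f m y) / of_real \<bar>vderiv R y'\<bar>"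
  have "eta R (the (T f)) = scale_fun k (evaluation q)"
    using eta_concentrated[OF fin q T(3), of "a * mode f m y"] T(4)
    by (auto simp: k_def q' constraint_points_def)
  moreover have "eta R (the (T f)) \<in> V" using V T(1) f by (auto simp: invariant_subspace_def)
  ultimately have "scale_fun k (evaluation q) \<in> V" by (simp only:)
  moreover have "functional.subspace V" using V by (simp add: invariant_subspace_def)
  ultimately have "scale_fun (inverse k) (scale_fun k (evaluation q)) \<in> V"
    by (rule functional.subspace_scale[rotated])
  \<comment> \<open>Regularity enters since division by a vanishing derivative would give 0.\<close>
  moreover have "k \<noteq> 0" using T(2) p(2) reg[rule_format, OF qy(2)] by (simp add: k_def)
  ultimately show ?thesis by (simp add: functional.scale_scale)
qed

lemma subspace_eta_image:
  assumes fin: "finite (constraint_points R)"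
  shows "functional.subspace (eta R ` \<Phi>)"
proof (rule functional.subspaceI)
  note lin = antilinear_eta[OF fin, unfolded antilinear_map_def]
  show "0 \<in> eta R ` \<Phi>"
  proof (rule image_eqI[OF _ zero_in_test_space])
    have "eta R (0 *\<^sub>C 0) = scale_fun (cnj 0) (eta R 0)" using lin zero_in_test_space by blast
    then show "0 = eta R 0" by simp
  qed
  show "\<xi> + \<zeta> \<in> eta R ` \<Phi>" if "\<xi> \<in> eta R ` \<Phi>" "\<zeta> \<in> eta R ` \<Phi>" for \<xi> \<zeta>
  proof -
    from that obtain f g where "f \<in> \<Phi>" "g \<in> \<Phi>" "\<xi> = eta R f" "\<zeta> = eta R g" by blast
    then show ?thesis using lin add_test_space by (intro image_eqI[of _ _ "f + g"]) auto
  qed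
  show "scale_fun a \<xi> \<in> eta R ` \<Phi>" if "\<xi> \<in> eta R ` \<Phi>" for a \<xi>
  proof -
    from that obtain f where "f \<in> \<Phi>" "\<xi> = eta R f" by blast
    then show ?thesis using lin scale_test_space by (intro image_eqI[of _ _ "cnj a *\<^sub>C f"]) auto
  qed
qed

lemma eta_image_subset:
  assumes fin: "finite (constraint_points R)" and V: "functional.subspace V"
    and ev: "\<And>q. q \<in> constraint_points R \<Longrightarrow> evaluation q \<in> V"
  shows "eta R ` \<Phi> \<subseteq> V"
proof clarify
  fix f assume "f \<in> \<Phi>"
  then show "eta R f \<in> V"
    unfolding eta_eq_evaluation[OF fin \<open>f \<in> \<Phi>\<close>]
    by (intro functional.subspace_sum V functional.subspace_scale ev)
qed

text \<open>The whole image is itself invariant, so the preceding argument applies to it, with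
  \<open>q\<close> as both source and target and a pure exponential as the function that is nonzero
  there.\<close>

lemma evaluation_in_eta_image:
  assumes R: "circle_smooth R" and reg: "\<forall>(m::int) y. R y = (of_int m)\<^sup>2 \<longrightarrow> vderiv R y \<noteq> 0"
    and q: "q \<in> constraint_points R"
  shows "evaluation q \<in> eta R ` \<Phi>"
proof -
  obtain m y where q': "q = (m, y)" by (cases q)
  define f where "f = test_fun (single_mode m (\<lambda>_. 1))"
  have f: "f \<in> \<Phi>"
    unfolding f_def by (intro test_fun_in_test_space single_mode_in_modes circle_smooth_const)
  have "mode f m y = 1"
    unfolding f_def by (subst mode_test_fun_single_mode[OF circle_smooth_const]) simp
  moreover have "invariant_subspace R (eta R) (eta R ` \<Phi>)"
    using subspace_eta_image[OF finite_constraint_points[OF R reg]]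
    by (auto simp: invariant_subspace_def observables_def)
  ultimately show ?thesis
    using f q evaluation_in_invariant_subspace[OF R reg, of "eta R ` \<Phi>" f m y q]
    by (simp add: q')
qed

lemma evaluation_nonzero:
  "evaluation q \<noteq> 0"
proof -
  define f where "f = test_fun (single_mode (fst q) (\<lambda>_. 1))"
  have "f \<in> \<Phi>"
    unfolding f_def by (intro test_fun_in_test_space single_mode_in_modes circle_smooth_const)
  moreover have "mode f (fst q) (snd q) = 1"
    unfolding f_def by (subst mode_test_fun_single_mode[OF circle_smooth_const]) simp
  ultimately have "evaluation q f \<noteq> 0 f" by (simp add: evaluation_def zero_fun_def)
  then show ?thesis by metis
qed

theorem mainTheorem1:
  fixes R :: "real \<Rightarrow> real"
  assumes "standing_assumptions R"
    and "\<exists>(q::nat) y. (of_nat q)\<^sup>2 = R y"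
    and "\<And>(q::nat) y. (of_nat q)\<^sup>2 = R y \<Longrightarrow> vderiv R y \<noteq> 0"
  shows "rigging_map R (eta R)
    \<and> eta R ` \<Phi> \<noteq> {0} \<and> finite_dimensional (eta R ` \<Phi>)
    \<and> irreducible_representation R (eta R)"
proof (intro conjI)
  have R: "circle_smooth R" using assms(1) by (simp add: standing_assumptions_def)
  have reg: "\<forall>(m::int) y. R y = (of_int m)\<^sup>2 \<longrightarrow> vderiv R y \<noteq> 0"
  proof (intro allI impI)
    fix m :: int and y assume "R y = (of_int m)\<^sup>2"
    \<comment> \<open>Modes carry signs while the hypothesis speaks of natural numbers; the absolute
      value mediates.\<close>
    then show "vderiv R y \<noteq> 0" using assms(3)[of "nat \<bar>m\<bar>" y] by (simp add: of_nat_nat)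
  qed
  note fin = finite_constraint_points[OF R reg]
  note ev = evaluation_in_eta_image[OF R reg]
  note sub = subspace_eta_image[OF fin]
  show "rigging_map R (eta R)" by (rule rigging_map_eta[OF R reg])
  obtain q :: nat and y where "(of_nat q)\<^sup>2 = R y" using assms(2) by blast
  moreover obtain k :: int where k: "\<bar>y + of_int k * (2 * pi) - pi\<bar> \<le> pi" by (rule mod_2pi_near)
  interpret periodic_fun_simple R "2 * pi"
    using R by unfold_locales (auto simp: circle_smooth_iff)
  \<comment> \<open>The representative within pi of pi lies in the closed period, so the end point 2
    pi has to be sent to 0.\<close>
  define z where "z = (if y + of_int k * (2 * pi) = 2 * pi then 0 else y + of_int k * (2 * pi))"
  have "R z = R y"
    using plus_of_int[of y k] plus_of_int[of 0 1] by (auto simp: z_def)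
  moreover have "z \<in> {0..<2*pi}" using k by (auto simp: z_def abs_le_iff)
  ultimately have p: "(int q, z) \<in> constraint_points R" by (simp add: constraint_points_def)
  show "eta R ` \<Phi> \<noteq> {0}" using ev[OF p] evaluation_nonzero by blast
  show "finite_dimensional (eta R ` \<Phi>)"
    unfolding finite_dimensional_def
  proof (intro exI conjI)
    show "finite (evaluation ` constraint_points R)" using fin by simp
    show "eta R ` \<Phi> = functional.span (evaluation ` constraint_points R)"
    proof
      show "eta R ` \<Phi> \<subseteq> functional.span (evaluation ` constraint_points R)"
        by (intro eta_image_subset[OF fin] functional.subspace_span functional.span_base imageI)
      show "functional.span (evaluation ` constraint_points R) \<subseteq> eta R ` \<Phi>"
        using ev by (intro functional.span_minimal sub) auto
    qed
  qed
  show "irreducible_representation R (eta R)"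
    unfolding irreducible_representation_def
  proof (intro allI impI)
    fix V assume V: "invariant_subspace R (eta R) V \<and> V \<noteq> {0}"
    then have V1: "functional.subspace V" "V \<subseteq> eta R ` \<Phi>"
      by (simp_all add: invariant_subspace_def)
    have "0 \<in> V" by (rule functional.subspace_0[OF V1(1)])
    then obtain \<xi> where "\<xi> \<in> V" "\<xi> \<noteq> 0" using V by blast
    then obtain f where f: "f \<in> \<Phi>" "eta R f \<in> V" "eta R f \<noteq> 0" using V1(2) by blast
    have "\<exists>(m, y)\<in>constraint_points R. mode f m y \<noteq> 0"
    proof (rule ccontr)
      assume "\<not> ?thesis"
      then have "eta R f = 0"
        unfolding eta_eq_evaluation[OF fin f(1)]
        by (intro sum.neutral) (auto simp: scale_fun_def zero_fun_def)
      with f(3) show False by contradiction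
    qed
    then obtain m y where my: "(m, y) \<in> constraint_points R" "mode f m y \<noteq> 0" by blast
    have "eta R ` \<Phi> \<subseteq> V"
      by (intro eta_image_subset[OF fin V1(1)]
          evaluation_in_invariant_subspace[OF R reg V[THEN conjunct1] f(1,2) my])
    with V1(2) show "V = eta R ` \<Phi>" by blast
  qed
qed

end
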